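(* For a locally convex space $E$ the following are equivalent: (i) $E$ contains no bounded $l^1$-sequence; (ii) $E$ is tame; (iii) every weak-star compact, equicontinuous, convex subset $M\subseteq E^*$ equals the closure, in the strong topology of $E^*$, of the convex hull of its set of extreme points; (iv) for every weak-star compact equicontinuous $T\subseteq E^*$, $\overline{{\rm co}}^{w^*}(T)=\overline{{\rm co}}(T)$, where $\overline{{\rm co}}^{w^*}$ denotes the weak-star closed convex hull and $\overline{{\rm co}}$ the strongly closed convex hull.
   Context: The strong topology on $E^*$ is the topology of uniform convergence on bounded subsets of $E$. ${\rm eqc}(E^* )$: equicontinuous weak-star compact subsets of $E^*$. A sequence of real functions $(f_n)$ on a set is independent if there are $a<b$ with $\bigcap_{n\in P} f_n^{-1}(-\infty,a)\cap\bigcap_{n\in M} f_n^{-1}(b,\infty)\neq\emptyset$ for all finite disjoint $P,M\subseteq\mathbb N$; a bounded family is tame if it has no independent sequence. $E$ is tame if for every bounded $B\subseteq E$ and every $K\in{\rm eqc}(E^* )$ the family $\{\varphi\mapsto\varphi(b)\}_{b\in B}$ on $K$ is tame. An $l^1$-sequence is a bounded sequence $(x_n)$ with a continuous seminorm $\rho$ and $\delta>0$ such that $\delta\sum_{i\le n}|c_i|\le\rho(\sum_{i\le n}c_ix_i)$ for all $n$ and reals $c_i$. *)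

theory Defs
  imports "HOL-Analysis.Analysis" "HOL-Library.Function_Algebras"
begin

instantiation "fun" :: (type, real_vector) real_vector
begin
definition scaleR_fun :: "real \<Rightarrow> ('a \<Rightarrow> 'b) \<Rightarrow> 'a \<Rightarrow> 'b"
  where "scaleR_fun r f = (\<lambda>x. r *\<^sub>R f x)"
instance
  by intro_classes (auto simp: scaleR_fun_def plus_fun_def fun_eq_iff scaleR_add_right scaleR_add_left)
end

definition seminorm :: "('a::real_vector \<Rightarrow> real) \<Rightarrow> bool" where
  "seminorm p \<longleftrightarrow> (\<forall>x y. p (x + y) \<le> p x + p y) \<and> (\<forall>c x. p (c *\<^sub>R x) = \<bar>c\<bar> * p x)"

definition seminorm_topology :: "('a::real_vector \<Rightarrow> real) set \<Rightarrow> 'a topology" where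
  "seminorm_topology P = topology (\<lambda>U. \<forall>x\<in>U. \<exists>F. finite F \<and> F \<subseteq> P \<and>
      (\<exists>e>0. {y. \<forall>p\<in>F. p (y - x) < e} \<subseteq> U))"

definition locally_convex_space :: "'a::real_vector topology \<Rightarrow> bool" where
  "locally_convex_space T \<longleftrightarrow> (\<exists>P. (\<forall>p\<in>P. seminorm p) \<and> T = seminorm_topology P)"

definition dual :: "'a::real_vector topology \<Rightarrow> ('a \<Rightarrow> real) set" where
  "dual T = {\<phi>. linear \<phi> \<and> continuous_map T euclideanreal \<phi>}"

definition tvs_bounded :: "'a::real_vector topology \<Rightarrow> 'a set \<Rightarrow> bool" where
  "tvs_bounded T B \<longleftrightarrow> (\<forall>U. openin T U \<and> 0 \<in> U \<longrightarrow>
      (\<exists>s>0. \<forall>t. s < t \<longrightarrow> B \<subseteq> (\<lambda>x. t *\<^sub>R x) ` U))"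

definition equicontinuous_set :: "'a::real_vector topology \<Rightarrow> ('a \<Rightarrow> real) set \<Rightarrow> bool" where
  "equicontinuous_set T K \<longleftrightarrow> (\<forall>e>0. \<exists>U. openin T U \<and> 0 \<in> U \<and>
      (\<forall>\<phi>\<in>K. \<forall>x\<in>U. \<bar>\<phi> x\<bar> < e))"

text \<open>Weak-star topology on E*: topology of pointwise convergence restricted to E*.\<close>
definition weak_star :: "'a::real_vector topology \<Rightarrow> ('a \<Rightarrow> real) topology" where
  "weak_star T = subtopology euclidean (dual T)"

definition eqc :: "'a::real_vector topology \<Rightarrow> ('a \<Rightarrow> real) set set" where
  "eqc T = {K. K \<subseteq> dual T \<and> equicontinuous_set T K \<and> compactin (weak_star T) K}"

definition strong_topology :: "'a::real_vector topology \<Rightarrow> ('a \<Rightarrow> real) topology" where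
  "strong_topology T = topology (\<lambda>U. U \<subseteq> dual T \<and> (\<forall>\<phi>\<in>U. \<exists>B e. tvs_bounded T B \<and> e > 0 \<and>
      {\<psi>\<in>dual T. \<forall>b\<in>B. \<bar>\<psi> b - \<phi> b\<bar> < e} \<subseteq> U))"

definition independent_seq :: "'b set \<Rightarrow> (nat \<Rightarrow> 'b \<Rightarrow> real) \<Rightarrow> bool" where
  "independent_seq K f \<longleftrightarrow> (\<exists>a b. a < b \<and> (\<forall>P M. finite P \<and> finite M \<and> P \<inter> M = {} \<longrightarrow>
      K \<inter> (\<Inter>n\<in>P. {x. f n x < a}) \<inter> (\<Inter>n\<in>M. {x. b < f n x}) \<noteq> {}))"

definition tame_family :: "'b set \<Rightarrow> ('b \<Rightarrow> real) set \<Rightarrow> bool" where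
  "tame_family K F \<longleftrightarrow> \<not> (\<exists>f. range f \<subseteq> F \<and> independent_seq K f)"

definition tame_lcs :: "'a::real_vector topology \<Rightarrow> bool" where
  "tame_lcs T \<longleftrightarrow> (\<forall>B K. tvs_bounded T B \<and> K \<in> eqc T \<longrightarrow>
      tame_family K ((\<lambda>b \<phi>. \<phi> b) ` B))"

definition continuous_seminorm :: "'a::real_vector topology \<Rightarrow> ('a \<Rightarrow> real) \<Rightarrow> bool" where
  "continuous_seminorm T \<rho> \<longleftrightarrow> seminorm \<rho> \<and> continuous_map T euclideanreal \<rho>"

definition l1_sequence :: "'a::real_vector topology \<Rightarrow> (nat \<Rightarrow> 'a) \<Rightarrow> bool" where
  "l1_sequence T x \<longleftrightarrow> tvs_bounded T (range x) \<and>
     (\<exists>\<rho> \<delta>. continuous_seminorm T \<rho> \<and> \<delta> > 0 \<and>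
        (\<forall>n c. \<delta> * (\<Sum>i\<le>n. \<bar>c i\<bar>) \<le> \<rho> (\<Sum>i\<le>n. c i *\<^sub>R x i)))"

end

theory Submission
  imports Defs
begin

text \<open>
  The hard implication is that tameness makes M the strongly closed convex hull of its extreme points.
  If \<open>\<phi>\<close> in M is far from that hull, uniformly on a bounded set, a minimax argument and compactness give
  a pointwise limit h on M of evaluations at points of a bounded convex set B, with
  h \<open>\<ge>\<close> c > h \<open>\<phi>\<close> on the extreme points. Such an h must oscillate, on a suitable relatively
  open set of extreme points of an auxiliary compact convex set, between two fixed levels. Approximating h by elements
  of B at finitely many points at a time produces an independent sequence in B, contradicting
  tameness. No integral representation is needed: the arguments use only caps at extreme points and a
  Baire category argument on the set of extreme points.

  The strong and weak-star closed hulls agree once this is known, by Milman's partial converse. An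
  \<open>l\<^sup>1\<close>-sequence prevents this: its functionals realise all sign patterns, and the
  limit of suitable averages is not a uniform limit of finite convex combinations.
\<close>

section \<open>Compact convex sets of functions\<close>

text \<open>The obstacle is that \<open>h\<close> is affine on M without being continuous: M need
  not be metrizable, so compactness gives a cluster point of evaluations rather than a limit of a
  sequence, and the minimum principle for continuous affine functions does not apply. Closing a
  truncated epigraph replaces \<open>h\<close> by its lower envelope, which extreme points do
  control; truncating below c rules out that envelope and function agree at an extreme point below
  the top level. Extreme points need not form a closed or Borel set, so statements about them are
  phrased through caps, the complements of compact convex subsets. Caps and Leger's argument take
  over the role of boundary measures. The weak-star topology is the product topology restricted to
  the dual, which is why the geometry lives in a product of lines over an arbitrary index type. For
  \<open>l\<^sup>1\<close>-sequences, one limit functional must stay away from all finite convex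
  combinations, of any length and weights. Levels of size \<open>2 ^ k\<close> achieve this: a
  combination of few functionals uses few choices at a large level, and a single number supplies
  choices at all levels by its remainders.\<close>

lemma compact_fun_imp_closed:
  fixes K :: "('i \<Rightarrow> real) set"
  assumes "compact K"
  shows "closed K"
proof -
  have "Hausdorff_space (product_topology (\<lambda>i::'i. euclideanreal) UNIV)"
    by (simp add: Hausdorff_space_product_topology)
  then show ?thesis
    using assms compactin_imp_closedin by (force simp: euclidean_product_topology)
qed

lemma fun_apply_simps [simp]:
  fixes f g :: "'i \<Rightarrow> real"
  shows "(f + g) i = f i + g i" "(f - g) i = f i - g i" "(r *\<^sub>R f) i = r * f i" "(- f) i = - f i"
    "(0 :: 'i \<Rightarrow> real) i = 0"
  by (simp_all add: scaleR_fun_def)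

lemma sum_fun_apply [simp]:
  fixes f :: "'j \<Rightarrow> 'i \<Rightarrow> real"
  shows "(\<Sum>j\<in>S. f j) i = (\<Sum>j\<in>S. f j i)"
  by (induction S rule: infinite_finite_induct) auto

lemma continuous_on_coordinate:
  fixes f :: "'a::topological_space \<Rightarrow> 'i \<Rightarrow> real"
  assumes "continuous_on S f"
  shows "continuous_on S (\<lambda>x. f x i)"
  using assms by (rule continuous_on_product_then_coordinatewise)

definition fun_box :: "('i \<Rightarrow> real) \<Rightarrow> 'i set \<Rightarrow> real \<Rightarrow> ('i \<Rightarrow> real) set" where
  "fun_box e F r = {y. \<forall>i\<in>F. \<bar>y i - e i\<bar> < r}"

lemma open_fun_box: "finite F \<Longrightarrow> open (fun_box e F r)"
  using product_topology_basis'[of F "\<lambda>i. ball (e i) r" "\<lambda>i. i", OF _ open_ball]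
  by (simp add: fun_box_def ball_def dist_real_def abs_minus_commute)

text \<open>Only finitely many factors of a basic open set are proper, so the least of their radii
  serves all of them.\<close>

lemma open_fun_box_subset:
  assumes "open O'" "e \<in> O'"
  obtains F r where "finite F" "r > 0" "fun_box e F r \<subseteq> O'"
proof -
  have "openin (product_topology (\<lambda>i. euclidean) UNIV) O'"
    using assms(1) by (simp add: open_fun_def)
  from product_topology_open_contains_basis[OF this assms(2)]
  obtain X where X: "e \<in> Pi\<^sub>E UNIV X" "\<And>i. open (X i)" "finite {i. X i \<noteq> UNIV}" "Pi\<^sub>E UNIV X \<subseteq> O'"
    by (auto simp flip: open_openin)
  let ?F = "{i. X i \<noteq> UNIV}"
  have "\<exists>r>0. \<forall>z. \<bar>z - e i\<bar> < r \<longrightarrow> z \<in> X i" for i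
    using X(1) X(2)[of i] by (auto simp: open_dist dist_real_def PiE_def Pi_def)
  then obtain r where r: "\<And>i. r i > 0" "\<And>i z. \<bar>z - e i\<bar> < r i \<Longrightarrow> z \<in> X i"
    by metis
  \<comment> \<open>The inserted 1 keeps \<open>Min\<close> defined when no factor is
    proper.\<close>
  define \<rho> where "\<rho> = Min (insert 1 (r ` ?F))"
  have "\<rho> > 0" "\<And>i. i \<in> ?F \<Longrightarrow> \<rho> \<le> r i"
    using X(3) r(1) by (auto simp: \<rho>_def)
  then have "fun_box e ?F \<rho> \<subseteq> O'"
    using X(4) r(2) by (fastforce simp: fun_box_def PiE_def Pi_def)
  then show thesis
    using that X(3) \<open>\<rho> > 0\<close> by blast
qed

lemma in_closure_fun_iff:
  fixes e :: "'i \<Rightarrow> real"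
  shows "e \<in> closure S \<longleftrightarrow> (\<forall>F r. finite F \<and> r > 0 \<longrightarrow> (\<exists>y\<in>S. y \<in> fun_box e F r))"
proof
  assume e: "e \<in> closure S"
  show "\<forall>F r. finite F \<and> r > 0 \<longrightarrow> (\<exists>y\<in>S. y \<in> fun_box e F r)"
  proof (intro allI impI)
    fix F :: "'i set" and r :: real
    assume "finite F \<and> r > 0"
    then have "open (fun_box e F r)" "e \<in> fun_box e F r"
      by (auto simp: open_fun_box) (simp add: fun_box_def)
    then show "\<exists>y\<in>S. y \<in> fun_box e F r"
      using e unfolding closure_iff_nhds_not_empty by blast
  qed
next
  assume *: "\<forall>F r. finite F \<and> r > 0 \<longrightarrow> (\<exists>y\<in>S. y \<in> fun_box e F r)"
  show "e \<in> closure S"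
    unfolding closure_iff_nhds_not_empty
  proof (intro allI impI)
    fix A V assume "V \<subseteq> A" "open V" "e \<in> V"
    then show "S \<inter> A \<noteq> {}"
      using * open_fun_box_subset[of V e] by (metis disjoint_iff subset_eq)
  qed
qed

text \<open>Tychonoff for a product of intervals; a negative \<open>c i\<close> merely makes the set
  empty.\<close>

lemma compact_fun_cbox: "compact {y::'i \<Rightarrow> real. \<forall>i. \<bar>y i\<bar> \<le> c i}"
proof -
  have "compactin (product_topology (\<lambda>i::'i. euclideanreal) UNIV) (PiE UNIV (\<lambda>i. {- c i .. c i}))"
    by (auto simp: compactin_PiE)
  moreover have "PiE UNIV (\<lambda>i. {- c i .. c i}) = {y::'i \<Rightarrow> real. \<forall>i. \<bar>y i\<bar> \<le> c i}"
    by (auto simp: PiE_def Pi_def abs_le_iff)  (smt (verit))+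
  ultimately show ?thesis
    by (simp add: euclidean_product_topology)
qed

lemma closure_convex_fun:
  fixes S :: "('i \<Rightarrow> real) set"
  assumes "convex S"
  shows "convex (closure S)"
  unfolding convex_alt
proof (intro ballI allI impI)
  fix x y :: "'i \<Rightarrow> real" and u :: real
  assume x: "x \<in> closure S" and y: "y \<in> closure S" and u: "0 \<le> u \<and> u \<le> 1"
  show "(1 - u) *\<^sub>R x + u *\<^sub>R y \<in> closure S"
    unfolding in_closure_fun_iff
  proof (intro allI impI)
    fix F :: "'i set" and r :: real
    assume F: "finite F \<and> r > 0"
    obtain x' y' where x': "x' \<in> S" "x' \<in> fun_box x F r" and y': "y' \<in> S" "y' \<in> fun_box y F r"
      using x y F unfolding in_closure_fun_iff by meson
    have "\<bar>((1 - u) * x' i + u * y' i) - ((1 - u) * x i + u * y i)\<bar> < r" if "i \<in> F" for i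
    proof -
      have "\<bar>x' i - x i\<bar> < r" "\<bar>y' i - y i\<bar> < r"
        using x' y' that by (auto simp: fun_box_def)
      then have "(1 - u) * \<bar>x' i - x i\<bar> + u * \<bar>y' i - y i\<bar> < r"
        using u by (intro convex_bound_lt) auto
      moreover have "\<bar>(1 - u) * (x' i - x i) + u * (y' i - y i)\<bar> \<le> (1 - u) * \<bar>x' i - x i\<bar> + u * \<bar>y' i - y i\<bar>"
        using u abs_triangle_ineq[of "(1 - u) * (x' i - x i)" "u * (y' i - y i)"] by (simp add: abs_mult)
      ultimately have "\<bar>(1 - u) * (x' i - x i) + u * (y' i - y i)\<bar> < r"
        by linarith
      then show ?thesis
        by (simp add: algebra_simps)
    qed
    then have "(1 - u) *\<^sub>R x' + u *\<^sub>R y' \<in> fun_box ((1 - u) *\<^sub>R x + u *\<^sub>R y) F r"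
      by (simp add: fun_box_def)
    then show "\<exists>z\<in>S. z \<in> fun_box ((1 - u) *\<^sub>R x + u *\<^sub>R y) F r"
      using assms x'(1) y'(1) u by (metis convex_alt)
  qed
qed

text \<open>A continuous image of a compact product. The interval is left general because the join
  uses \<open>{0..1}\<close> and the mass estimate \<open>{r..1}\<close>.\<close>

lemma compact_convex_combinations:
  fixes K L :: "('i \<Rightarrow> real) set"
  assumes "compact K" "compact L"
  shows "compact {u *\<^sub>R x + (1 - u) *\<^sub>R y |u x y. u \<in> {a..b} \<and> x \<in> K \<and> y \<in> L}"
proof -
  have "continuous_on S (\<lambda>p. fst p * fst (snd p) i + (1 - fst p) * snd (snd p) i)"
    for i and S :: "(real \<times> ('i \<Rightarrow> real) \<times> ('i \<Rightarrow> real)) set"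
    by (intro continuous_on_coordinate[of S "\<lambda>p. fst (snd p)" i]
      continuous_on_coordinate[of S "\<lambda>p. snd (snd p)" i] continuous_intros)
  then have "compact ((\<lambda>p. fst p *\<^sub>R fst (snd p) + (1 - fst p) *\<^sub>R snd (snd p)) ` ({a..b} \<times> K \<times> L))"
    using assms
    by (intro compact_continuous_image compact_Times compact_Icc
        continuous_on_coordinatewise_then_product) simp_all
  also have "(\<lambda>p. fst p *\<^sub>R fst (snd p) + (1 - fst p) *\<^sub>R snd (snd p)) ` ({a..b} \<times> K \<times> L)
    = {u *\<^sub>R x + (1 - u) *\<^sub>R y |u x y. u \<in> {a..b} \<and> x \<in> K \<and> y \<in> L}"
    by (auto simp: image_def) ((intro exI conjI, rule refl, auto), (rule bexI)+, rule refl, auto)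
  finally show ?thesis .
qed

text \<open>The terms from K and those from L are collected separately, and each group is
  renormalised by its total weight.\<close>

lemma convex_convex_combinations:
  fixes K L :: "'v::real_vector set"
  assumes "convex K" "convex L"
  shows "convex {u *\<^sub>R x + (1 - u) *\<^sub>R y |u x y. u \<in> {0..1} \<and> x \<in> K \<and> y \<in> L}"
proof (rule convexI, clarsimp)
  fix s t u v :: real and x y x' y' :: 'v
  assume st: "0 \<le> s" "0 \<le> t" "s + t = 1" and u: "0 \<le> u" "u \<le> 1" and v: "0 \<le> v" "v \<le> 1"
    and K: "x \<in> K" "x' \<in> K" and L: "y \<in> L" "y' \<in> L"
  \<comment> \<open>A total weight of 0 cannot be renormalised, but then any point of
    \<open>C\<close> serves as \<open>z\<close>.\<close>
  have *: "\<exists>z\<in>C. a *\<^sub>R p + b *\<^sub>R q = (a + b) *\<^sub>R z"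
    if "0 \<le> a" "0 \<le> b" "convex C" "p \<in> C" "q \<in> C" for a b p q and C :: "'v set"
  proof (cases "a + b = 0")
    case True
    then have "a = 0" "b = 0" using that by auto
    then show ?thesis using that by auto
  next
    case False
    have "(a / (a + b)) *\<^sub>R p + (b / (a + b)) *\<^sub>R q \<in> C"
      using that False by (intro convexD) (auto simp: divide_simps)
    moreover have "a *\<^sub>R p + b *\<^sub>R q = (a + b) *\<^sub>R ((a / (a + b)) *\<^sub>R p + (b / (a + b)) *\<^sub>R q)"
      using False by (simp add: scaleR_add_right)
    ultimately show ?thesis by blast
  qed
  obtain z where z: "z \<in> K" "(s * u) *\<^sub>R x + (t * v) *\<^sub>R x' = (s * u + t * v) *\<^sub>R z"
    using *[of "s * u" "t * v" K x x'] st u v K assms by auto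
  obtain w where w: "w \<in> L"
      "(s * (1 - u)) *\<^sub>R y + (t * (1 - v)) *\<^sub>R y' = (s * (1 - u) + t * (1 - v)) *\<^sub>R w"
    using *[of "s * (1 - u)" "t * (1 - v)" L y y'] st u v L assms by auto
  have "s * (1 - u) + t * (1 - v) = 1 - (s * u + t * v)"
    using st(3) by (simp add: algebra_simps)
  moreover have "s *\<^sub>R (u *\<^sub>R x + (1 - u) *\<^sub>R y) + t *\<^sub>R (v *\<^sub>R x' + (1 - v) *\<^sub>R y')
     = ((s * u) *\<^sub>R x + (t * v) *\<^sub>R x') + ((s * (1 - u)) *\<^sub>R y + (t * (1 - v)) *\<^sub>R y')"
    by (simp only: scaleR_add_right scaleR_scaleR add_ac)
  ultimately have "s *\<^sub>R (u *\<^sub>R x + (1 - u) *\<^sub>R y) + t *\<^sub>R (v *\<^sub>R x' + (1 - v) *\<^sub>R y')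
     = (s * u + t * v) *\<^sub>R z + (1 - (s * u + t * v)) *\<^sub>R w"
    using z w by simp
  moreover have "0 \<le> s * u + t * v" "s * u + t * v \<le> 1"
    using st u v convex_bound_le[of u 1 v s t] by (auto intro!: add_nonneg_nonneg)
  ultimately show "\<exists>ua. \<exists>xa ya. s *\<^sub>R (u *\<^sub>R x + (1 - u) *\<^sub>R y) + t *\<^sub>R (v *\<^sub>R x' + (1 - v) *\<^sub>R y')
     = ua *\<^sub>R xa + (1 - ua) *\<^sub>R ya \<and> 0 \<le> ua \<and> ua \<le> 1 \<and> xa \<in> K \<and> ya \<in> L"
    using z(1) w(1) by blast
qed

text \<open>The join is the convex hull of the union. The three-way alternative covers an empty K or
  L, where there are no connecting segments.\<close>

lemma compact_convex_join:
  fixes K L :: "('i \<Rightarrow> real) set"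
  assumes "compact K" "compact L" "convex K" "convex L"
  obtains P where "compact P" "convex P" "K \<subseteq> P" "L \<subseteq> P"
    "\<And>z. z \<in> P \<Longrightarrow> z \<in> K \<or> z \<in> L \<or>
       (\<exists>u x y. 0 \<le> u \<and> u \<le> 1 \<and> x \<in> K \<and> y \<in> L \<and> z = u *\<^sub>R x + (1 - u) *\<^sub>R y)"
proof (cases "K = {} \<or> L = {}")
  case True
  then show thesis
    using that[of "K \<union> L"] assms by auto
next
  case False
  let ?P = "{u *\<^sub>R x + (1 - u) *\<^sub>R y |u x y. u \<in> {0..1} \<and> x \<in> K \<and> y \<in> L}"
  obtain p q where "p \<in> K" "q \<in> L"
    using False by blast
  have "x \<in> ?P" if "x \<in> K" for x
    using that \<open>q \<in> L\<close> by (intro CollectI exI[of _ "1::real"] exI[of _ x] exI[of _ q]) auto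
  moreover have "y \<in> ?P" if "y \<in> L" for y
    using that \<open>p \<in> K\<close> by (intro CollectI exI[of _ "0::real"] exI[of _ p] exI[of _ y]) auto
  ultimately show thesis
    using compact_convex_combinations[OF assms(1,2), of 0 1] convex_convex_combinations[OF assms(3,4)]
    by (intro that[of ?P]) auto
qed

section \<open>Extreme points\<close>

lemma extreme_point_of_combination:
  assumes "e extreme_point_of S" "x \<in> S" "y \<in> S" "0 < u" "u < 1" "e = u *\<^sub>R x + (1 - u) *\<^sub>R y"
  shows "x = e" "y = e"
proof -
  have "x = y"
  proof (rule ccontr)
    assume "x \<noteq> y"
    moreover have "e = (1 - (1 - u)) *\<^sub>R x + (1 - u) *\<^sub>R y"
      using assms(6) by simp
    ultimately have "e \<in> open_segment x y"
      unfolding in_segment using assms(4,5) by (intro conjI exI[of _ "1 - u"]) auto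
    then show False
      using assms(1-3) by (auto simp: extreme_point_of_def)
  qed
  then show "x = e" "y = e"
    using assms(6) by (auto simp flip: scaleR_add_left)
qed

lemma closed_coordinate_le: "closed {y::'i \<Rightarrow> real. y i \<le> r}" "closed {y::'i \<Rightarrow> real. r \<le> y i}"
  by (intro closed_Collect_le continuous_on_product_coordinates continuous_on_const)+

lemma open_coordinate_less: "open {y::'i \<Rightarrow> real. y i < r}" "open {y::'i \<Rightarrow> real. r < y i}"
  by (intro open_Collect_less continuous_on_product_coordinates continuous_on_const)+

lemma convex_coordinate:
  "convex {y::'i \<Rightarrow> real. y i \<le> r}" "convex {y::'i \<Rightarrow> real. r \<le> y i}"
  "convex {y::'i \<Rightarrow> real. y i < r}" "convex {y::'i \<Rightarrow> real. r < y i}"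
proof -
  have "linear (\<lambda>y::'i \<Rightarrow> real. y i)"
    by (rule linearI) auto
  then have "convex ((\<lambda>y::'i \<Rightarrow> real. y i) -` S)" if "convex S" for S
    using that by (rule convex_linear_vimage)
  from this[of "{..r}"] this[of "{r..}"] this[of "{..<r}"] this[of "{r<..}"]
  show "convex {y::'i \<Rightarrow> real. y i \<le> r}" "convex {y::'i \<Rightarrow> real. r \<le> y i}"
    "convex {y::'i \<Rightarrow> real. y i < r}" "convex {y::'i \<Rightarrow> real. r < y i}"
    by (simp_all add: vimage_def)
qed

text \<open>Caps form a neighbourhood base at an extreme point. A coordinate half-space directly
  gives a cap; two caps are intersected by joining the removed sets, and extremality is exactly what
  keeps \<open>e\<close> out of the join.\<close>

lemma extreme_point_cap:
  fixes G :: "('i \<Rightarrow> real) set"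
  assumes "compact G" "convex G" and e: "e extreme_point_of G" and "open U" "e \<in> U"
  obtains K where "compact K" "convex K" "K \<subseteq> G" "e \<notin> K" "G - K \<subseteq> U"
proof -
  have eG: "e \<in> G"
    using e by (simp add: extreme_point_of_def)
  define cap where "cap V \<longleftrightarrow> (\<exists>K. compact K \<and> convex K \<and> K \<subseteq> G \<and> e \<notin> K \<and> G - K \<subseteq> V)" for V
  have Int: "cap (V \<inter> W)" if VW: "cap V" "cap W" for V W
  proof -
    obtain K where K: "compact K" "convex K" "K \<subseteq> G" "e \<notin> K" "G - K \<subseteq> V"
      using VW(1) unfolding cap_def by auto
    obtain L where L: "compact L" "convex L" "L \<subseteq> G" "e \<notin> L" "G - L \<subseteq> W"
      using VW(2) unfolding cap_def by auto
    obtain P where P: "compact P" "convex P" "K \<subseteq> P" "L \<subseteq> P"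
      "\<And>z. z \<in> P \<Longrightarrow> z \<in> K \<or> z \<in> L \<or>
       (\<exists>u x y. 0 \<le> u \<and> u \<le> 1 \<and> x \<in> K \<and> y \<in> L \<and> z = u *\<^sub>R x + (1 - u) *\<^sub>R y)"
      using compact_convex_join[OF K(1) L(1) K(2) L(2)] by blast
    have "P \<subseteq> G"
    proof
      fix z assume "z \<in> P"
      from P(5)[OF this] show "z \<in> G"
        using K(3) L(3) convexD[OF \<open>convex G\<close>] by (smt (verit) subsetD)
    qed
    moreover have "e \<notin> P"
    proof
      assume "e \<in> P"
      then obtain u x y where u: "0 \<le> u" "u \<le> 1" "x \<in> K" "y \<in> L" "e = u *\<^sub>R x + (1 - u) *\<^sub>R y"
        using P(5) K(4) L(4) by blast
      have "u \<noteq> 0" "u \<noteq> 1"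
        using u K(4) L(4) by auto
      then have "x = e"
        using extreme_point_of_combination[OF e] u K(3) L(3) by (metis less_eq_real_def subsetD)
      then show False
        using u K(4) by simp
    qed
    ultimately show ?thesis
      unfolding cap_def using P K L by (intro exI[of _ P]) blast
  qed
  have half: "cap {y. y i < r}" if "e i < r" for i r
    unfolding cap_def using that assms
    by (intro exI[of _ "G \<inter> {y. r \<le> y i}"])
       (auto intro!: compact_Int_closed convex_Int convex_coordinate closed_coordinate_le)
  have half': "cap {y. r < y i}" if "r < e i" for i r
    unfolding cap_def using that assms
    by (intro exI[of _ "G \<inter> {y. y i \<le> r}"])
       (auto intro!: compact_Int_closed convex_Int convex_coordinate closed_coordinate_le)
  obtain F r where F: "finite F" "r > 0" "fun_box e F r \<subseteq> U"
    using open_fun_box_subset[OF assms(4,5)] .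
  have "cap (fun_box e F r)"
    using F(1)
  proof induction
    case empty
    then show ?case
      unfolding cap_def by (intro exI[of _ "{}"]) (auto simp: fun_box_def)
  next
    case (insert i F)
    have "fun_box e (insert i F) r = {y. y i < e i + r} \<inter> {y. e i - r < y i} \<inter> fun_box e F r"
      by (auto simp: fun_box_def)
    then show ?case
      using Int half half' insert F(2) by simp
  qed
  then show thesis
    using that F(3) unfolding cap_def by blast
qed

text \<open>Leger's argument: a maximal relatively open convex proper subset is the complement of a point.\<close>

lemma extreme_point_outside_open_convex:
  fixes G :: "('i \<Rightarrow> real) set"
  assumes G: "compact G" "convex G" and A: "openin (top_of_set G) A" "convex A" "A \<noteq> G"
  obtains e where "e extreme_point_of G" "e \<notin> A"
proof -
  define \<A> where "\<A> = {B. openin (top_of_set G) B \<and> convex B \<and> B \<noteq> G \<and> A \<subseteq> B}"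
  have sub: "B \<subseteq> G" if "B \<in> \<A>" for B
    using that openin_imp_subset unfolding \<A>_def by blast
  have "\<exists>M\<in>\<A>. \<forall>X\<in>\<A>. M \<subseteq> X \<longrightarrow> X = M"
  proof (rule subset_Zorn_nonempty)
    show "\<A> \<noteq> {}"
      using A unfolding \<A>_def by blast
    fix \<C> assume ne: "\<C> \<noteq> {}" and ch: "subset.chain \<A> \<C>"
    have CA: "\<C> \<subseteq> \<A>" and tot: "\<And>X Y. X \<in> \<C> \<Longrightarrow> Y \<in> \<C> \<Longrightarrow> X \<subseteq> Y \<or> Y \<subseteq> X"
      using ch by (auto simp: subset_chain_def)
    have "openin (top_of_set G) (\<Union>\<C>)"
      using CA unfolding \<A>_def by (intro openin_Union) auto
    moreover have "convex (\<Union>\<C>)"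
    proof (rule convexI)
      fix x y and u v :: real
      assume *: "x \<in> \<Union>\<C>" "y \<in> \<Union>\<C>" "0 \<le> u" "0 \<le> v" "u + v = 1"
      then obtain X Y where "X \<in> \<C>" "x \<in> X" "Y \<in> \<C>" "y \<in> Y" by blast
      then obtain Z where "Z \<in> \<C>" "x \<in> Z" "y \<in> Z"
        using tot by blast
      then show "u *\<^sub>R x + v *\<^sub>R y \<in> \<Union>\<C>"
        using CA * convexD[of Z x y u v] unfolding \<A>_def by blast
    qed
    \<comment> \<open>If a chain covered the compact set \<open>G\<close>, a single member would
      already contain it, but members differ from \<open>G\<close>.\<close>
    moreover have "\<Union>\<C> \<noteq> G"
    proof
      assume eq: "\<Union>\<C> = G"
      have "compactin (top_of_set G) G"
        using G(1) by (simp add: compactin_subtopology)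
      then obtain \<F> where \<F>: "finite \<F>" "\<F> \<subseteq> \<C>" "G \<subseteq> \<Union>\<F>"
        using CA eq unfolding compactin_def \<A>_def by (metis (no_types, lifting) mem_Collect_eq order_refl subsetD)
      have "\<exists>Z\<in>\<C>. \<Union>\<F> \<subseteq> Z"
        using \<F>(1,2)
      proof (induction)
        case empty
        then show ?case using ne by auto
      next
        case (insert X \<F>)
        then obtain Z where "Z \<in> \<C>" "\<Union>\<F> \<subseteq> Z" "X \<in> \<C>" by auto
        then show ?case
          using tot[of X Z] by auto
      qed
      then obtain Z where "Z \<in> \<C>" "G \<subseteq> Z"
        using \<F>(3) by blast
      then show False
        using CA sub unfolding \<A>_def by blast
    qed
    ultimately show "\<Union>\<C> \<in> \<A>"
      using CA ne unfolding \<A>_def by blast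
  qed
  then obtain M where M: "openin (top_of_set G) M" "convex M" "M \<noteq> G" "A \<subseteq> M"
    and max: "\<And>X. openin (top_of_set G) X \<Longrightarrow> convex X \<Longrightarrow> M \<subseteq> X \<Longrightarrow> X = M \<or> X = G"
    unfolding \<A>_def by (smt (verit, del_insts) dual_order.trans mem_Collect_eq)
  have MG: "M \<subseteq> G"
    using M(1) openin_imp_subset by blast
  \<comment> \<open>The preimage of \<open>M\<close> under the contraction \<open>f\<close> towards
    \<open>x\<close> is relatively open, convex and contains \<open>M\<close>, so it is
    \<open>M\<close> or \<open>G\<close>. As \<open>f y\<close> is outside \<open>M\<close>, it is
    \<open>M\<close>; then all iterates of \<open>y\<close> stay outside \<open>M\<close> although
    they converge to \<open>x\<close>.\<close>
  have mix: "u *\<^sub>R x + (1 - u) *\<^sub>R y \<in> M" if x: "x \<in> M" and y: "y \<in> G" and u: "0 < u" "u < 1" for x y u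
  proof (rule ccontr)
    assume no: "u *\<^sub>R x + (1 - u) *\<^sub>R y \<notin> M"
    define f where "f w = u *\<^sub>R x + (1 - u) *\<^sub>R w" for w
    have fG: "f w \<in> G" if "w \<in> G" for w
      unfolding f_def using that x MG u G(2) by (intro convexD) auto
    have cont: "continuous_on S f" for S
      unfolding f_def
      by (rule continuous_on_coordinatewise_then_product)
        (auto intro!: continuous_intros continuous_on_subset[OF continuous_on_product_coordinates])
    let ?X = "G \<inter> f -` M"
    have "openin (top_of_set G) ?X"
      using cont fG M(1) by (intro continuous_openin_preimage[of G f G]) auto
    moreover have "convex ?X"
    proof (rule convexI)
      fix a b and s t :: real
      assume *: "a \<in> ?X" "b \<in> ?X" "0 \<le> s" "0 \<le> t" "s + t = 1"
      have "f (s *\<^sub>R a + t *\<^sub>R b) = s *\<^sub>R f a + t *\<^sub>R f b"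
      proof -
        have t: "t = 1 - s" using * by simp
        show ?thesis
          unfolding t by (simp add: f_def fun_eq_iff algebra_simps)
      qed
      then show "s *\<^sub>R a + t *\<^sub>R b \<in> ?X"
        using * M(2) G(2) by (auto intro!: convexD)
    qed
    moreover have "M \<subseteq> ?X"
      using MG x u M(2) unfolding f_def by (auto intro!: convexD)
    ultimately have "?X = M \<or> ?X = G"
      using max by blast
    then have X: "?X = M"
      using no y unfolding f_def by blast
    have iter: "(f ^^ n) y \<in> G - M" for n
    proof (induction n)
      case 0
      have "y \<notin> M"
        using no M(2) x u by (auto intro: convexD)
      then show ?case using y by simp
    next
      case (Suc n)
      then show ?case using X fG by auto
    qed
    have form: "(f ^^ n) y = x + (1 - u) ^ n *\<^sub>R (y - x)" for n
    proof (induction n)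
      case (Suc n)
      have "(f ^^ Suc n) y = f (x + (1 - u) ^ n *\<^sub>R (y - x))"
        by (simp only: funpow.simps o_apply Suc)
      also have "\<dots> = x + (1 - u) ^ Suc n *\<^sub>R (y - x)"
        by (simp add: f_def fun_eq_iff algebra_simps)
      finally show ?case .
    qed simp
    obtain V where V: "open V" "M = G \<inter> V"
      using M(1) by (auto simp: openin_open)
    then obtain F r where F: "finite F" "r > 0" "fun_box x F r \<subseteq> V"
      using x open_fun_box_subset[of V x] by blast
    have "\<forall>\<^sub>F n in sequentially. \<forall>i\<in>F. \<bar>(1 - u) ^ n * (y i - x i)\<bar> < r"
    proof (intro eventually_ball_finite F ballI)
      fix i
      have "(\<lambda>n. \<bar>(1 - u) ^ n * (y i - x i)\<bar>) \<longlonglongrightarrow> \<bar>0 * (y i - x i)\<bar>"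
        using u by (intro tendsto_intros LIMSEQ_power_zero) auto
      then show "\<forall>\<^sub>F n in sequentially. \<bar>(1 - u) ^ n * (y i - x i)\<bar> < r"
        using F(2) by (intro order_tendstoD(2)) auto
    qed
    then have "\<exists>n. \<forall>i\<in>F. \<bar>(1 - u) ^ n * (y i - x i)\<bar> < r"
      by (rule eventually_happens'[OF sequentially_bot])
    then obtain n where "\<forall>i\<in>F. \<bar>(1 - u) ^ n * (y i - x i)\<bar> < r" ..
    then have "(f ^^ n) y \<in> fun_box x F r"
      unfolding form fun_box_def by simp
    then show False
      using iter[of n] F(3) V(2) by auto
  qed
  obtain p where p: "p \<in> G" "p \<notin> M"
    using M(3) MG by blast
  have uniq: "q = p" if q: "q \<in> G" "q \<notin> M" for q
  proof (rule ccontr)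
    assume "q \<noteq> p"
    then obtain i where "q i \<noteq> p i" by blast
    then obtain a b where ab: "a \<in> G" "a \<notin> M" "b \<in> G" "b \<notin> M" "a i < b i"
      using p q by (metis linorder_neqE)
    \<comment> \<open>A slice containing \<open>a\<close> but not \<open>b\<close>. By
      \<open>mix\<close>, adding it to \<open>M\<close> keeps convexity, so
      \<open>M \<union> V\<close> contradicts maximality.\<close>
    define V where "V = G \<inter> {y. y i < b i}"
    have V: "openin (top_of_set G) V" "convex V"
      unfolding V_def using G(2) open_coordinate_less convex_coordinate
      by (auto intro!: openin_open_Int convex_Int)
    have "convex (M \<union> V)"
    proof (rule convexI)
      fix x y and s t :: real
      assume *: "x \<in> M \<union> V" "y \<in> M \<union> V" "0 \<le> s" "0 \<le> t" "s + t = 1"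
      then have t: "t = 1 - s" by simp
      consider "s = 0" | "s = 1" | "0 < s" "s < 1" using * by fastforce
      then show "s *\<^sub>R x + t *\<^sub>R y \<in> M \<union> V"
      proof cases
        case 3
        show ?thesis
        proof (cases "x \<in> M \<or> y \<in> M")
          case True
          moreover have "s *\<^sub>R x + t *\<^sub>R y \<in> M" if "x \<in> M"
            using that mix[of x y s] 3 * MG unfolding t V_def by blast
          moreover have "s *\<^sub>R x + t *\<^sub>R y \<in> M" if "y \<in> M"
          proof -
            have "t *\<^sub>R y + (1 - t) *\<^sub>R x \<in> M"
              using that mix[of y x t] 3 * MG unfolding t V_def by auto
            then show ?thesis using t by (simp add: add.commute)
          qed
          ultimately show ?thesis by blast
        next
          case False
          then show ?thesis using * convexD[OF V(2)] by blast
        qed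
      qed (use * t in auto)
    qed
    then have "M \<union> V = M \<or> M \<union> V = G"
      using max[of "M \<union> V"] V(1) M(1) by blast
    then show False
      using ab unfolding V_def by blast
  qed
  have "p extreme_point_of G"
    unfolding extreme_point_of_def
  proof (intro conjI ballI notI)
    show "p \<in> G" by (rule p)
    fix a b assume ab: "a \<in> G" "b \<in> G" "p \<in> open_segment a b"
    then obtain u where u: "a \<noteq> b" "0 < u" "u < 1" "p = (1 - u) *\<^sub>R a + u *\<^sub>R b"
      by (auto simp: in_segment)
    have "a \<notin> M"
      using mix[of a b "1 - u"] u ab p by auto
    moreover have "b \<notin> M"
      using mix[of b a u] u ab p by (auto simp: add.commute)
    ultimately show False
      using uniq ab u(1) by blast
  qed
  then show thesis
    using that p M(4) by blast
qed

text \<open>Krein-Milman without separating functionals: P fattened by a small box is open and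
  convex and still misses a given point outside P, so some extreme point of G would have to lie
  outside it.\<close>

lemma compact_convex_contains_extreme:
  fixes G P :: "('i \<Rightarrow> real) set"
  assumes G: "compact G" "convex G" and P: "compact P" "convex P"
    and ext: "\<And>e. e extreme_point_of G \<Longrightarrow> e \<in> P"
  shows "G \<subseteq> P"
proof (rule ccontr)
  assume "\<not> G \<subseteq> P"
  then obtain z where z: "z \<in> G" "z \<notin> P" by blast
  have "open (- P)"
    using compact_fun_imp_closed[OF P(1)] by auto
  then obtain F r where F: "finite F" "r > 0" "fun_box z F r \<subseteq> - P"
    using open_fun_box_subset[of "- P" z] z by auto
  define A where "A = {w. \<exists>p\<in>P. p \<in> fun_box w F r}"
  have "p \<in> fun_box w F r \<longleftrightarrow> w \<in> fun_box p F r" for p w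
    by (simp add: fun_box_def abs_minus_commute)
  then have A_eq: "A = (\<Union>p\<in>P. fun_box p F r)"
    unfolding A_def by auto
  have "open A"
    unfolding A_eq using open_fun_box[OF F(1)] by blast
  moreover have "convex A"
  proof (rule convexI)
    fix x y and u v :: real
    assume "x \<in> A" "y \<in> A" and u: "0 \<le> u" "0 \<le> v" "u + v = 1"
    then obtain p q where p: "p \<in> P" "q \<in> P" "p \<in> fun_box x F r" "q \<in> fun_box y F r"
      unfolding A_def by blast
    have "\<bar>u * p i + v * q i - (u * x i + v * y i)\<bar> < r" if "i \<in> F" for i
    proof -
      have "\<bar>p i - x i\<bar> < r" "\<bar>q i - y i\<bar> < r"
        using p that by (auto simp: fun_box_def)
      then have "u * \<bar>p i - x i\<bar> + v * \<bar>q i - y i\<bar> < r"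
        using u by (intro convex_bound_lt) auto
      moreover have "\<bar>u * (p i - x i) + v * (q i - y i)\<bar> \<le> u * \<bar>p i - x i\<bar> + v * \<bar>q i - y i\<bar>"
        using u abs_triangle_ineq[of "u * (p i - x i)" "v * (q i - y i)"] by (simp add: abs_mult)
      ultimately show ?thesis by (simp add: algebra_simps)
    qed
    then have "u *\<^sub>R p + v *\<^sub>R q \<in> fun_box (u *\<^sub>R x + v *\<^sub>R y) F r"
      by (simp add: fun_box_def)
    then show "u *\<^sub>R x + v *\<^sub>R y \<in> A"
      unfolding A_def using P(2) p u by (auto intro!: convexD)
  qed
  moreover have "z \<notin> A"
    using F(3) unfolding A_def by blast
  ultimately obtain e where e: "e extreme_point_of G" "e \<notin> G \<inter> A"
    using extreme_point_outside_open_convex[OF G, of "G \<inter> A"] z G(2)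
    by (metis IntD2 convex_Int openin_open_Int)
  moreover have "e \<in> A"
    using ext[OF e(1)] F(2) unfolding A_def fun_box_def by force
  ultimately show False
    by (auto simp: extreme_point_of_def)
qed

text \<open>A point near e puts almost all of its mass near e, and N does not depend on the
  coordinate j or the level a.\<close>

lemma extreme_point_mass:
  fixes G :: "('i \<Rightarrow> real) set"
  assumes G: "compact G" "convex G" and e: "e extreme_point_of G" and U: "open U" "e \<in> U"
    and r: "0 < r" "r \<le> 1" and R: "\<And>y j. y \<in> G \<Longrightarrow> j \<in> J \<Longrightarrow> \<bar>y j\<bar> \<le> R"
  obtains N where "open N" "e \<in> N"
    "\<And>z j a. z \<in> N \<inter> G \<Longrightarrow> j \<in> J \<Longrightarrow> z j < a - 2 * r * R \<Longrightarrow>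
       \<exists>e'. e' extreme_point_of G \<and> e' \<in> U \<and> e' j < a"
proof -
  obtain K where K: "compact K" "convex K" "K \<subseteq> G" "e \<notin> K" "G - K \<subseteq> U"
    using extreme_point_cap[OF G e U] .
  \<comment> \<open>The points of \<open>G\<close> that can be written with weight at least
    \<open>r\<close> on \<open>K\<close>. Extremality and \<open>r > 0\<close> keep \<open>e\<close>
    out, so the complement is the required \<open>N\<close>.\<close>
  define C where "C = {u *\<^sub>R x + (1 - u) *\<^sub>R y |u x y. u \<in> {r..1} \<and> x \<in> K \<and> y \<in> G}"
  have "open (- C)"
    unfolding C_def using compact_fun_imp_closed[OF compact_convex_combinations[OF K(1) G(1)]] by auto
  moreover have "e \<notin> C"
  proof
    assume "e \<in> C"
    then obtain u x y where u: "r \<le> u" "u \<le> 1" "x \<in> K" "y \<in> G" "e = u *\<^sub>R x + (1 - u) *\<^sub>R y"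
      unfolding C_def by auto
    have "x = e"
    proof (cases "u = 1")
      case False
      then show ?thesis
        using extreme_point_of_combination(1)[OF e, of x y u] u K(3) r by auto
    qed (use u in auto)
    then show False
      using u K(4) by simp
  qed
  moreover have "\<exists>e'. e' extreme_point_of G \<and> e' \<in> U \<and> e' j < a"
    if z: "z \<in> G" "z \<notin> C" and j: "j \<in> J" and less: "z j < a - 2 * r * R" for z j a
  proof (rule ccontr)
    assume no: "\<not> ?thesis"
    \<comment> \<open>If all extreme points in \<open>U\<close> had \<open>j\<close>-coordinate at
      least \<open>a\<close>, then \<open>G\<close> would lie in the join of \<open>K\<close> and
      \<open>L\<close>. A point outside \<open>C\<close> has weight below \<open>r\<close> on
      \<open>K\<close>, and exchanging that part costs at most \<open>2 * r * R\<close> in the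
      coordinate.\<close>
    define L where "L = G \<inter> {y. a \<le> y j}"
    have "R \<ge> 0"
      using R[OF z(1) j] by linarith
    have L: "compact L" "convex L"
      unfolding L_def using G by (auto intro!: compact_Int_closed convex_Int convex_coordinate closed_coordinate_le)
    obtain P where P: "compact P" "convex P" "K \<subseteq> P" "L \<subseteq> P"
      "\<And>z. z \<in> P \<Longrightarrow> z \<in> K \<or> z \<in> L \<or>
       (\<exists>u x y. 0 \<le> u \<and> u \<le> 1 \<and> x \<in> K \<and> y \<in> L \<and> z = u *\<^sub>R x + (1 - u) *\<^sub>R y)"
      using compact_convex_join[OF K(1) L(1) K(2) L(2)] by blast
    have "G \<subseteq> P"
    proof (rule compact_convex_contains_extreme[OF G P(1,2)])
      fix e' assume e': "e' extreme_point_of G"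
      then have "e' \<in> G"
        by (simp add: extreme_point_of_def)
      then show "e' \<in> P"
        using e' no P(3,4) K(5) unfolding L_def by fastforce
    qed
    then consider "z \<in> K" | "z \<in> L" |
      u x y where "0 \<le> u" "u \<le> 1" "x \<in> K" "y \<in> L" "z = u *\<^sub>R x + (1 - u) *\<^sub>R y"
      using P(5) z(1) by blast
    then show False
    proof cases
      case 1
      then have "z \<in> C"
        unfolding C_def using z(1) r by (intro CollectI exI[of _ 1] exI[of _ z]) auto
      then show False using z by simp
    next
      case 2
      then have "a \<le> z j" by (simp add: L_def)
      then show False using less r(1) \<open>R \<ge> 0\<close> by (smt (verit) mult_nonneg_nonneg)
    next
      case 3
      then have y: "y \<in> G" "a \<le> y j" by (auto simp: L_def)
      then have "u < r"
        using 3 z(2) unfolding C_def by fastforce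
      have x: "\<bar>x j\<bar> \<le> R" and "\<bar>y j\<bar> \<le> R"
        using R[OF _ j] 3 y K(3) by auto
      then have "u * (y j - x j) \<le> u * (2 * R)"
        using 3 by (intro mult_left_mono) auto
      also have "\<dots> \<le> r * (2 * R)"
        using \<open>u < r\<close> \<open>R \<ge> 0\<close> by (intro mult_right_mono) auto
      finally have "u * (y j - x j) \<le> 2 * r * R"
        by simp
      moreover have "z j = u * x j + (1 - u) * y j"
        using 3(5) by (simp only: fun_apply_simps)
      ultimately have "y j - 2 * r * R \<le> z j"
        by (simp add: algebra_simps)
      then show False
        using less y by simp
    qed
  qed
  ultimately show thesis
    using that[of "- C"] by blast
qed

section \<open>Baire category and oscillation on the set of extreme points\<close>

text \<open>Choquet's observation that the extreme points form a Baire space. If no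
  \<open>E n\<close> is dense among the extreme points of some open piece, an increasing sequence of
  compact convex sets absorbs those in \<open>E 0\<close>, \<open>E 1\<close> and so on, each set
  lying in the relative interior of the next. The union is relatively open, convex and proper, so it
  misses an extreme point, which \<open>cover\<close> forbids.\<close>

lemma extreme_points_Baire:
  fixes G :: "('i \<Rightarrow> real) set"
  assumes G: "compact G" "convex G" and U: "open U" "e0 extreme_point_of G" "e0 \<in> U"
    and cover: "\<And>e. e extreme_point_of G \<Longrightarrow> e \<in> U \<Longrightarrow> \<exists>n::nat. e \<in> E n"
  obtains n V where "open V" "V \<subseteq> U" "\<exists>e. e extreme_point_of G \<and> e \<in> V"
    "\<And>W. open W \<Longrightarrow> W \<subseteq> V \<Longrightarrow> \<exists>e. e extreme_point_of G \<and> e \<in> W \<Longrightarrow>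
       \<exists>e. e extreme_point_of G \<and> e \<in> W \<and> e \<in> E n"
proof (rule ccontr)
  note witness = that
  assume "\<not> thesis"
  then have no: "\<exists>W. open W \<and> W \<subseteq> V \<and> (\<exists>e. e extreme_point_of G \<and> e \<in> W) \<and>
      \<not> (\<exists>e. e extreme_point_of G \<and> e \<in> W \<and> e \<in> E n)"
    if "open V" "V \<subseteq> U" "\<exists>e. e extreme_point_of G \<and> e \<in> V" for n V
    using that witness[of V n] by blast
  \<comment> \<open>The shrinking caps \<open>G - K\<close> play the role of the nested open sets in
    Baire's theorem; the last clause says that the cap still holds an extreme point.\<close>
  define good where "good K \<longleftrightarrow> compact K \<and> convex K \<and> K \<subseteq> G \<and> G - K \<subseteq> U \<and>
      (\<exists>e. e extreme_point_of G \<and> e \<notin> K)" for K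
  have "\<exists>f. \<forall>n. good (f n) \<and> ((\<exists>W. open W \<and> f n \<subseteq> W \<and> G \<inter> W \<subseteq> f (Suc n)) \<and>
      (\<forall>e\<in>E n. e extreme_point_of G \<longrightarrow> e \<in> f (Suc n)))"
  proof (rule dependent_nat_choice)
    obtain K where "compact K" "convex K" "K \<subseteq> G" "e0 \<notin> K" "G - K \<subseteq> U"
      using extreme_point_cap[OF G U(2,1,3)] .
    then show "\<exists>K. good K"
      unfolding good_def using U(2) by blast
  next
    fix K and n :: nat
    assume "good K"
    then obtain e1 where K: "compact K" "convex K" "K \<subseteq> G" "G - K \<subseteq> U"
      and e1: "e1 extreme_point_of G" "e1 \<notin> K"
      unfolding good_def by blast
    have "open (U \<inter> - K)"
      using U(1) compact_fun_imp_closed[OF K(1)] by auto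
    moreover have "e1 \<in> U \<inter> - K"
      using e1 K(4) by (auto simp: extreme_point_of_def)
    ultimately obtain W where W: "open W" "W \<subseteq> U \<inter> - K" "\<exists>e. e extreme_point_of G \<and> e \<in> W"
        "\<not> (\<exists>e. e extreme_point_of G \<and> e \<in> W \<and> e \<in> E n)"
      using no[of "U \<inter> - K" n] e1(1) by blast
    then obtain e where e: "e extreme_point_of G" "e \<in> W" by blast
    obtain F r where F: "finite F" "r > 0" "fun_box e F r \<subseteq> W"
      using open_fun_box_subset[OF W(1) e(2)] .
    \<comment> \<open>A closed box between the new cap and \<open>W\<close>. Its complement is an
      open set that contains \<open>K\<close> and meets \<open>G\<close> only inside
      \<open>L\<close>, which later makes the union relatively open.\<close>
    define Q where "Q = {y. \<forall>i\<in>F. \<bar>y i - e i\<bar> \<le> r / 2}"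
    have "\<bar>t - s\<bar> \<le> r / 2 \<longleftrightarrow> t \<le> s + r / 2 \<and> s - r / 2 \<le> t" for s t
      by linarith
    then have Q_eq: "Q = (\<Inter>i\<in>F. {y. y i \<le> e i + r / 2} \<inter> {y. e i - r / 2 \<le> y i})"
      unfolding Q_def by auto
    have Q: "closed Q" "fun_box e F (r / 2) \<subseteq> Q" "Q \<subseteq> fun_box e F r"
    proof -
      show "closed Q"
        unfolding Q_eq by (intro closed_INT ballI closed_Int closed_coordinate_le)
      show "fun_box e F (r / 2) \<subseteq> Q" "Q \<subseteq> fun_box e F r"
        unfolding Q_def fun_box_def using F(2) by (auto simp: less_eq_real_def)
    qed
    have "e \<in> fun_box e F (r / 2)"
      using F(2) by (simp add: fun_box_def)
    then obtain L where L: "compact L" "convex L" "L \<subseteq> G" "e \<notin> L" "G - L \<subseteq> fun_box e F (r / 2)"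
      using extreme_point_cap[OF G e(1) open_fun_box[OF F(1)]] by blast
    have GL: "G - L \<subseteq> Q" "Q \<subseteq> W"
      using L(5) Q F(3) by auto
    have "good L"
      unfolding good_def using L e(1) GL W(2) by blast
    moreover have "open (- Q)" "K \<subseteq> - Q" "G \<inter> - Q \<subseteq> L"
      using Q(1) GL W(2) by auto
    moreover have "\<forall>e\<in>E n. e extreme_point_of G \<longrightarrow> e \<in> L"
      using W(4) GL extreme_point_of_def by blast
    ultimately show "\<exists>L. good L \<and> ((\<exists>W. open W \<and> K \<subseteq> W \<and> G \<inter> W \<subseteq> L) \<and>
        (\<forall>e\<in>E n. e extreme_point_of G \<longrightarrow> e \<in> L))"
      by blast
  qed
  then obtain f where f: "\<And>n. good (f n)"
      "\<And>n e. e \<in> E n \<Longrightarrow> e extreme_point_of G \<Longrightarrow> e \<in> f (Suc n)"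
      "\<And>n. \<exists>W. open W \<and> f n \<subseteq> W \<and> G \<inter> W \<subseteq> f (Suc n)"
    by metis
  then obtain W where W: "\<And>n. open (W n)" "\<And>n. f n \<subseteq> W n" "\<And>n. G \<inter> W n \<subseteq> f (Suc n)"
    by metis
  have fG: "f n \<subseteq> G" "convex (f n)" "f n \<noteq> G" "G - f n \<subseteq> U" for n
    using f(1)[of n] unfolding good_def by (auto simp: extreme_point_of_def)
  have mono: "f m \<subseteq> f n" if "m \<le> n" for m n
    using that by (rule lift_Suc_mono_le[rotated]) (use W fG in blast)
  define A where "A = (\<Union>n. f n)"
  have A_eq: "A = G \<inter> (\<Union>n. W n)"
    unfolding A_def using W(2,3) fG(1) by blast
  have "openin (top_of_set G) A"
    unfolding A_eq using W(1) by (intro openin_open_Int) auto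
  moreover have "convex A"
  proof (rule convexI)
    fix x y and u v :: real
    assume *: "x \<in> A" "y \<in> A" "0 \<le> u" "0 \<le> v" "u + v = 1"
    then obtain m n where "x \<in> f m" "y \<in> f n"
      unfolding A_def by blast
    then have "x \<in> f (max m n)" "y \<in> f (max m n)"
      using mono[of m "max m n"] mono[of n "max m n"] by auto
    then have "u *\<^sub>R x + v *\<^sub>R y \<in> f (max m n)"
      using * fG(2) by (intro convexD) auto
    then show "u *\<^sub>R x + v *\<^sub>R y \<in> A"
      unfolding A_def by blast
  qed
  \<comment> \<open>By compactness, equality would already hold at a finite stage, where an extreme
    point is still left out.\<close>
  moreover have "A \<noteq> G"
  proof
    assume "A = G"
    then have "G \<subseteq> (\<Union>n. W n)"
      unfolding A_eq by blast
    then obtain N where N: "finite N" "G \<subseteq> (\<Union>n\<in>N. W n)"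
      using compactE_image[OF G(1), of UNIV W] W(1) by (metis UNIV_I)
    obtain m where m: "\<And>n. n \<in> N \<Longrightarrow> n \<le> m"
      using N(1) by (meson finite_nat_set_iff_bounded_le)
    have "G \<subseteq> f (Suc m)"
    proof
      fix x assume "x \<in> G"
      then obtain n where "n \<in> N" "x \<in> W n" using N(2) by blast
      then show "x \<in> f (Suc m)"
        using W(3)[of n] mono[of "Suc n" "Suc m"] m \<open>x \<in> G\<close> by auto
    qed
    then show False
      using fG(1,3) by blast
  qed
  ultimately obtain e where e: "e extreme_point_of G" "e \<notin> A"
    using extreme_point_outside_open_convex[OF G] by blast
  have "e \<in> G - f 0"
    using e unfolding A_def by (auto simp: extreme_point_of_def)
  then have "e \<in> U"
    using fG(4) by blast
  then obtain n where "e \<in> E n"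
    using cover e(1) by blast
  then show False
    using f(2) e unfolding A_def by blast
qed

text \<open>A finite family of open sets meeting the extreme points is split repeatedly. One
  coordinate approximating \<open>h\<close> at finitely many chosen points divides every member into
  a low and a high part that both still contain extreme points. The hypothesis \<open>low\<close>
  yields only a point of G, not an extreme one; concentration of mass near an extreme point repairs
  this.\<close>

lemma independent_seq_from_oscillation:
  fixes G :: "('i \<Rightarrow> real) set" and h :: "('i \<Rightarrow> real) \<Rightarrow> real"
  assumes G: "compact G" "convex G" and R: "\<And>y j. y \<in> G \<Longrightarrow> j \<in> J \<Longrightarrow> \<bar>y j\<bar> \<le> R"
    and h: "\<And>S d. finite S \<Longrightarrow> S \<subseteq> G \<Longrightarrow> d > 0 \<Longrightarrow> \<exists>j\<in>J. \<forall>y\<in>S. \<bar>y j - h y\<bar> < d"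
    and ab: "a < b" and V: "open V" "\<exists>e. e extreme_point_of G \<and> e \<in> V"
    and high: "\<And>W. open W \<Longrightarrow> W \<subseteq> V \<Longrightarrow> \<exists>e. e extreme_point_of G \<and> e \<in> W \<Longrightarrow>
       \<exists>e. e extreme_point_of G \<and> e \<in> W \<and> b < h e"
    and low: "\<And>W. open W \<Longrightarrow> W \<subseteq> V \<Longrightarrow> \<exists>e. e extreme_point_of G \<and> e \<in> W \<Longrightarrow>
       \<exists>z\<in>G \<inter> W. h z < a"
  obtains j where "range j \<subseteq> J" "independent_seq G (\<lambda>n y. y (j n))"
proof -
  \<comment> \<open>The margin \<open>a' - a\<close> equals \<open>2 * d\<close>: one
    \<open>d\<close> pays for approximating \<open>h\<close>, the other for the mass lost when a
    point is traded for an extreme point.\<close>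
  define a' where "a' = a + (b - a) / 3"
  define b' where "b' = b - (b - a) / 3"
  define d where "d = (b - a) / 6"
  have d: "d > 0" "a + d < a'" "b' \<le> b - d" "a' < b'"
    using ab by (auto simp: a'_def b'_def d_def field_simps)
  define ok where "ok W \<longleftrightarrow> open W \<and> W \<subseteq> V \<and> (\<exists>e. e extreme_point_of G \<and> e \<in> W)" for W
  have split: "\<exists>j\<in>J. \<forall>W\<in>\<W>. ok (W \<inter> {y. y j < a'}) \<and> ok (W \<inter> {y. b' < y j})"
    if \<W>: "finite \<W>" "\<forall>W\<in>\<W>. ok W" for \<W>
  proof -
    have "\<exists>e z. e extreme_point_of G \<and> e \<in> W \<and> b < h e \<and> z \<in> G \<and> h z < a \<and>
        (\<forall>j\<in>J. z j < a + d \<longrightarrow> (\<exists>e'. e' extreme_point_of G \<and> e' \<in> W \<and> e' j < a'))"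
      if "W \<in> \<W>" for W
    proof -
      have W: "open W" "W \<subseteq> V" "\<exists>e. e extreme_point_of G \<and> e \<in> W"
        using \<W>(2) that unfolding ok_def by auto
      obtain e where e: "e extreme_point_of G" "e \<in> W" "b < h e"
        using high[OF W] by blast
      \<comment> \<open>Chosen so that the loss \<open>2 * r * R\<close> fits into
        \<open>a' - (a + d)\<close>; the added 1 avoids dividing by 0.\<close>
      define r where "r = min 1 ((a' - (a + d)) / (2 * (\<bar>R\<bar> + 1)))"
      have r: "0 < r" "r \<le> 1"
        using d by (auto simp: r_def)
      have "r * (2 * (\<bar>R\<bar> + 1)) \<le> a' - (a + d)"
      proof -
        have "r \<le> (a' - (a + d)) / (2 * (\<bar>R\<bar> + 1))" by (simp add: r_def)
        then show ?thesis by (simp add: pos_le_divide_eq)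
      qed
      moreover have "2 * r * R \<le> r * (2 * (\<bar>R\<bar> + 1))"
        using r by simp
      ultimately have rR: "a + d \<le> a' - 2 * r * R"
        by linarith
      obtain N where N: "open N" "e \<in> N"
        "\<And>z j a. z \<in> N \<inter> G \<Longrightarrow> j \<in> J \<Longrightarrow> z j < a - 2 * r * R \<Longrightarrow>
           \<exists>e'. e' extreme_point_of G \<and> e' \<in> W \<and> e' j < a"
        using extreme_point_mass[OF G e(1) W(1) e(2) r, of J R] R by blast
      \<comment> \<open>Since \<open>N\<close> depends neither on the coordinate nor on the level,
        \<open>z\<close> can be fixed before \<open>j\<close> is chosen.\<close>
      obtain z where z: "z \<in> G \<inter> (N \<inter> W)" "h z < a"
        using low[of "N \<inter> W"] N(1,2) W e by blast
      then show ?thesis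
        using e N(3)[of z _ a'] rR by (intro exI[of _ e] exI[of _ z]) force
    qed
    then obtain e z where ez: "\<And>W. W \<in> \<W> \<Longrightarrow> e W extreme_point_of G \<and> e W \<in> W \<and> b < h (e W) \<and>
        z W \<in> G \<and> h (z W) < a \<and>
        (\<forall>j\<in>J. z W j < a + d \<longrightarrow> (\<exists>e'. e' extreme_point_of G \<and> e' \<in> W \<and> e' j < a'))"
      by metis
    have "finite (e ` \<W> \<union> z ` \<W>)" "e ` \<W> \<union> z ` \<W> \<subseteq> G"
      using \<W>(1) ez by (auto simp: extreme_point_of_def)
    then obtain j where j: "j \<in> J" "\<And>y. y \<in> e ` \<W> \<union> z ` \<W> \<Longrightarrow> \<bar>y j - h y\<bar> < d"
      using h d(1) by meson
    have "ok (W \<inter> {y. y j < a'}) \<and> ok (W \<inter> {y. b' < y j})" if "W \<in> \<W>" for W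
    proof -
      have "\<bar>e W j - h (e W)\<bar> < d" "\<bar>z W j - h (z W)\<bar> < d"
        using j(2) that by auto
      moreover have "b < h (e W)" "h (z W) < a"
        using ez[OF that] by auto
      ultimately have "b' < e W j" "z W j < a + d"
        using d by linarith+
      then show ?thesis
        using ez[OF that] \<W>(2) that j(1) open_coordinate_less[where i = j]
        unfolding ok_def by (auto intro!: open_Int)
    qed
    then show ?thesis using j(1) by blast
  qed
  define nxt where "nxt \<W> j = (\<lambda>W. W \<inter> {y. y j < a'}) ` \<W> \<union> (\<lambda>W. W \<inter> {y. b' < y j}) ` \<W>" for \<W> and j :: 'i
  have "\<exists>f. \<forall>n. (finite (fst (f n)) \<and> (\<forall>W\<in>fst (f n). ok W) \<and> (n = 0 \<longrightarrow> fst (f n) = {V})) \<and>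
     (snd (f (Suc n)) \<in> J \<and> fst (f (Suc n)) = nxt (fst (f n)) (snd (f (Suc n))))"
  proof (rule dependent_nat_choice)
    show "\<exists>x. finite (fst x) \<and> (\<forall>W\<in>fst x. ok W) \<and> (0 = (0::nat) \<longrightarrow> fst x = {V})"
      using V by (intro exI[of _ "({V}, undefined)"]) (simp add: ok_def)
  next
    fix x :: "('i \<Rightarrow> real) set set \<times> 'i" and n :: nat
    assume x: "finite (fst x) \<and> (\<forall>W\<in>fst x. ok W) \<and> (n = 0 \<longrightarrow> fst x = {V})"
    then obtain j where "j \<in> J" "\<forall>W\<in>fst x. ok (W \<inter> {y. y j < a'}) \<and> ok (W \<inter> {y. b' < y j})"
      using split[of "fst x"] by auto
    then show "\<exists>y. (finite (fst y) \<and> (\<forall>W\<in>fst y. ok W) \<and> (Suc n = 0 \<longrightarrow> fst y = {V})) \<and>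
        snd y \<in> J \<and> fst y = nxt (fst x) (snd y)"
      using x by (intro exI[of _ "(nxt (fst x) j, j)"]) (auto simp: nxt_def)
  qed
  then obtain f where f: "\<And>n W. W \<in> fst (f n) \<Longrightarrow> ok W" "fst (f 0) = {V}" "\<And>n. snd (f (Suc n)) \<in> J"
      "\<And>n. fst (f (Suc n)) = nxt (fst (f n)) (snd (f (Suc n)))"
    by metis
  \<comment> \<open>The state pairs a family with the coordinate that produced it. The initial
    coordinate is arbitrary, hence the shift by one.\<close>
  define j where "j n = snd (f (Suc n))" for n
  \<comment> \<open>A member of the n-th family records one choice of sides; indices outside
    \<open>P\<close> always go to the high side.\<close>
  have pattern: "\<exists>W\<in>fst (f n). \<forall>y\<in>W. \<forall>k<n. if k \<in> P then y (j k) < a' else b' < y (j k)" for n P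
  proof (induction n)
    case 0
    then show ?case using f(2) by simp
  next
    case (Suc n)
    then obtain W where W: "W \<in> fst (f n)" "\<forall>y\<in>W. \<forall>k<n. if k \<in> P then y (j k) < a' else b' < y (j k)"
      by blast
    define W' where "W' = (if n \<in> P then W \<inter> {y. y (j n) < a'} else W \<inter> {y. b' < y (j n)})"
    have "W' \<in> fst (f (Suc n))"
      unfolding f(4) nxt_def W'_def j_def[symmetric] using W(1) by auto
    moreover have "\<forall>y\<in>W'. \<forall>k<Suc n. if k \<in> P then y (j k) < a' else b' < y (j k)"
      using W(2) unfolding W'_def by (auto simp: less_Suc_eq)
    ultimately show ?case by blast
  qed
  have "independent_seq G (\<lambda>n y. y (j n))"
    unfolding independent_seq_def
  proof (rule exI[of _ a'], rule exI[of _ b'], intro conjI allI impI)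
    fix P M :: "nat set"
    assume PM: "finite P \<and> finite M \<and> P \<inter> M = {}"
    then have "finite (P \<union> M)" by blast
    then obtain n where n: "\<forall>k\<in>P \<union> M. k < n"
      by (meson finite_nat_set_iff_bounded)
    obtain W where W: "W \<in> fst (f n)" "\<forall>y\<in>W. \<forall>k<n. if k \<in> P then y (j k) < a' else b' < y (j k)"
      using pattern by blast
    obtain e where e: "e extreme_point_of G" "e \<in> W"
      using f(1)[OF W(1)] unfolding ok_def by blast
    have "k \<notin> P" if "k \<in> M" for k
      using that PM by blast
    then have "\<forall>k\<in>P. e (j k) < a'" "\<forall>k\<in>M. b' < e (j k)"
      using e(2) W(2) n by (metis UnI1, metis UnI2)
    moreover have "e \<in> G"
      using e(1) by (simp add: extreme_point_of_def)
    ultimately show "G \<inter> (\<Inter>n\<in>P. {x. x (j n) < a'}) \<inter> (\<Inter>n\<in>M. {x. b' < x (j n)}) \<noteq> {}"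
      by blast
  qed (use d in auto)
  moreover have "range j \<subseteq> J"
    using f(3) by (auto simp: j_def)
  ultimately show thesis
    using that by blast
qed

section \<open>A minimum principle for limits of evaluations\<close>

lemma closure_subset_compact_fun:
  fixes S :: "('i \<Rightarrow> real) set"
  assumes "S \<subseteq> K" "compact K"
  shows "compact (closure S)" "closure S \<subseteq> K"
proof -
  show "closure S \<subseteq> K"
    using assms compact_fun_imp_closed by (intro closure_minimal) auto
  then show "compact (closure S)"
    using compact_Int_closed[OF assms(2) closed_closure, of S] by (simp add: Int_absorb1)
qed

text \<open>Extreme points (x, s) with s < t of the closure of the part of the epigraph of h below a level t
  between h \<open>\<phi>\<close> and c satisfy s < h x, since otherwise x would be an extreme point of M. As points of the
  epigraph, where h is at most about s, accumulate at (x, s), h oscillates near these extreme points.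
  The size of the gap is made uniform by the Baire property. The extra coordinate None carries s.\<close>

lemma affine_minimum_principle:
  fixes M :: "('a \<Rightarrow> real) set" and h :: "('a \<Rightarrow> real) \<Rightarrow> real"
  assumes M: "compact M" "convex M" and R: "\<And>y j. y \<in> M \<Longrightarrow> j \<in> J \<Longrightarrow> \<bar>y j\<bar> \<le> R"
    and h: "\<And>S d. finite S \<Longrightarrow> S \<subseteq> M \<Longrightarrow> d > 0 \<Longrightarrow> \<exists>j\<in>J. \<forall>y\<in>S. \<bar>y j - h y\<bar> < d"
    and affine: "\<And>x y u. x \<in> M \<Longrightarrow> y \<in> M \<Longrightarrow> 0 \<le> u \<Longrightarrow> u \<le> 1 \<Longrightarrow>
       h (u *\<^sub>R x + (1 - u) *\<^sub>R y) = u * h x + (1 - u) * h y"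
    and ext: "\<And>e. e extreme_point_of M \<Longrightarrow> c \<le> h e"
    and \<phi>: "\<phi> \<in> M" "h \<phi> < c"
  obtains j where "range j \<subseteq> J" "independent_seq M (\<lambda>n y. y (j n))"
proof -
  \<comment> \<open>Both inequalities must be strict: the first places a point of \<open>G\<close>
    below the top level, the second excludes extreme points of \<open>M\<close> from the
    sublevel.\<close>
  obtain t where t: "h \<phi> < t" "t < c"
    using \<phi>(2) dense by blast
  define pr where "pr y = (\<lambda>i. y (Some i))" for y :: "'a option \<Rightarrow> real"
  define lift where "lift x s = case_option s x" for x :: "'a \<Rightarrow> real" and s :: real
  have pr_lift [simp]: "pr (lift x s) = x" and lift_None [simp]: "lift x s None = s"
    and lift_pr: "lift (pr y) (y None) = y" for x s y
    by (auto simp: pr_def lift_def fun_eq_iff split: option.split)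
  have pr_comb: "pr (u *\<^sub>R x + v *\<^sub>R y) = u *\<^sub>R pr x + v *\<^sub>R pr y" for u v x y
    by (simp add: pr_def fun_eq_iff)
  have lift_comb: "lift (u *\<^sub>R x + v *\<^sub>R y) (u * r + v * s) = u *\<^sub>R lift x r + v *\<^sub>R lift y s" for u v x y r s
    by (auto simp: lift_def fun_eq_iff split: option.split)
  have h_bound: "\<bar>h x\<bar> \<le> R" if xM: "x \<in> M" for x
  proof (rule field_le_epsilon)
    fix d :: real assume "d > 0"
    then obtain j where "j \<in> J" "\<bar>x j - h x\<bar> < d"
      using h[of "{x}" d] xM by auto
    then show "\<bar>h x\<bar> \<le> R + d"
      using R[OF xM, of j] by linarith
  qed
  define G0 where "G0 = {y. pr y \<in> M \<and> h (pr y) \<le> y None \<and> y None \<le> t}"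
  define G where "G = closure G0"
  have "convex G0"
  proof (rule convexI)
    fix x y and u v :: real
    assume *: "x \<in> G0" "y \<in> G0" "0 \<le> u" "0 \<le> v" "u + v = 1"
    then have v: "v = 1 - u" by simp
    have "u * h (pr x) + v * h (pr y) \<le> u * x None + v * y None"
      using * by (intro add_mono mult_left_mono) (auto simp: G0_def)
    moreover have "u * x None + v * y None \<le> t"
      using * by (intro convex_bound_le) (auto simp: G0_def)
    moreover have "u *\<^sub>R pr x + v *\<^sub>R pr y \<in> M"
      using * M(2) by (intro convexD) (auto simp: G0_def)
    moreover have "h (u *\<^sub>R pr x + v *\<^sub>R pr y) = u * h (pr x) + v * h (pr y)"
      using * unfolding v by (intro affine) (auto simp: G0_def)
    ultimately show "u *\<^sub>R x + v *\<^sub>R y \<in> G0"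
      by (simp add: G0_def pr_comb)
  qed
  then have convG: "convex G"
    unfolding G_def by (rule closure_convex_fun)
  define Q where "Q = (\<lambda>p. lift (fst p) (snd p)) ` (M \<times> {- R..t})"
  have "compact Q"
    unfolding Q_def
  proof (intro compact_continuous_image compact_Times M compact_Icc continuous_on_coordinatewise_then_product)
    fix i :: "'a option"
    show "continuous_on (M \<times> {- R..t}) (\<lambda>p. lift (fst p) (snd p) i)"
    proof (cases i)
      case None
      then show ?thesis by (simp add: continuous_intros)
    next
      case (Some b)
      have "continuous_on (M \<times> {- R..t}) (\<lambda>p. fst p b)"
        by (intro continuous_on_coordinate continuous_intros)
      then show ?thesis
        using Some by (simp add: lift_def)
    qed
  qed
  moreover have "G0 \<subseteq> Q"
  proof
    fix y assume y: "y \<in> G0"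
    then have "- R \<le> y None"
      using h_bound[of "pr y"] by (auto simp: G0_def)
    then show "y \<in> Q"
      using y lift_pr[of y] unfolding Q_def G0_def by (intro image_eqI[of _ _ "(pr y, y None)"]) auto
  qed
  ultimately have compG: "compact G" and GQ: "G \<subseteq> Q"
    unfolding G_def using closure_subset_compact_fun by blast+
  have prG: "pr y \<in> M" "y None \<le> t" if "y \<in> G" for y
    using GQ that unfolding Q_def by auto
  have liftG: "lift x s \<in> G" if "x \<in> M" "h x \<le> s" "s \<le> t" for x s
    using that closure_subset[of G0] unfolding G_def by (auto simp: G0_def)
  define h' where "h' y = h (pr y)" for y
  define U where "U = {y :: 'a option \<Rightarrow> real. y None < t}"
  have "open U"
    unfolding U_def by (rule open_coordinate_less)
  \<comment> \<open>Otherwise Krein-Milman would confine \<open>G\<close> to the top level, while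
    the graph point over \<open>\<phi>\<close> lies strictly below it.\<close>
  have "\<exists>e. e extreme_point_of G \<and> e \<in> U"
  proof (rule ccontr)
    assume no: "\<not> ?thesis"
    have "G \<subseteq> G \<inter> {y. t \<le> y None}"
    proof (rule compact_convex_contains_extreme[OF compG convG])
      show "compact (G \<inter> {y. t \<le> y None})" "convex (G \<inter> {y. t \<le> y None})"
        using compG convG
        by (auto intro!: compact_Int_closed closed_coordinate_le convex_Int convex_coordinate)
      fix e assume "e extreme_point_of G"
      then show "e \<in> G \<inter> {y. t \<le> y None}"
        using no by (auto simp: extreme_point_of_def U_def)
    qed
    then show False
      using liftG[OF \<phi>(1), of "h \<phi>"] t(1) by auto
  qed
  then obtain e0 where e0: "e0 extreme_point_of G" "e0 \<in> U" by blast
  \<comment> \<open>If \<open>h x < s\<close>, then \<open>e\<close> lies inside a vertical segment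
    reaching up to \<open>t\<close>. If \<open>h x = s\<close>, then \<open>h x < c\<close>, so
    \<open>x\<close> splits in \<open>M\<close>, and affinity of \<open>h\<close> splits
    \<open>e\<close> along the graph. Either way \<open>e\<close> is not extreme.\<close>
  have gap: "e None < h' e" if e: "e extreme_point_of G" "e \<in> U" for e
  proof (rule ccontr)
    assume "\<not> e None < h' e"
    define x where "x = pr e"
    define s where "s = e None"
    have xs: "e = lift x s" "h x \<le> s" "s < t"
      using \<open>\<not> _\<close> e(2) lift_pr[of e] by (auto simp: x_def s_def h'_def U_def)
    have xM: "x \<in> M"
      using prG(1)[of e] e(1) by (auto simp: x_def extreme_point_of_def)
    have s: "h x = s"
    proof (rule ccontr)
      assume "h x \<noteq> s"
      then have less: "h x < s" using xs by simp
      define u where "u = (t - s) / (t - h x)"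
      have u: "0 < u" "u < 1"
        using less xs by (auto simp: u_def)
      have "u * (t - h x) = t - s"
        using less xs by (simp add: u_def)
      then have "s = u * h x + (1 - u) * t"
        by (simp add: algebra_simps)
      then have "e = u *\<^sub>R lift x (h x) + (1 - u) *\<^sub>R lift x t"
        unfolding xs(1) lift_comb[symmetric] by (simp flip: scaleR_add_left)
      then have "lift x (h x) = e"
        using extreme_point_of_combination(1)[OF e(1), of "lift x (h x)" "lift x t" u] u liftG xM less xs by auto
      then show False
        using less by (metis lift_None s_def less_irrefl)
    qed
    have "\<not> x extreme_point_of M"
      using ext[of x] s xs t by auto
    then obtain a b u where ab: "a \<in> M" "b \<in> M" "a \<noteq> b" "0 < u" "u < 1" "x = (1 - u) *\<^sub>R a + u *\<^sub>R b"
      using xM by (auto simp: extreme_point_of_def in_segment)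
    \<comment> \<open>Contracting \<open>M\<close> towards \<open>x\<close> by \<open>w\<close>
      raises \<open>h\<close> above \<open>s\<close> by at most
      \<open>2 * w * \<bar>R\<bar>\<close>, so the two graph points stay below \<open>t\<close>. The
      added 1 covers \<open>R = 0\<close>.\<close>
    define w where "w = min 1 ((t - s) / (2 * \<bar>R\<bar> + 1))"
    have w: "0 < w" "w \<le> 1"
      using xs(3) by (auto simp: w_def)
    have "w \<le> (t - s) / (2 * \<bar>R\<bar> + 1)" by (simp add: w_def)
    then have wR: "w * (2 * \<bar>R\<bar> + 1) \<le> t - s"
      by (simp add: pos_le_divide_eq)
    define p where "p y = w *\<^sub>R y + (1 - w) *\<^sub>R x" for y
    have p: "p y \<in> M" "h (p y) \<le> t" "h (p y) = w * h y + (1 - w) * h x" if "y \<in> M" for y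
    proof -
      show eq: "h (p y) = w * h y + (1 - w) * h x"
        unfolding p_def using that xM w by (intro affine) auto
      show "p y \<in> M"
        unfolding p_def using that xM w M(2) by (intro convexD) auto
      have "h y - h x \<le> 2 * \<bar>R\<bar> + 1"
        using h_bound[OF that] h_bound[OF xM] by linarith
      then have "w * (h y - h x) \<le> w * (2 * \<bar>R\<bar> + 1)"
        using w by (intro mult_left_mono) auto
      then show "h (p y) \<le> t"
        using wR unfolding eq s by (simp add: algebra_simps)
    qed
    have x_eq: "x = (1 - u) *\<^sub>R p a + u *\<^sub>R p b"
    proof -
      have "(1 - u) *\<^sub>R p a + u *\<^sub>R p b = w *\<^sub>R ((1 - u) *\<^sub>R a + u *\<^sub>R b) + (1 - w) *\<^sub>R x"
        unfolding p_def by (simp add: fun_eq_iff algebra_simps)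
      also have "\<dots> = x"
        unfolding ab(6)[symmetric] by (simp flip: scaleR_add_left)
      finally show ?thesis ..
    qed
    have "h x = (1 - u) * h a + (1 - (1 - u)) * h b"
      unfolding ab(6) using ab(1,2,4,5) affine[of a b "1 - u"] by simp
    then have hx: "h x = (1 - u) * h a + u * h b"
      by simp
    have "(1 - u) * h (p a) + u * h (p b) = w * ((1 - u) * h a + u * h b) + (1 - w) * h x"
      unfolding p(3)[OF ab(1)] p(3)[OF ab(2)] by (simp add: algebra_simps)
    also have "\<dots> = s"
      unfolding hx[symmetric] s by (simp add: algebra_simps)
    finally have "s = (1 - u) * h (p a) + u * h (p b)" ..
    then have e_eq: "e = (1 - u) *\<^sub>R lift (p a) (h (p a)) + (1 - (1 - u)) *\<^sub>R lift (p b) (h (p b))"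
      unfolding xs(1) using x_eq lift_comb[of "1 - u" "p a" u "p b"] by simp
    have "lift (p a) (h (p a)) = e" "lift (p b) (h (p b)) = e"
      using extreme_point_of_combination[OF e(1) _ _ _ _ e_eq] liftG[OF p(1) order_refl p(2)] ab by auto
    then have "p a = p b"
      by (metis pr_lift)
    then have "w *\<^sub>R a = w *\<^sub>R b"
      by (simp add: p_def)
    then show False
      using w ab(3) by simp
  qed
  \<comment> \<open>Every gap between \<open>e None\<close> and \<open>h' e\<close> contains two
    rationals. Countably many pairs suffice, so the Baire argument finds one pair valid on a dense
    set of extreme points in some open set.\<close>
  define q where "q = from_nat_into (\<rat> \<times> \<rat> :: (real \<times> real) set)"
  define E where "E n = {e. e None < fst (q n) \<and> fst (q n) < snd (q n) \<and> snd (q n) < h' e}" for n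
  have "\<exists>n. e \<in> E n" if eU: "e extreme_point_of G" "e \<in> U" for e
  proof -
    obtain r1 where r1: "r1 \<in> \<rat>" "e None < r1" "r1 < h' e"
      using gap[OF eU] Rats_dense_in_real by blast
    obtain r2 where r2: "r2 \<in> \<rat>" "r1 < r2" "r2 < h' e"
      using r1 Rats_dense_in_real by blast
    have "countable (\<rat> \<times> \<rat> :: (real \<times> real) set)"
      using countable_rat by blast
    then obtain n where "q n = (r1, r2)"
      unfolding q_def using from_nat_into_surj[of "\<rat> \<times> \<rat>" "(r1, r2)"] r1 r2 by auto
    then show ?thesis
      using r1 r2 by (intro exI[of _ n]) (simp add: E_def)
  qed
  then obtain n V where V: "open V" "V \<subseteq> U" "\<exists>e. e extreme_point_of G \<and> e \<in> V"
    "\<And>W. open W \<Longrightarrow> W \<subseteq> V \<Longrightarrow> \<exists>e. e extreme_point_of G \<and> e \<in> W \<Longrightarrow>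
       \<exists>e. e extreme_point_of G \<and> e \<in> W \<and> e \<in> E n"
    using extreme_points_Baire[OF compG convG \<open>open U\<close> e0, of E] by metis
  obtain j where j: "range j \<subseteq> Some ` J" "independent_seq G (\<lambda>n y. y (j n))"
  proof (rule independent_seq_from_oscillation[OF compG convG, of "Some ` J" R h' "fst (q n)" "snd (q n)" V])
    show "\<bar>y j\<bar> \<le> R" if "y \<in> G" "j \<in> Some ` J" for y j
      using R[OF prG(1)[OF that(1)]] that(2) by (auto simp: pr_def)
    show "\<exists>j\<in>Some ` J. \<forall>y\<in>S. \<bar>y j - h' y\<bar> < d" if "finite S" "S \<subseteq> G" "d > 0" for S d
      using h[of "pr ` S" d] that prG(1) by (auto simp: pr_def h'_def)
    show "fst (q n) < snd (q n)"
      using V(4)[OF V(1) order_refl V(3)] by (auto simp: E_def)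
    show "\<exists>e. e extreme_point_of G \<and> e \<in> W \<and> snd (q n) < h' e"
      if "open W" "W \<subseteq> V" "\<exists>e. e extreme_point_of G \<and> e \<in> W" for W
      using V(4)[OF that] by (auto simp: E_def)
    \<comment> \<open>At the extreme point itself \<open>h'\<close> is high. The low value comes
      from a nearby point of the unclosed epigraph, where \<open>h'\<close> is at most the last
      coordinate.\<close>
    show "\<exists>z\<in>G \<inter> W. h' z < fst (q n)"
      if W: "open W" "W \<subseteq> V" "\<exists>e. e extreme_point_of G \<and> e \<in> W" for W
    proof -
      obtain e where e: "e extreme_point_of G" "e \<in> W" "e None < fst (q n)"
        using V(4)[OF W] by (auto simp: E_def)
      have "open (W \<inter> {y. y None < fst (q n)})"
        using W(1) by (intro open_Int open_coordinate_less(1))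
      moreover have "e \<in> closure G0"
        using e(1) by (simp add: extreme_point_of_def G_def)
      ultimately obtain z where "z \<in> G0" "z \<in> W" "z None < fst (q n)"
        using e closure_iff_nhds_not_empty[of e G0] by blast
      then show ?thesis
        using closure_subset[of G0] unfolding G_def by (intro bexI[of _ z]) (auto simp: G0_def h'_def)
    qed
    show "open V" "\<exists>e. e extreme_point_of G \<and> e \<in> V"
      by (rule V(1), rule V(3))
  qed (rule that)
  \<comment> \<open>The coordinate carrying \<open>s\<close> is never among the \<open>j n\<close>,
    so the patterns depend on the projection alone and descend from \<open>G\<close> to
    \<open>M\<close>.\<close>
  define k where "k n = the (j n)" for n
  have j_in: "j n \<in> Some ` J" for n
    by (rule subsetD[OF j(1) rangeI])
  have jk: "j n = Some (k n)" "k n \<in> J" for n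
    using j_in[of n] by (auto simp: k_def)
  have "independent_seq M (\<lambda>n y. y (k n))"
  proof -
    from j(2) obtain a b where "a < b" and ind: "\<forall>P Q. finite P \<and> finite Q \<and> P \<inter> Q = {} \<longrightarrow>
      G \<inter> (\<Inter>n\<in>P. {x. x (j n) < a}) \<inter> (\<Inter>n\<in>Q. {x. b < x (j n)}) \<noteq> {}"
      unfolding independent_seq_def by (elim exE conjE)
    show ?thesis
      unfolding independent_seq_def
    proof (rule exI[of _ a], rule exI[of _ b], intro conjI allI impI)
      fix P Q :: "nat set"
      assume "finite P \<and> finite Q \<and> P \<inter> Q = {}"
      then have "G \<inter> (\<Inter>n\<in>P. {x. x (j n) < a}) \<inter> (\<Inter>n\<in>Q. {x. b < x (j n)}) \<noteq> {}"
        by (rule ind[rule_format])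
      then obtain y where y: "y \<in> G" "\<forall>n\<in>P. y (j n) < a" "\<forall>n\<in>Q. b < y (j n)"
        by blast
      have "pr y \<in> M \<inter> (\<Inter>n\<in>P. {x. x (k n) < a}) \<inter> (\<Inter>n\<in>Q. {x. b < x (k n)})"
        using y(2,3) prG(1)[OF y(1)] by (auto simp: pr_def jk(1))
      then show "M \<inter> (\<Inter>n\<in>P. {x. x (k n) < a}) \<inter> (\<Inter>n\<in>Q. {x. b < x (k n)}) \<noteq> {}"
        by blast
    qed (rule \<open>a < b\<close>)
  qed
  then show thesis
    using that[of k] jk(2) by blast
qed

section \<open>Sublinear functionals and minimax\<close>

definition sublinear :: "('v::real_vector \<Rightarrow> real) \<Rightarrow> bool" where
  "sublinear p \<longleftrightarrow> (\<forall>x y. p (x + y) \<le> p x + p y) \<and> (\<forall>c x. 0 \<le> c \<longrightarrow> p (c *\<^sub>R x) = c * p x)"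

lemma sublinear_ge:
  assumes "sublinear p"
  shows "- p (- x) \<le> p x" "p 0 = 0"
proof -
  have "p (0 *\<^sub>R x) = 0 * p x"
    using assms unfolding sublinear_def by blast
  then show "p 0 = 0" by simp
  moreover have "p (x + - x) \<le> p x + p (- x)"
    using assms unfolding sublinear_def by blast
  ultimately show "- p (- x) \<le> p x" by simp
qed

text \<open>Applying the inequality for scalars to \<open>1 / c\<close> as well turns it into
  equality.\<close>

lemma sublinearI:
  assumes "\<And>x y. p (x + y) \<le> p x + p y" "\<And>c x. 0 < c \<Longrightarrow> p (c *\<^sub>R x) \<le> c * p x" "p 0 = 0"
  shows "sublinear p"
  unfolding sublinear_def
proof (intro conjI allI impI assms(1))
  fix c :: real and x assume "0 \<le> c"
  show "p (c *\<^sub>R x) = c * p x"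
  proof (cases "c = 0")
    case False
    then have c: "c > 0" using \<open>0 \<le> c\<close> by simp
    have "p ((1 / c) *\<^sub>R (c *\<^sub>R x)) \<le> (1 / c) * p (c *\<^sub>R x)"
      using c by (intro assms(2)) auto
    then have "c * p x \<le> p (c *\<^sub>R x)"
      using c by (simp add: field_simps)
    then show ?thesis
      using assms(2)[OF c, of x] by simp
  qed (use assms(3) in simp)
qed

text \<open>A minimal sublinear functional m is linear: the sublinear functional
  \<open>x \<mapsto> inf\<close> over \<open>t \<ge> 0\<close> of m (x + t a) - t m a lies below m, so it equals m, and m is superadditive.\<close>

theorem linear_below_sublinear:
  fixes p :: "'v::real_vector \<Rightarrow> real"
  assumes p: "sublinear p"
  obtains f where "linear f" "\<And>x. f x \<le> p x"
proof -
  define S where "S = {q. sublinear q \<and> (\<forall>x. q x \<le> p x)}"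
  have lb: "- p (- x) \<le> q x" if "q \<in> S" for q x
  proof -
    have "- q (- x) \<le> q x" "q (- x) \<le> p (- x)"
      using that sublinear_ge(1)[of q x] unfolding S_def by auto
    then show ?thesis by linarith
  qed
  \<comment> \<open>The order is reversed, so that a Zorn maximal element is a minimal
    functional.\<close>
  define le where "le q r \<longleftrightarrow> (\<forall>x. r x \<le> q x)" for q r :: "'v \<Rightarrow> real"
  have "\<exists>m\<in>S. \<forall>q\<in>S. le m q \<longrightarrow> q = m"
  proof (rule predicate_Zorn)
    show "partial_order_on S (relation_of le S)"
      by (rule partial_order_on_relation_ofI) (auto simp: le_def fun_eq_iff intro: order_trans order_antisym)
    fix C assume C: "C \<in> Chains (relation_of le S)"
    show "\<exists>u\<in>S. \<forall>a\<in>C. le a u"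
    proof (cases "C = {}")
      case True
      then show ?thesis using p unfolding S_def by auto
    next
      case False
      have CS: "C \<subseteq> S" and tot: "\<And>q r. q \<in> C \<Longrightarrow> r \<in> C \<Longrightarrow> le q r \<or> le r q"
        using C unfolding Chains_def relation_of_def by blast+
      define u where "u x = (INF q\<in>C. q x)" for x
      have bdd: "bdd_below ((\<lambda>q. q x) ` C)" for x
        using lb CS by (intro bdd_belowI2[of _ "- p (- x)"]) auto
      have u_le: "u x \<le> q x" if "q \<in> C" for q x
        unfolding u_def using that by (intro cINF_lower bdd)
      have u_ge: "c \<le> u x" if "\<And>q. q \<in> C \<Longrightarrow> c \<le> q x" for c x
        unfolding u_def using that False by (intro cINF_greatest) auto
      have sub: "q (x + y) \<le> q x + q y" "0 < c \<Longrightarrow> q (c *\<^sub>R x) = c * q x" "q 0 = 0" if "q \<in> C" for q x y c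
        using that CS sublinear_ge(2)[of q] unfolding S_def sublinear_def by auto
      have "sublinear u"
      proof (rule sublinearI)
        fix x y
        \<comment> \<open>In a chain, the smaller of \<open>q\<close> and \<open>r\<close> serves at
          both points, which makes the infimum subadditive.\<close>
        have *: "u (x + y) - q x \<le> r y" if qr: "q \<in> C" "r \<in> C" for q r
        proof -
          obtain s where "s \<in> C" "s x \<le> q x" "s y \<le> r y"
            using tot[OF qr] qr unfolding le_def by blast
          then show ?thesis
            using u_le[of s "x + y"] sub(1)[of s x y] by linarith
        qed
        have "u (x + y) - q x \<le> u y" if "q \<in> C" for q
          using *[OF that] by (rule u_ge)
        then have "u (x + y) - u y \<le> u x"
          by (intro u_ge) (smt (verit))
        then show "u (x + y) \<le> u x + u y" by simp
      next
        fix c :: real and x assume c: "0 < c"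
        have "u (c *\<^sub>R x) / c \<le> u x"
          using u_le[of _ "c *\<^sub>R x"] sub(2)[OF _ c] c by (intro u_ge) (force simp: field_simps)
        then show "u (c *\<^sub>R x) \<le> c * u x"
          using c by (simp add: field_simps)
      next
        show "u 0 = 0"
        proof -
          have "u 0 = (INF q\<in>C. 0)"
            unfolding u_def using sub(3) by (intro INF_cong) auto
          then show ?thesis using False by simp
        qed
      qed
      moreover have "u x \<le> p x" for x
        using False u_le CS unfolding S_def by (metis (mono_tags, lifting) ex_in_conv mem_Collect_eq order_trans subsetD)
      ultimately have "u \<in> S" by (simp add: S_def)
      then show ?thesis using u_le unfolding le_def by blast
    qed
  qed
  then obtain m where "m \<in> S" and max: "\<And>q. q \<in> S \<Longrightarrow> le m q \<Longrightarrow> q = m"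
    by blast
  then have m: "sublinear m" "\<And>x. m x \<le> p x"
    unfolding S_def by auto
  have min: "q = m" if "sublinear q" "\<And>x. q x \<le> m x" for q
    using that max[of q] m(2) unfolding S_def le_def by (auto intro: order_trans)
  have super: "m x + m a \<le> m (x + a)" for x a
  proof -
    define q where "q x = (INF t\<in>{0..}. m (x + t *\<^sub>R a) - t * m a)" for x
    have lower: "- m (- x) \<le> m (x + t *\<^sub>R a) - t * m a" if "0 \<le> t" for x t
    proof -
      have "m (t *\<^sub>R a) \<le> m (x + t *\<^sub>R a) + m (- x)"
        using m(1) unfolding sublinear_def by (metis add.commute add_minus_cancel)
      moreover have "m (t *\<^sub>R a) = t * m a"
        using m(1) that unfolding sublinear_def by blast
      ultimately show ?thesis by linarith
    qed
    have bdd: "bdd_below ((\<lambda>t. m (x + t *\<^sub>R a) - t * m a) ` {0..})" for x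
      using lower by (intro bdd_belowI2[of _ "- m (- x)"]) auto
    have q_le: "q x \<le> m (x + t *\<^sub>R a) - t * m a" if "0 \<le> t" for x t
      unfolding q_def using that by (intro cINF_lower bdd) auto
    have q_ge: "c \<le> q x" if "\<And>t. 0 \<le> t \<Longrightarrow> c \<le> m (x + t *\<^sub>R a) - t * m a" for c x
      unfolding q_def using that by (intro cINF_greatest) auto
    have "sublinear q"
    proof (rule sublinearI)
      fix x y
      show "q (x + y) \<le> q x + q y"
      proof -
        have "q (x + y) - (m (x + t *\<^sub>R a) - t * m a) \<le> m (y + s *\<^sub>R a) - s * m a" if "0 \<le> t" "0 \<le> s" for s t
        proof -
          have "q (x + y) \<le> m ((x + y) + (t + s) *\<^sub>R a) - (t + s) * m a"
            using that by (intro q_le) auto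
          also have "(x + y) + (t + s) *\<^sub>R a = (x + t *\<^sub>R a) + (y + s *\<^sub>R a)"
            by (simp add: scaleR_add_left)
          also have "m \<dots> \<le> m (x + t *\<^sub>R a) + m (y + s *\<^sub>R a)"
            using m(1) unfolding sublinear_def by blast
          finally show ?thesis by (simp add: algebra_simps)
        qed
        then have "q (x + y) - (m (x + t *\<^sub>R a) - t * m a) \<le> q y" if "0 \<le> t" for t
          using that q_ge by blast
        then have "q (x + y) - q y \<le> q x"
          by (intro q_ge) (smt (verit))
        then show ?thesis by simp
      qed
    next
      fix c :: real and x assume c: "0 < c"
      have "q (c *\<^sub>R x) / c \<le> q x"
      proof (rule q_ge)
        fix t :: real assume "0 \<le> t"
        then have "q (c *\<^sub>R x) \<le> m (c *\<^sub>R x + (c * t) *\<^sub>R a) - (c * t) * m a"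
          using c by (intro q_le) auto
        also have "c *\<^sub>R x + (c * t) *\<^sub>R a = c *\<^sub>R (x + t *\<^sub>R a)"
          by (simp add: scaleR_add_right)
        also have "m (c *\<^sub>R (x + t *\<^sub>R a)) = c * m (x + t *\<^sub>R a)"
          using m(1) c unfolding sublinear_def by (meson less_imp_le)
        finally show "q (c *\<^sub>R x) / c \<le> m (x + t *\<^sub>R a) - t * m a"
          using c by (simp add: field_simps)
      qed
      then show "q (c *\<^sub>R x) \<le> c * q x"
        using c by (simp add: field_simps)
    next
      show "q 0 = 0"
        using q_le[of 0 0] q_ge[of 0 0] lower[of _ 0] sublinear_ge[OF m(1)] by force
    qed
    moreover have "q x \<le> m x" for x
      using q_le[of 0 x] by simp
    ultimately have "q = m"
      using min by blast
    then show ?thesis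
      using q_le[of 1 x] by simp
  qed
  have add: "m (x + y) = m x + m y" for x y
    using super[of x y] m(1) unfolding sublinear_def by (simp add: order_antisym)
  have "linear m"
  proof (rule linearI)
    fix c :: real and x
    have neg: "m (- x) = - m x" for x
      using add[of x "- x"] sublinear_ge(2)[OF m(1)] by simp
    show "m (c *\<^sub>R x) = c *\<^sub>R m x"
    proof (cases "0 \<le> c")
      case True
      then show ?thesis using m(1) unfolding sublinear_def by simp
    next
      case False
      then have "m ((- c) *\<^sub>R x) = (- c) * m x"
        using m(1) unfolding sublinear_def by (meson le_minus_iff linear neg_0_le_iff_le)
      then show ?thesis
        using neg[of "c *\<^sub>R x"] by simp
    qed
  qed (rule add)
  then show thesis
    using that m(2) by blast
qed

text \<open>D lists lower bounds demanded of the functional. Over the cone generated by D, the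
  infimum of \<open>p (v + x) - a\<close> is sublinear. A linear functional below it lies below
  \<open>p\<close>, by the cone's apex, and meets each demand \<open>(w, r)\<close>, by taking
  \<open>v = - w\<close>.\<close>

theorem Mazur_Orlicz:
  fixes p :: "'v::real_vector \<Rightarrow> real"
  assumes p: "sublinear p" and D: "convex D" "D \<noteq> {}" and ge: "\<And>w r. (w, r) \<in> D \<Longrightarrow> r \<le> p w"
  obtains f where "linear f" "\<And>x. f x \<le> p x" "\<And>w r. (w, r) \<in> D \<Longrightarrow> r \<le> f w"
proof -
  define C where "C = {(s *\<^sub>R w, s * r) |s w r. 0 \<le> s \<and> (w, r) \<in> D}"
  obtain w0 r0 where w0: "(w0, r0) \<in> D"
    using D(2) by auto
  have C0: "(0, 0) \<in> C"
  proof -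
    have "(0 *\<^sub>R w0, 0 * r0) \<in> C"
      unfolding C_def using w0 by blast
    then show ?thesis by simp
  qed
  have Cadd: "(x + y, a + b) \<in> C" if xy: "(x, a) \<in> C" "(y, b) \<in> C" for x y a b
  proof -
    obtain s w r where s: "x = s *\<^sub>R w" "a = s * r" "0 \<le> s" "(w, r) \<in> D"
      using xy(1) unfolding C_def by blast
    obtain s' w' r' where s': "y = s' *\<^sub>R w'" "b = s' * r'" "0 \<le> s'" "(w', r') \<in> D"
      using xy(2) unfolding C_def by blast
    show ?thesis
    proof (cases "s + s' = 0")
      case True
      then have "s = 0" "s' = 0" using s s' by auto
      then show ?thesis using C0 s s' by simp
    next
      case False
      then have pos: "s + s' > 0" using s s' by simp
      define u where "u = s / (s + s')"
      define v where "v = s' / (s + s')"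
      have uv: "0 \<le> u" "0 \<le> v" "u + v = 1" "(s + s') * u = s" "(s + s') * v = s'"
        using pos s s' by (auto simp: u_def v_def simp flip: add_divide_distrib)
      have "u *\<^sub>R (w, r) + v *\<^sub>R (w', r') \<in> D"
        using D(1) uv s s' by (intro convexD) auto
      then have "(u *\<^sub>R w + v *\<^sub>R w', u * r + v * r') \<in> D" by simp
      moreover have "x + y = (s + s') *\<^sub>R (u *\<^sub>R w + v *\<^sub>R w')"
        by (simp only: scaleR_add_right scaleR_scaleR uv s s')
      moreover have "a + b = (s + s') * (u * r + v * r')"
        by (simp only: distrib_left mult.assoc[symmetric] uv s s')
      ultimately show ?thesis
        unfolding C_def using pos by (intro CollectI exI[of _ "s + s'"]) force
    qed
  qed
  have Cscale: "(c *\<^sub>R x, c * a) \<in> C" if ca: "(x, a) \<in> C" "0 \<le> c" for c x a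
  proof -
    obtain s w r where s: "x = s *\<^sub>R w" "a = s * r" "0 \<le> s" "(w, r) \<in> D"
      using ca(1) unfolding C_def by blast
    then show ?thesis
      unfolding C_def using ca(2) by (intro CollectI exI[of _ "c * s"] exI[of _ w] exI[of _ r]) simp
  qed
  have Cp: "a \<le> p x" if xa: "(x, a) \<in> C" for x a
  proof -
    obtain s w r where s: "x = s *\<^sub>R w" "a = s * r" "0 \<le> s" "(w, r) \<in> D"
      using xa unfolding C_def by blast
    then show ?thesis
      using p ge[OF s(4)] mult_left_mono[of r "p w" s] unfolding sublinear_def by simp
  qed
  define q where "q v = (INF y\<in>C. p (v + fst y) - snd y)" for v
  have lower: "- p (- v) \<le> p (v + x) - a" if xa: "(x, a) \<in> C" for v x a
  proof -
    have "p (v + x + - v) \<le> p (v + x) + p (- v)"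
      using p unfolding sublinear_def by blast
    then show ?thesis
      using Cp[OF xa] by simp
  qed
  have bdd: "bdd_below ((\<lambda>y. p (v + fst y) - snd y) ` C)" for v
    using lower by (intro bdd_belowI2[of _ "- p (- v)"]) auto
  have q_le: "q v \<le> p (v + x) - a" if "(x, a) \<in> C" for v x a
    unfolding q_def using cINF_lower[OF bdd that, of v] by simp
  have q_ge: "c \<le> q v" if "\<And>x a. (x, a) \<in> C \<Longrightarrow> c \<le> p (v + x) - a" for c v
    unfolding q_def using that C0 by (intro cINF_greatest) auto
  have "sublinear q"
  proof (rule sublinearI)
    fix x y
    have "q (x + y) - (p (x + v) - a) \<le> p (y + w) - b" if vw: "(v, a) \<in> C" "(w, b) \<in> C" for v w a b
    proof -
      have "q (x + y) \<le> p ((x + y) + (v + w)) - (a + b)"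
        by (rule q_le[OF Cadd[OF vw]])
      also have "(x + y) + (v + w) = (x + v) + (y + w)" by simp
      also have "p \<dots> \<le> p (x + v) + p (y + w)"
        using p unfolding sublinear_def by blast
      finally show ?thesis by simp
    qed
    then have "q (x + y) - (p (x + v) - a) \<le> q y" if "(v, a) \<in> C" for v a
      using that q_ge by blast
    then have "q (x + y) - q y \<le> q x"
      by (intro q_ge) (smt (verit))
    then show "q (x + y) \<le> q x + q y" by simp
  next
    fix c :: real and x assume c: "0 < c"
    have "q (c *\<^sub>R x) / c \<le> q x"
    proof (rule q_ge)
      fix y a assume "(y, a) \<in> C"
      then have "q (c *\<^sub>R x) \<le> p (c *\<^sub>R x + c *\<^sub>R y) - c * a"
        using c by (intro q_le Cscale) auto
      also have "p (c *\<^sub>R x + c *\<^sub>R y) = c * p (x + y)"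
        using p c unfolding sublinear_def by (metis less_imp_le scaleR_add_right)
      finally show "q (c *\<^sub>R x) / c \<le> p (x + y) - a"
        using c by (simp add: field_simps)
    qed
    then show "q (c *\<^sub>R x) \<le> c * q x"
      using c by (simp add: field_simps)
  next
    have "0 \<le> q 0"
      using Cp by (intro q_ge) simp
    then show "q 0 = 0"
      using q_le[OF C0, of 0] sublinear_ge(2)[OF p] by simp
  qed
  then obtain f where f: "linear f" "\<And>x. f x \<le> q x"
    using linear_below_sublinear by blast
  have "f x \<le> p x" for x
    using f(2)[of x] q_le[OF C0, of x] by simp
  moreover have "r \<le> f w" if "(w, r) \<in> D" for w r
  proof -
    have "(w, r) \<in> C"
      unfolding C_def using that by (intro CollectI exI[of _ 1]) auto
    then have "q (- w) \<le> - r"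
      using q_le[of w r "- w"] sublinear_ge(2)[OF p] by simp
    then show ?thesis
      using f(2)[of "- w"] linear_neg[OF f(1), of w] by simp
  qed
  ultimately show thesis
    using that f(1) by blast
qed

text \<open>A linear functional dominated by the maximum over F is a vector of probability weights
  on F. Mazur-Orlicz supplies one that also satisfies the demands
  \<open>- c \<le> f (- w)\<close>.\<close>

lemma finite_minimax:
  fixes W :: "('i \<Rightarrow> real) set"
  assumes F: "finite F" "F \<noteq> {}" and W: "convex W" "W \<noteq> {}"
    and no: "\<And>w. w \<in> W \<Longrightarrow> \<exists>i\<in>F. w i \<le> c"
  obtains l where "\<And>i. i \<in> F \<Longrightarrow> 0 \<le> l i" "sum l F = 1" "\<And>w. w \<in> W \<Longrightarrow> (\<Sum>i\<in>F. l i * w i) \<le> c"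
proof -
  define p where "p v = Max (v ` F)" for v :: "'i \<Rightarrow> real"
  have p_ge: "v i \<le> p v" if "i \<in> F" for i v
    unfolding p_def using F that by simp
  have p_le: "p v \<le> r" if "\<And>i. i \<in> F \<Longrightarrow> v i \<le> r" for v r
    unfolding p_def using F that by simp
  have p: "sublinear p"
  proof (rule sublinearI)
    show "p (x + y) \<le> p x + p y" for x y
      using p_ge by (intro p_le) (simp add: add_mono)
    show "p (r *\<^sub>R x) \<le> r * p x" if "0 < r" for r x
      using p_ge that by (intro p_le) simp
    show "p 0 = 0"
      unfolding p_def using F by (simp add: image_constant_conv)
  qed
  define D where "D = (\<lambda>w. (- w, - c)) ` W"
  have "convex D"
  proof (rule convexI)
    fix x y and u v :: real
    assume *: "x \<in> D" "y \<in> D" "0 \<le> u" "0 \<le> v" "u + v = 1"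
    then obtain w w' where w: "w \<in> W" "x = (- w, - c)" "w' \<in> W" "y = (- w', - c)"
      unfolding D_def by blast
    have "u *\<^sub>R w + v *\<^sub>R w' \<in> W"
      using W(1) w * by (intro convexD) auto
    moreover have "u *\<^sub>R x + v *\<^sub>R y = (- (u *\<^sub>R w + v *\<^sub>R w'), - ((u + v) * c))"
      unfolding w(2,4) by (simp add: algebra_simps)
    ultimately show "u *\<^sub>R x + v *\<^sub>R y \<in> D"
      unfolding D_def using *(5) by (intro image_eqI[of _ _ "u *\<^sub>R w + v *\<^sub>R w'"]) simp_all
  qed
  moreover have "r \<le> p w" if wr: "(w, r) \<in> D" for w r
  proof -
    obtain w' where w': "w' \<in> W" "w = - w'" "r = - c"
      using wr unfolding D_def by blast
    then obtain i where "i \<in> F" "w' i \<le> c"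
      using no by blast
    then show ?thesis
      using p_ge[of i w] w' by simp
  qed
  moreover have "D \<noteq> {}"
    using W(2) by (simp add: D_def)
  ultimately obtain f where f: "linear f" "\<And>x. f x \<le> p x" "\<And>w r. (w, r) \<in> D \<Longrightarrow> r \<le> f w"
    using Mazur_Orlicz[OF p, of D] by blast
  define b where "b i = (\<lambda>k. if k = i then 1 else 0 :: real)" for i :: 'i
  \<comment> \<open>Both \<open>v\<close> and \<open>- v\<close> have maximum 0 over
    \<open>F\<close>, so \<open>f\<close> sees only the coordinates in \<open>F\<close>.\<close>
  have null: "f v = 0" if "\<And>i. i \<in> F \<Longrightarrow> v i = 0" for v
  proof -
    have "f v \<le> 0" "f (- v) \<le> 0"
      using f(2)[of v] f(2)[of "- v"] p_le[of v 0] p_le[of "- v" 0] that by force+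
    then show ?thesis
      using linear_neg[OF f(1)] by simp
  qed
  have f_eq: "f v = (\<Sum>i\<in>F. f (b i) * v i)" for v
  proof -
    have "f (v - (\<Sum>i\<in>F. v i *\<^sub>R b i)) = 0"
      by (rule null) (use F(1) in \<open>simp add: b_def if_distrib cong: if_cong\<close>)
    then have "f v = f (\<Sum>i\<in>F. v i *\<^sub>R b i)"
      using linear_diff[OF f(1)] by simp
    also have "\<dots> = (\<Sum>i\<in>F. f (b i) * v i)"
      using linear_sum[OF f(1), of "\<lambda>i. v i *\<^sub>R b i" F] linear_scale[OF f(1)] by (simp add: mult.commute)
    finally show ?thesis .
  qed
  show thesis
  proof (rule that[of "\<lambda>i. f (b i)"])
    fix i assume "i \<in> F"
    have "f (- b i) \<le> 0"
      using f(2)[of "- b i"] p_le[of "- b i" 0] by (force simp: b_def)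
    then show "0 \<le> f (b i)"
      using linear_neg[OF f(1)] by simp
  next
    \<comment> \<open>The constants 1 and -1 have maxima 1 and -1, which pins the total weight from
      both sides.\<close>
    have "f (\<lambda>_. 1) \<le> 1" "f (- (\<lambda>_. 1)) \<le> - 1"
      using f(2)[of "\<lambda>_. 1"] f(2)[of "- (\<lambda>_. 1)"] p_le[of "\<lambda>_. 1" 1] p_le[of "- (\<lambda>_. 1)" "-1"] by force+
    then have "f (\<lambda>_. 1) = 1"
      using linear_neg[OF f(1)] by simp
    then show "(\<Sum>i\<in>F. f (b i)) = 1"
      using f_eq[of "\<lambda>_. 1"] by simp
  next
    fix w assume "w \<in> W"
    then have "- c \<le> f (- w)"
      using f(3)[of "- w" "- c"] unfolding D_def by blast
    then show "(\<Sum>i\<in>F. f (b i) * w i) \<le> c"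
      using linear_neg[OF f(1)] f_eq[of w] by simp
  qed
qed

section \<open>Locally convex spaces\<close>

text \<open>Evaluations separating \<open>\<phi>\<close> from a finite subset of X have the finite
  intersection property, so Tychonoff gives a common cluster point. Affinity and the separation
  involve only finitely many points at a time and hence survive the limit.\<close>

lemma affine_cluster_point:
  fixes M X :: "('a \<Rightarrow> real) set"
  assumes R: "\<And>y b. y \<in> M \<Longrightarrow> b \<in> B \<Longrightarrow> \<bar>y b\<bar> \<le> R" and M: "convex M" "\<phi> \<in> M" "X \<subseteq> M"
    and sep: "\<And>F. finite F \<Longrightarrow> F \<subseteq> X \<Longrightarrow> \<exists>g\<in>B. \<forall>\<psi>\<in>F. \<phi> g + d \<le> \<psi> g"
  obtains h where "\<And>S r. finite S \<Longrightarrow> S \<subseteq> M \<Longrightarrow> r > 0 \<Longrightarrow> \<exists>b\<in>B. \<forall>y\<in>S. \<bar>y b - h y\<bar> < r"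
    "\<And>x y u. x \<in> M \<Longrightarrow> y \<in> M \<Longrightarrow> 0 \<le> u \<Longrightarrow> u \<le> 1 \<Longrightarrow>
       h (u *\<^sub>R x + (1 - u) *\<^sub>R y) = u * h x + (1 - u) * h y"
    "\<And>e. e \<in> X \<Longrightarrow> h \<phi> + d \<le> h e"
proof -
  \<comment> \<open>The value 0 off \<open>M\<close> keeps all evaluations in a single compact
    cube.\<close>
  define ev where "ev g = (\<lambda>y. if y \<in> M then y g else 0)" for g
  define C where "C F = {g\<in>B. \<forall>\<psi>\<in>F. \<phi> g + d \<le> \<psi> g}" for F
  define box where "box = {H::('a \<Rightarrow> real) \<Rightarrow> real. \<forall>y. \<bar>H y\<bar> \<le> \<bar>R\<bar>}"
  have "compact box"
    unfolding box_def by (rule compact_fun_cbox)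
  moreover have "\<forall>a\<in>{closure (ev ` C F) |F. finite F \<and> F \<subseteq> X}. closed a"
    by auto
  moreover have "box \<inter> \<Inter>\<A> \<noteq> {}"
    if \<A>: "\<A> \<subseteq> {closure (ev ` C F) |F. finite F \<and> F \<subseteq> X}" "finite \<A>" for \<A>
  proof -
    have "\<forall>a\<in>\<A>. \<exists>F. a = closure (ev ` C F) \<and> finite F \<and> F \<subseteq> X"
      using \<A>(1) by blast
    then obtain f where f: "\<forall>a\<in>\<A>. a = closure (ev ` C (f a)) \<and> finite (f a) \<and> f a \<subseteq> X"
      by (rule bchoice[THEN exE])
    \<comment> \<open>One evaluation separating the union of the finitely many sets belongs to all
      the closures.\<close>
    have "finite (\<Union>(f ` \<A>))" "\<Union>(f ` \<A>) \<subseteq> X"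
      using f \<A>(2) by auto
    then obtain g where g: "g \<in> B" "\<forall>\<psi>\<in>\<Union>(f ` \<A>). \<phi> g + d \<le> \<psi> g"
      using sep by blast
    have "ev g \<in> box"
      unfolding box_def ev_def using R[OF _ g(1)] by (auto intro: order_trans[OF _ abs_ge_self])
    moreover have "ev g \<in> a" if "a \<in> \<A>" for a
    proof -
      have "g \<in> C (f a)"
        using g that unfolding C_def by blast
      then show ?thesis
        using f[rule_format, OF that] closure_subset[of "ev ` C (f a)"] by auto
    qed
    ultimately show ?thesis by blast
  qed
  ultimately have "box \<inter> \<Inter>{closure (ev ` C F) |F. finite F \<and> F \<subseteq> X} \<noteq> {}"
    unfolding compact_fip by blast
  then obtain h where "h \<in> \<Inter>{closure (ev ` C F) |F. finite F \<and> F \<subseteq> X}"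
    by blast
  then have hF: "h \<in> closure (ev ` C F)" if "finite F" "F \<subseteq> X" for F
    using that by blast
  have approx: "\<exists>g\<in>C F. \<forall>y\<in>S. \<bar>y g - h y\<bar> < r" if "finite F" "F \<subseteq> X" "finite S" "S \<subseteq> M" "r > 0" for F S r
  proof -
    have "\<exists>y\<in>ev ` C F. y \<in> fun_box h S r"
      using hF[OF that(1,2)] that(3,5) unfolding in_closure_fun_iff by blast
    then show ?thesis
      using that(4) unfolding fun_box_def ev_def by (force simp: subset_eq)
  qed
  show thesis
  proof (rule that[of h])
    show "\<exists>b\<in>B. \<forall>y\<in>S. \<bar>y b - h y\<bar> < r" if "finite S" "S \<subseteq> M" "r > 0" for S r
      using approx[of "{}" S r] that by (auto simp: C_def)
  next
    fix x y and u :: real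
    assume *: "x \<in> M" "y \<in> M" "0 \<le> u" "u \<le> 1"
    define z where "z = u *\<^sub>R x + (1 - u) *\<^sub>R y"
    have "z \<in> M"
      unfolding z_def using * M(1) by (intro convexD) auto
    have "\<bar>h z - (u * h x + (1 - u) * h y)\<bar> \<le> 0 + r" if "r > 0" for r
    proof -
      obtain g where "\<forall>w\<in>{x, y, z}. \<bar>w g - h w\<bar> < r / 2"
        using approx[of "{}" "{x, y, z}" "r / 2"] \<open>r > 0\<close> * \<open>z \<in> M\<close> by auto
      then have g: "\<bar>x g - h x\<bar> \<le> r / 2" "\<bar>y g - h y\<bar> \<le> r / 2" "\<bar>z g - h z\<bar> \<le> r / 2"
        by auto
      have "u * \<bar>x g - h x\<bar> + (1 - u) * \<bar>y g - h y\<bar> \<le> r / 2"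
        using g(1,2) * by (intro convex_bound_le) auto
      moreover have "\<bar>u * (x g - h x) + (1 - u) * (y g - h y)\<bar> \<le> u * \<bar>x g - h x\<bar> + (1 - u) * \<bar>y g - h y\<bar>"
        using * abs_triangle_ineq[of "u * (x g - h x)" "(1 - u) * (y g - h y)"] by (simp add: abs_mult)
      moreover have "h z - (u * h x + (1 - u) * h y) = u * (x g - h x) + (1 - u) * (y g - h y) - (z g - h z)"
        by (simp add: z_def algebra_simps)
      ultimately show ?thesis
        using g(3) by linarith
    qed
    then have "\<bar>h z - (u * h x + (1 - u) * h y)\<bar> \<le> 0"
      by (rule field_le_epsilon)
    then show "h (u *\<^sub>R x + (1 - u) *\<^sub>R y) = u * h x + (1 - u) * h y"
      by (simp add: z_def)
  next
    fix e assume e: "e \<in> X"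
    show "h \<phi> + d \<le> h e"
    proof (rule field_le_epsilon)
      fix r :: real assume "r > 0"
      then obtain g where g: "g \<in> C {e}" "\<forall>w\<in>{\<phi>, e}. \<bar>w g - h w\<bar> < r / 2"
        using approx[of "{e}" "{\<phi>, e}" "r / 2"] e M by auto
      then have "\<phi> g + d \<le> e g" "\<bar>\<phi> g - h \<phi>\<bar> < r / 2" "\<bar>e g - h e\<bar> < r / 2"
        by (auto simp: C_def)
      then show "h \<phi> + d \<le> h e + r"
        unfolding abs_less_iff by linarith
    qed
  qed
qed

section \<open>Seminorms and their polars\<close>

lemma seminorm_props:
  assumes "seminorm p"
  shows "p (x + y) \<le> p x + p y" "p (c *\<^sub>R x) = \<bar>c\<bar> * p x" "p 0 = 0" "p (- x) = p x" "0 \<le> p x"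
    "\<bar>p x - p y\<bar> \<le> p (x - y)"
proof -
  have add: "p (x + y) \<le> p x + p y" and scale: "p (c *\<^sub>R x) = \<bar>c\<bar> * p x" for x y c
    using assms by (auto simp: seminorm_def)
  show "p (x + y) \<le> p x + p y" "p (c *\<^sub>R x) = \<bar>c\<bar> * p x"
    by (rule add, rule scale)
  show p0: "p 0 = 0"
    using scale[of 0 0] by simp
  have minus: "p (- x) = p x" for x
    using scale[of "-1" x] by simp
  then show "p (- x) = p x" .
  show "0 \<le> p x"
    using add[of x "- x"] by (simp add: p0 minus)
  have "p (y - x) = p (x - y)"
    using minus[of "x - y"] by simp
  then show "\<bar>p x - p y\<bar> \<le> p (x - y)"
    using add[of "x - y" y] add[of "y - x" x] by simp
qed

lemma seminorm_sublinear: "seminorm p \<Longrightarrow> sublinear p"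
  by (auto simp: seminorm_def sublinear_def)

text \<open>For a seminorm this is the polar of its unit ball; the one-sided bound becomes two-sided
  by symmetry and fits the sublinear setting.\<close>

definition polar_set :: "('a::real_vector \<Rightarrow> real) \<Rightarrow> ('a \<Rightarrow> real) set" where
  "polar_set \<rho> = {\<phi>. linear \<phi> \<and> (\<forall>x. \<phi> x \<le> \<rho> x)}"

lemma polar_set_abs:
  assumes "seminorm \<rho>" "\<phi> \<in> polar_set \<rho>"
  shows "\<bar>\<phi> x\<bar> \<le> \<rho> x"
proof -
  have "linear \<phi>" "\<phi> x \<le> \<rho> x" "\<phi> (- x) \<le> \<rho> (- x)"
    using assms(2) by (auto simp: polar_set_def)
  then show ?thesis
    using seminorm_props(4)[OF assms(1)] linear_neg[of \<phi> x] by simp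
qed

lemma closed_linear_functionals: "closed {\<phi>::'a::real_vector \<Rightarrow> real. linear \<phi>}"
proof -
  have "{\<phi>::'a \<Rightarrow> real. linear \<phi>} =
      {\<phi>. (\<forall>x y. \<phi> (x + y) = \<phi> x + \<phi> y) \<and> (\<forall>c x. \<phi> (c *\<^sub>R x) = c * \<phi> x)}"
    by (auto simp: linear_iff)
  also have "closed \<dots>"
    by (intro closed_Collect_conj closed_Collect_all closed_Collect_eq continuous_on_add
        continuous_on_mult continuous_on_const continuous_on_product_coordinates)
  finally show ?thesis .
qed

lemma closed_polar_set: "closed (polar_set \<rho>)"
proof -
  have "closed {\<phi>. \<forall>x. \<phi> x \<le> \<rho> x}"
    by (intro closed_Collect_all closed_coordinate_le)
  then show ?thesis
    unfolding polar_set_def Collect_conj_eq by (rule closed_Int[OF closed_linear_functionals])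
qed

lemma convex_polar_set: "convex (polar_set \<rho>)"
proof (rule convexI)
  fix x y and u v :: real
  assume *: "x \<in> polar_set \<rho>" "y \<in> polar_set \<rho>" "0 \<le> u" "0 \<le> v" "u + v = 1"
  have "linear (\<lambda>z. u *\<^sub>R x z + v *\<^sub>R y z)"
    using * by (intro linear_compose_add linear_compose_scale_right) (auto simp: polar_set_def)
  moreover have "u * x z + v * y z \<le> \<rho> z" for z
    using * by (intro convex_bound_le) (auto simp: polar_set_def)
  ultimately show "u *\<^sub>R x + v *\<^sub>R y \<in> polar_set \<rho>"
    by (simp add: polar_set_def plus_fun_def scaleR_fun_def)
qed

text \<open>Banach-Alaoglu: a pointwise closed subset of a product of intervals.\<close>

lemma compact_polar_set: "seminorm \<rho> \<Longrightarrow> compact (polar_set \<rho>)"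
  using compact_Int_closed[OF compact_fun_cbox closed_polar_set[of \<rho>], of \<rho>]
  by (simp add: Int_absorb1 polar_set_abs subset_eq)

section \<open>The topology of a family of seminorms and its bounded sets\<close>

locale seminorm_family =
  fixes P :: "('a::real_vector \<Rightarrow> real) set"
  assumes seminorms: "p \<in> P \<Longrightarrow> seminorm p"
begin

abbreviation T :: "'a topology" where "T \<equiv> seminorm_topology P"

lemma openin_T: "openin T U \<longleftrightarrow> (\<forall>x\<in>U. \<exists>F. finite F \<and> F \<subseteq> P \<and> (\<exists>e>0. {y. \<forall>p\<in>F. p (y - x) < e} \<subseteq> U))"
proof -
  have "istopology (\<lambda>U. \<forall>x\<in>U. \<exists>F. finite F \<and> F \<subseteq> P \<and> (\<exists>e>0. {y. \<forall>p\<in>F. p (y - x) < e} \<subseteq> U))"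
    unfolding istopology_def
  proof (intro conjI allI impI ballI)
    fix U V x
    assume U: "\<forall>x\<in>U. \<exists>F. finite F \<and> F \<subseteq> P \<and> (\<exists>e>0. {y. \<forall>p\<in>F. p (y - x) < e} \<subseteq> U)"
      and V: "\<forall>x\<in>V. \<exists>F. finite F \<and> F \<subseteq> P \<and> (\<exists>e>0. {y. \<forall>p\<in>F. p (y - x) < e} \<subseteq> V)"
      and x: "x \<in> U \<inter> V"
    obtain F e where F: "finite F" "F \<subseteq> P" "e > 0" "{y. \<forall>p\<in>F. p (y - x) < e} \<subseteq> U"
      using U x by (meson IntD1)
    obtain F' e' where F': "finite F'" "F' \<subseteq> P" "e' > 0" "{y. \<forall>p\<in>F'. p (y - x) < e'} \<subseteq> V"
      using V x by (meson IntD2)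
    have "{y. \<forall>p\<in>F \<union> F'. p (y - x) < min e e'} \<subseteq> U \<inter> V"
      using F(4) F'(4) by auto
    then show "\<exists>F. finite F \<and> F \<subseteq> P \<and> (\<exists>e>0. {y. \<forall>p\<in>F. p (y - x) < e} \<subseteq> U \<inter> V)"
      using F F' by (intro exI[of _ "F \<union> F'"] conjI exI[of _ "min e e'"]) auto
  next
    fix \<K> x
    assume "\<forall>U\<in>\<K>. \<forall>x\<in>U. \<exists>F. finite F \<and> F \<subseteq> P \<and> (\<exists>e>0. {y. \<forall>p\<in>F. p (y - x) < e} \<subseteq> U)" "x \<in> \<Union>\<K>"
    then show "\<exists>F. finite F \<and> F \<subseteq> P \<and> (\<exists>e>0. {y. \<forall>p\<in>F. p (y - x) < e} \<subseteq> \<Union>\<K>)"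
      by (meson Sup_upper UnionE order_trans)
  qed
  then show ?thesis
    by (simp add: seminorm_topology_def topology_inverse')
qed

lemma topspace_T: "topspace T = UNIV"
proof -
  have "openin T UNIV"
    unfolding openin_T by (intro ballI exI[of _ "{}"]) (auto intro: exI[of _ "1::real"])
  then show ?thesis
    using openin_subset by blast
qed

text \<open>Only an open set on which \<open>\<rho>\<close> is bounded is assumed, not continuity of
  \<open>\<rho>\<close>. The case \<open>f = \<rho>\<close> therefore proves that a seminorm is
  continuous.\<close>

lemma continuous_map_dominated:
  assumes \<rho>: "seminorm \<rho>" and U: "openin T U" "0 \<in> U" "\<And>y. y \<in> U \<Longrightarrow> \<rho> y \<le> 1"
    and f: "\<And>x y. \<bar>f y - f x\<bar> \<le> \<rho> (y - x)"
  shows "continuous_map T euclideanreal f"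
  unfolding continuous_map topspace_T
proof (intro conjI allI impI)
  fix V :: "real set" assume "openin euclidean V"
  then have V: "open V" by simp
  obtain F e where F: "finite F" "F \<subseteq> P" "e > 0" "{y. \<forall>p\<in>F. p (y - 0) < e} \<subseteq> U"
    using U(1,2) unfolding openin_T by meson
  have "\<exists>F. finite F \<and> F \<subseteq> P \<and> (\<exists>e>0. {y. \<forall>p\<in>F. p (y - x) < e} \<subseteq> {x. f x \<in> V})" if x: "f x \<in> V" for x
  proof -
    obtain r where r: "r > 0" "\<And>t. \<bar>t - f x\<bar> < r \<Longrightarrow> t \<in> V"
      using V x unfolding open_dist dist_real_def by blast
    \<comment> \<open>Scaling \<open>y - x\<close> by \<open>2 / r\<close> moves it into
      \<open>U\<close>, so \<open>\<rho> (y - x)\<close> is at most \<open>r / 2\<close>.\<close>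
    have "f y \<in> V" if y: "\<forall>p\<in>F. p (y - x) < e * (r / 2)" for y
    proof -
      have "p ((2 / r) *\<^sub>R (y - x)) < e" if "p \<in> F" for p
      proof -
        have eq: "p ((2 / r) *\<^sub>R (y - x)) = (2 / r) * p (y - x)"
          using seminorm_props(2)[OF seminorms, of p] that F(2) r(1) by auto
        show ?thesis
          unfolding eq using y[rule_format, OF that] r(1) by (simp add: field_simps)
      qed
      then have "\<rho> ((2 / r) *\<^sub>R (y - x)) \<le> 1"
        using F(4) by (intro U(3)) auto
      then have "\<rho> (y - x) \<le> r / 2"
        unfolding seminorm_props(2)[OF \<rho>] using r(1) by (simp add: field_simps)
      then show ?thesis
        using f[of y x] r by (intro r(2)) linarith
    qed
    then show ?thesis
      using F r(1) by (intro exI[of _ F] conjI exI[of _ "e * (r / 2)"]) auto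
  qed
  then show "openin T {x \<in> UNIV. f x \<in> V}"
    unfolding openin_T by simp
qed simp

lemma open_seminorm_ball:
  assumes "continuous_seminorm T \<rho>"
  shows "openin T {y. \<rho> y < e}"
  using assms openin_continuous_map_preimage[of T euclideanreal \<rho> "{..<e}"]
  by (simp add: continuous_seminorm_def topspace_T)

lemma continuous_seminorm_P:
  assumes "p \<in> P"
  shows "continuous_seminorm T p"
proof -
  have "openin T {y. p y < 1}"
    unfolding openin_T
  proof (intro ballI exI[of _ "{p}"] conjI)
    fix x assume x: "x \<in> {y. p y < 1}"
    have "p y < 1" if "p (y - x) < 1 - p x" for y
      using seminorm_props(6)[OF seminorms[OF assms], of y x] that by linarith
    then show "\<exists>e>0. {y. \<forall>p\<in>{p}. p (y - x) < e} \<subseteq> {y. p y < 1}"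
      using x by (intro exI[of _ "1 - p x"]) auto
  qed (use assms in auto)
  then show ?thesis
    unfolding continuous_seminorm_def
    using seminorms[OF assms] seminorm_props(3,6)[OF seminorms[OF assms]]
    by (auto intro!: continuous_map_dominated[of p "{y. p y < 1}"])
qed

lemma tvs_bounded_seminorm:
  assumes "tvs_bounded T B" "continuous_seminorm T \<rho>"
  obtains c where "\<And>b. b \<in> B \<Longrightarrow> \<rho> b \<le> c"
proof -
  have \<rho>: "seminorm \<rho>"
    using assms(2) by (simp add: continuous_seminorm_def)
  have "openin T {y. \<rho> y < 1}" "0 \<in> {y. \<rho> y < 1}"
    using open_seminorm_ball[OF assms(2)] seminorm_props(3)[OF \<rho>] by auto
  then obtain s where s: "s > 0" "\<And>t. s < t \<Longrightarrow> B \<subseteq> (\<lambda>x. t *\<^sub>R x) ` {y. \<rho> y < 1}"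
    using assms(1) unfolding tvs_bounded_def by blast
  have "\<rho> b \<le> s + 1" if "b \<in> B" for b
  proof -
    obtain y where "b = (s + 1) *\<^sub>R y" "\<rho> y < 1"
      using s(2)[of "s + 1"] \<open>b \<in> B\<close> by auto
    then show ?thesis
      using seminorm_props(2)[OF \<rho>] s(1) by simp
  qed
  then show thesis using that by blast
qed

lemma tvs_boundedI:
  assumes "\<And>p. p \<in> P \<Longrightarrow> \<exists>c. \<forall>b\<in>B. p b \<le> c"
  shows "tvs_bounded T B"
  unfolding tvs_bounded_def
proof (intro allI impI)
  fix U assume "openin T U \<and> 0 \<in> U"
  then obtain F e where F: "finite F" "F \<subseteq> P" "e > 0" "{y. \<forall>p\<in>F. p (y - 0) < e} \<subseteq> U"
    unfolding openin_T by meson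
  obtain c where c: "\<And>p b. p \<in> F \<Longrightarrow> b \<in> B \<Longrightarrow> p b \<le> c p"
    using assms F(2) by (metis subsetD)
  \<comment> \<open>The inserted 1 covers an empty \<open>F\<close> and makes \<open>s\<close>
    positive; the final 1 makes \<open>c p < s * e\<close> strict.\<close>
  define s where "s = Max (insert 1 (c ` F)) / e + 1"
  have s: "0 < s" "\<And>p. p \<in> F \<Longrightarrow> c p < s * e"
  proof -
    have "1 \<le> Max (insert 1 (c ` F))"
      using F(1) by simp
    then show "0 < s"
      using F(3) by (simp add: s_def add_pos_pos)
    fix p assume "p \<in> F"
    then have "c p \<le> Max (insert 1 (c ` F))"
      using F(1) by simp
    moreover have "s * e = Max (insert 1 (c ` F)) + e"
      using F(3) by (simp add: s_def distrib_right)
    ultimately show "c p < s * e"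
      using F(3) by linarith
  qed
  have "B \<subseteq> (\<lambda>x. t *\<^sub>R x) ` U" if t: "s < t" for t
  proof
    fix b assume b: "b \<in> B"
    have "p ((1 / t) *\<^sub>R b) < e" if "p \<in> F" for p
    proof -
      have "p b < s * e"
        using c[OF that b] s(2)[OF that] by linarith
      also have "\<dots> < t * e"
        using t F(3) by simp
      finally show ?thesis
        using seminorm_props(2)[OF seminorms, of p] that F(2) s(1) t by (auto simp: field_simps)
    qed
    then have "(1 / t) *\<^sub>R b \<in> U"
      using F(4) by auto
    then show "b \<in> (\<lambda>x. t *\<^sub>R x) ` U"
      using s(1) t by (intro image_eqI[of _ _ "(1 / t) *\<^sub>R b"]) auto
  qed
  then show "\<exists>s>0. \<forall>t. s < t \<longrightarrow> B \<subseteq> (\<lambda>x. t *\<^sub>R x) ` U"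
    using s(1) by blast
qed

lemma tvs_bounded_finite: "finite B \<Longrightarrow> tvs_bounded T B"
  by (rule tvs_boundedI) (metis Max_ge finite_imageI image_eqI)

lemma tvs_bounded_Un:
  assumes "tvs_bounded T A" "tvs_bounded T B"
  shows "tvs_bounded T (A \<union> B)"
proof (rule tvs_boundedI)
  fix p assume "p \<in> P"
  then obtain c d where "\<And>b. b \<in> A \<Longrightarrow> p b \<le> c" "\<And>b. b \<in> B \<Longrightarrow> p b \<le> d"
    using tvs_bounded_seminorm[OF assms(1) continuous_seminorm_P]
      tvs_bounded_seminorm[OF assms(2) continuous_seminorm_P] by metis
  then show "\<exists>c. \<forall>b\<in>A \<union> B. p b \<le> c"
    by (intro exI[of _ "max c d"]) fastforce
qed

text \<open>Sublevel sets of a seminorm are convex and symmetric, so every bound on B passes to the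
  hull.\<close>

lemma tvs_bounded_absolute_hull:
  assumes "tvs_bounded T B"
  shows "tvs_bounded T (convex hull (B \<union> uminus ` B))"
proof (rule tvs_boundedI)
  fix p assume p: "p \<in> P"
  note sn = seminorm_props[OF seminorms[OF p]]
  obtain c where c: "\<And>b. b \<in> B \<Longrightarrow> p b \<le> c"
    using tvs_bounded_seminorm[OF assms continuous_seminorm_P[OF p]] by blast
  have "convex {x. p x \<le> c}"
  proof (rule convexI, clarsimp)
    fix x y and u v :: real
    assume *: "p x \<le> c" "p y \<le> c" "0 \<le> u" "0 \<le> v" "u + v = 1"
    have "p (u *\<^sub>R x + v *\<^sub>R y) \<le> u * p x + v * p y"
      using sn(1)[of "u *\<^sub>R x" "v *\<^sub>R y"] sn(2) * by simp
    also have "\<dots> \<le> c"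
      using * by (intro convex_bound_le) auto
    finally show "p (u *\<^sub>R x + v *\<^sub>R y) \<le> c" .
  qed
  then have "convex hull (B \<union> uminus ` B) \<subseteq> {x. p x \<le> c}"
    using c sn(4) by (intro hull_minimal) auto
  then show "\<exists>c. \<forall>b\<in>convex hull (B \<union> uminus ` B). p b \<le> c"
    by blast
qed

section \<open>Equicontinuous compact sets and closures in the dual\<close>

lemma eqc_iff: "K \<in> eqc T \<longleftrightarrow> K \<subseteq> dual T \<and> equicontinuous_set T K \<and> compact K"
  by (auto simp: eqc_def weak_star_def compactin_subtopology)

lemma closed_subset_polar_eqc:
  assumes \<rho>: "continuous_seminorm T \<rho>" and S: "S \<subseteq> polar_set \<rho>" "closed S"
  shows "S \<in> eqc T"
  unfolding eqc_iff
proof (intro conjI)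
  have sn: "seminorm \<rho>"
    using \<rho> by (simp add: continuous_seminorm_def)
  show "compact S"
    using compact_Int_closed[OF compact_polar_set[OF sn] S(2)] S(1) by (simp add: Int_absorb1)
  show "S \<subseteq> dual T"
  proof
    fix \<phi> assume "\<phi> \<in> S"
    then have \<phi>: "linear \<phi>" "\<And>x. \<bar>\<phi> x\<bar> \<le> \<rho> x"
      using S(1) polar_set_abs[OF sn] by (auto simp: polar_set_def)
    have "continuous_map T euclideanreal \<phi>"
    proof (rule continuous_map_dominated[OF sn open_seminorm_ball[OF \<rho>, of 1]])
      show "\<bar>\<phi> y - \<phi> x\<bar> \<le> \<rho> (y - x)" for x y
        using \<phi>(2)[of "y - x"] linear_diff[OF \<phi>(1)] by simp
    qed (use seminorm_props(3)[OF sn] in auto)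
    then show "\<phi> \<in> dual T"
      using \<phi>(1) by (simp add: dual_def)
  qed
  show "equicontinuous_set T S"
    unfolding equicontinuous_set_def
  proof (intro allI impI)
    fix e :: real assume "0 < e"
    then show "\<exists>U. openin T U \<and> 0 \<in> U \<and> (\<forall>\<phi>\<in>S. \<forall>x\<in>U. \<bar>\<phi> x\<bar> < e)"
      using open_seminorm_ball[OF \<rho>, of e] seminorm_props(3)[OF sn] S(1) polar_set_abs[OF sn]
      by (intro exI[of _ "{y. \<rho> y < e}"]) (auto intro: le_less_trans)
  qed
qed

text \<open>The seminorm is the supremum of \<open>\<bar>\<phi> x\<bar>\<close> over K: finite by
  compactness, continuous by equicontinuity.\<close>

lemma eqc_subset_polar:
  assumes "K \<in> eqc T"
  obtains \<rho> where "continuous_seminorm T \<rho>" "K \<subseteq> polar_set \<rho>"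
proof -
  have K: "K \<subseteq> dual T" "equicontinuous_set T K" "compact K"
    using assms by (auto simp: eqc_iff)
  have lin: "linear \<phi>" if "\<phi> \<in> K" for \<phi>
    using K(1) that by (auto simp: dual_def)
  \<comment> \<open>Inserting 0 keeps the supremum meaningful and nonnegative when \<open>K\<close>
    is empty.\<close>
  define \<rho> where "\<rho> x = (SUP \<phi>\<in>insert 0 K. \<bar>\<phi> x\<bar>)" for x
  have bdd: "bdd_above ((\<lambda>\<phi>. \<bar>\<phi> x\<bar>) ` insert 0 K)" for x
  proof -
    have "compact ((\<lambda>\<phi>. \<bar>\<phi> x\<bar>) ` K)"
      using K(3) by (intro compact_continuous_image continuous_on_rabs continuous_on_coordinate continuous_on_id)
    then have "bdd_above ((\<lambda>\<phi>. \<bar>\<phi> x\<bar>) ` K)"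
      by (simp add: bounded_imp_bdd_above compact_imp_bounded)
    then show ?thesis by simp
  qed
  have le: "\<bar>\<phi> x\<bar> \<le> \<rho> x" if "\<phi> \<in> K" for \<phi> x
    unfolding \<rho>_def using that by (intro cSUP_upper bdd) auto
  have ge0: "0 \<le> \<rho> x" for x
    unfolding \<rho>_def using cSUP_upper[OF _ bdd, of 0] by force
  have least: "\<rho> x \<le> c" if "\<And>\<phi>. \<phi> \<in> K \<Longrightarrow> \<bar>\<phi> x\<bar> \<le> c" "0 \<le> c" for x c
    unfolding \<rho>_def using that by (intro cSUP_least) auto
  have sn: "seminorm \<rho>"
    unfolding seminorm_def
  proof (intro conjI allI)
    fix x y
    show "\<rho> (x + y) \<le> \<rho> x + \<rho> y"
    proof (rule least)
      fix \<phi> assume \<phi>: "\<phi> \<in> K"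
      show "\<bar>\<phi> (x + y)\<bar> \<le> \<rho> x + \<rho> y"
        using le[OF \<phi>, of x] le[OF \<phi>, of y] linear_add[OF lin[OF \<phi>], of x y] by linarith
    qed (simp add: ge0)
  next
    fix c x
    have le': "\<rho> (c *\<^sub>R x) \<le> \<bar>c\<bar> * \<rho> x" for c x
    proof (rule least)
      fix \<phi> assume \<phi>: "\<phi> \<in> K"
      show "\<bar>\<phi> (c *\<^sub>R x)\<bar> \<le> \<bar>c\<bar> * \<rho> x"
        using le[OF \<phi>, of x] linear_scale[OF lin[OF \<phi>], of c x] by (simp add: abs_mult mult_left_mono)
    qed (simp add: ge0)
    show "\<rho> (c *\<^sub>R x) = \<bar>c\<bar> * \<rho> x"
    proof (cases "c = 0")
      case True
      then show ?thesis
        using le'[of 0 x] ge0[of 0] by simp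
    next
      case False
      have "\<rho> ((1 / c) *\<^sub>R (c *\<^sub>R x)) \<le> \<bar>1 / c\<bar> * \<rho> (c *\<^sub>R x)"
        by (rule le')
      then show ?thesis
        using False le'[of c x] by (simp add: field_simps)
    qed
  qed
  obtain U where U: "openin T U" "0 \<in> U" "\<forall>\<phi>\<in>K. \<forall>x\<in>U. \<bar>\<phi> x\<bar> < 1"
    using K(2) unfolding equicontinuous_set_def by (meson zero_less_one)
  have "continuous_map T euclideanreal \<rho>"
  proof (rule continuous_map_dominated[OF sn U(1,2)])
    show "\<rho> y \<le> 1" if "y \<in> U" for y
      using U(3) that by (intro least) (auto intro: less_imp_le)
    show "\<bar>\<rho> y - \<rho> x\<bar> \<le> \<rho> (y - x)" for x y
      by (rule seminorm_props(6)[OF sn])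
  qed
  moreover have "K \<subseteq> polar_set \<rho>"
    using lin le abs_ge_self by (fastforce simp: polar_set_def intro: order_trans)
  ultimately show thesis
    using that sn by (simp add: continuous_seminorm_def)
qed

text \<open>A polar containing K is closed and convex and lies in the dual. The closure in the full
  product therefore never leaves the dual and coincides with the weak-star closure.\<close>

lemma eqc_closure_hull:
  assumes "K \<in> eqc T"
  shows "closure (convex hull K) \<in> eqc T" "weak_star T closure_of (convex hull K) = closure (convex hull K)"
proof -
  obtain \<rho> where \<rho>: "continuous_seminorm T \<rho>" "K \<subseteq> polar_set \<rho>"
    using eqc_subset_polar[OF assms] .
  have hull: "convex hull K \<subseteq> polar_set \<rho>"
    using \<rho>(2) convex_polar_set by (intro hull_minimal) auto
  then have "closure (convex hull K) \<subseteq> polar_set \<rho>"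
    using closed_polar_set by (intro closure_minimal) auto
  then show eqc: "closure (convex hull K) \<in> eqc T"
    using closed_subset_polar_eqc[OF \<rho>(1)] by simp
  then have "closure (convex hull K) \<subseteq> dual T"
    by (simp add: eqc_iff)
  moreover have "convex hull K \<subseteq> dual T"
    using calculation closure_subset by blast
  ultimately show "weak_star T closure_of (convex hull K) = closure (convex hull K)"
    unfolding weak_star_def by (simp add: closure_of_subtopology Int_absorb1)
qed

lemma in_strong_closure_iff:
  assumes S: "S \<subseteq> dual T"
  shows "\<phi> \<in> strong_topology T closure_of S \<longleftrightarrow> \<phi> \<in> dual T \<and>
     (\<forall>B e. tvs_bounded T B \<and> e > 0 \<longrightarrow> (\<exists>\<psi>\<in>S. \<forall>b\<in>B. \<bar>\<psi> b - \<phi> b\<bar> < e))"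
proof -
  define opn where "opn U \<longleftrightarrow> U \<subseteq> dual T \<and> (\<forall>\<phi>\<in>U. \<exists>B e. tvs_bounded T B \<and> e > 0 \<and>
      {\<psi>\<in>dual T. \<forall>b\<in>B. \<bar>\<psi> b - \<phi> b\<bar> < e} \<subseteq> U)" for U
  have "istopology opn"
    unfolding istopology_def
  proof (intro conjI allI impI)
    fix U V assume U: "opn U" and V: "opn V"
    show "opn (U \<inter> V)"
      unfolding opn_def
    proof (intro conjI ballI)
      fix \<phi> assume \<phi>: "\<phi> \<in> U \<inter> V"
      obtain B e where B: "tvs_bounded T B" "e > 0" "{\<psi>\<in>dual T. \<forall>b\<in>B. \<bar>\<psi> b - \<phi> b\<bar> < e} \<subseteq> U"
        using U \<phi> unfolding opn_def by (meson IntD1)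
      obtain B' e' where B': "tvs_bounded T B'" "e' > 0" "{\<psi>\<in>dual T. \<forall>b\<in>B'. \<bar>\<psi> b - \<phi> b\<bar> < e'} \<subseteq> V"
        using V \<phi> unfolding opn_def by (meson IntD2)
      have "{\<psi>\<in>dual T. \<forall>b\<in>B \<union> B'. \<bar>\<psi> b - \<phi> b\<bar> < min e e'} \<subseteq> U \<inter> V"
        using B(3) B'(3) by auto
      then show "\<exists>B e. tvs_bounded T B \<and> e > 0 \<and> {\<psi>\<in>dual T. \<forall>b\<in>B. \<bar>\<psi> b - \<phi> b\<bar> < e} \<subseteq> U \<inter> V"
        using tvs_bounded_Un[OF B(1) B'(1)] B(2) B'(2) by (meson min_less_iff_conj)
    qed (use U in \<open>auto simp: opn_def\<close>)
  next
    fix \<K> assume \<K>: "\<forall>U\<in>\<K>. opn U"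
    show "opn (\<Union>\<K>)"
      unfolding opn_def
    proof (intro conjI ballI)
      fix \<phi> assume "\<phi> \<in> \<Union>\<K>"
      then obtain U where U: "U \<in> \<K>" "\<phi> \<in> U" by blast
      then obtain B e where B: "tvs_bounded T B" "e > 0" "{\<psi>\<in>dual T. \<forall>b\<in>B. \<bar>\<psi> b - \<phi> b\<bar> < e} \<subseteq> U"
        using \<K> unfolding opn_def by meson
      then show "\<exists>B e. tvs_bounded T B \<and> e > 0 \<and> {\<psi>\<in>dual T. \<forall>b\<in>B. \<bar>\<psi> b - \<phi> b\<bar> < e} \<subseteq> \<Union>\<K>"
        using U(1) by blast
    qed (use \<K> in \<open>auto simp: opn_def\<close>)
  qed
  moreover have "strong_topology T = topology opn"
    unfolding strong_topology_def opn_def ..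
  ultimately have openin: "openin (strong_topology T) U \<longleftrightarrow> opn U" for U
    by (simp add: topology_inverse')
  \<comment> \<open>A pointwise strict bound on an infinite \<open>B\<close> can have supremum
    \<open>e\<close>, and then no uniform room is left. Asking for one \<open>r < e\<close> on all
    of \<open>B\<close> gives a set that is really open.\<close>
  have nbhd: "opn {\<psi>\<in>dual T. \<exists>r<e. \<forall>b\<in>B. \<bar>\<psi> b - \<phi> b\<bar> \<le> r}" if B: "tvs_bounded T B" for \<phi> B e
    unfolding opn_def
  proof (intro conjI ballI)
    fix \<psi> assume "\<psi> \<in> {\<psi>\<in>dual T. \<exists>r<e. \<forall>b\<in>B. \<bar>\<psi> b - \<phi> b\<bar> \<le> r}"
    then obtain r where r: "\<psi> \<in> dual T" "r < e" "\<forall>b\<in>B. \<bar>\<psi> b - \<phi> b\<bar> \<le> r" by blast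
    have "\<forall>b\<in>B. \<bar>\<theta> b - \<phi> b\<bar> \<le> (r + e) / 2" if "\<forall>b\<in>B. \<bar>\<theta> b - \<psi> b\<bar> < (e - r) / 2" for \<theta>
    proof
      fix b assume "b \<in> B"
      then have "\<bar>\<theta> b - \<psi> b\<bar> < (e - r) / 2" "\<bar>\<psi> b - \<phi> b\<bar> \<le> r"
        using that r by auto
      then show "\<bar>\<theta> b - \<phi> b\<bar> \<le> (r + e) / 2"
        by (simp add: abs_if field_simps split: if_splits)
    qed
    moreover have "(r + e) / 2 < e" "0 < (e - r) / 2"
      using r(2) by auto
    ultimately have "{\<theta>\<in>dual T. \<forall>b\<in>B. \<bar>\<theta> b - \<psi> b\<bar> < (e - r) / 2} \<subseteq>
        {\<psi>\<in>dual T. \<exists>r<e. \<forall>b\<in>B. \<bar>\<psi> b - \<phi> b\<bar> \<le> r}"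
      by blast
    then show "\<exists>B' e'. tvs_bounded T B' \<and> e' > 0 \<and> {\<theta>\<in>dual T. \<forall>b\<in>B'. \<bar>\<theta> b - \<psi> b\<bar> < e'} \<subseteq>
        {\<psi>\<in>dual T. \<exists>r<e. \<forall>b\<in>B. \<bar>\<psi> b - \<phi> b\<bar> \<le> r}"
      using B \<open>0 < (e - r) / 2\<close> by blast
  qed auto
  have "opn (dual T)"
    unfolding opn_def using tvs_bounded_finite[of "{}"] by (auto intro!: exI[of _ "{}"] exI[of _ "1::real"])
  then have top: "topspace (strong_topology T) = dual T"
    unfolding topspace_def openin by (auto simp: opn_def)
  show ?thesis
  proof
    assume \<phi>: "\<phi> \<in> strong_topology T closure_of S"
    then have "\<phi> \<in> dual T"
      using top by (auto simp: in_closure_of)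
    moreover have "\<exists>\<psi>\<in>S. \<forall>b\<in>B. \<bar>\<psi> b - \<phi> b\<bar> < e" if B: "tvs_bounded T B" "e > 0" for B e
    proof -
      define N where "N = {\<psi>\<in>dual T. \<exists>r<e. \<forall>b\<in>B. \<bar>\<psi> b - \<phi> b\<bar> \<le> r}"
      have "\<phi> \<in> N"
        unfolding N_def using \<open>\<phi> \<in> dual T\<close> B(2) by (intro CollectI conjI exI[of _ 0]) simp_all
      moreover have "openin (strong_topology T) N"
        unfolding openin N_def by (rule nbhd[OF B(1)])
      ultimately obtain \<psi> where "\<psi> \<in> S" "\<psi> \<in> N"
        using \<phi> unfolding in_closure_of by blast
      then obtain r where "\<psi> \<in> S" "r < e" "\<forall>b\<in>B. \<bar>\<psi> b - \<phi> b\<bar> \<le> r"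
        unfolding N_def by blast
      then show ?thesis
        by (intro bexI[of _ \<psi>] ballI) (auto intro: le_less_trans)
    qed
    ultimately show "\<phi> \<in> dual T \<and> (\<forall>B e. tvs_bounded T B \<and> e > 0 \<longrightarrow> (\<exists>\<psi>\<in>S. \<forall>b\<in>B. \<bar>\<psi> b - \<phi> b\<bar> < e))"
      by blast
  next
    assume \<phi>: "\<phi> \<in> dual T \<and> (\<forall>B e. tvs_bounded T B \<and> e > 0 \<longrightarrow> (\<exists>\<psi>\<in>S. \<forall>b\<in>B. \<bar>\<psi> b - \<phi> b\<bar> < e))"
    have "\<exists>y. y \<in> S \<and> y \<in> U" if U: "\<phi> \<in> U" "opn U" for U
    proof -
      obtain B e where "tvs_bounded T B" "e > 0" "{\<psi>\<in>dual T. \<forall>b\<in>B. \<bar>\<psi> b - \<phi> b\<bar> < e} \<subseteq> U"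
        using U unfolding opn_def by meson
      moreover from this obtain \<psi> where "\<psi> \<in> S" "\<forall>b\<in>B. \<bar>\<psi> b - \<phi> b\<bar> < e"
        using \<phi> by blast
      ultimately show ?thesis using S by blast
    qed
    then show "\<phi> \<in> strong_topology T closure_of S"
      using \<phi> by (auto simp: in_closure_of openin top)
  qed
qed

text \<open>Finite sets are bounded, so strong approximation includes pointwise
  approximation.\<close>

lemma strong_closure_subset:
  assumes "S \<subseteq> dual T"
  shows "strong_topology T closure_of S \<subseteq> closure S"
proof
  fix \<phi> assume \<phi>: "\<phi> \<in> strong_topology T closure_of S"
  show "\<phi> \<in> closure S"
    unfolding in_closure_fun_iff
  proof (intro allI impI)
    fix F :: "'a set" and r :: real
    assume "finite F \<and> r > 0"
    then show "\<exists>y\<in>S. y \<in> fun_box \<phi> F r"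
      using \<phi> tvs_bounded_finite[of F] unfolding in_strong_closure_iff[OF assms] fun_box_def by blast
  qed
qed

end

section \<open>Tameness and closed convex hulls\<close>

text \<open>Remainder and quotient determine \<open>u\<close>. This is the counting behind the
  equidistribution of remainders at all levels up to L.\<close>

lemma card_mod_in_le:
  assumes "finite A" "k \<le> L"
  shows "card {u::nat. u < 2 ^ L \<and> u mod 2 ^ k \<in> A} \<le> card A * 2 ^ (L - k)"
proof -
  have "(2::nat) ^ L = 2 ^ (L - k) * 2 ^ k"
    using assms(2) by (simp flip: power_add)
  then have "u div 2 ^ k < 2 ^ (L - k)" if "u < 2 ^ L" for u :: nat
    using that by (simp add: less_mult_imp_div_less)
  then have "card {u::nat. u < 2 ^ L \<and> u mod 2 ^ k \<in> A} \<le> card (A \<times> {..<(2::nat) ^ (L - k)})"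
    using assms(1)
    by (intro card_inj_on_le[where f = "\<lambda>u. (u mod 2 ^ k, u div 2 ^ k)"])
       (auto simp: inj_on_def, metis div_mult_mod_eq)
  then show ?thesis
    by (simp add: card_cartesian_product)
qed

context seminorm_family
begin

section \<open>Bounded \<open>l\<^sup>1\<close>-sequences and independent sequences\<close>

text \<open>The lower estimate says that \<open>\<rho>\<close> dominates the functional with values
  \<open>d * s n\<close> on the span. Feeding its graph to Mazur-Orlicz extends it and spares
  checking separately that it is well defined.\<close>

lemma l1_sequence_functional:
  fixes x :: "nat \<Rightarrow> 'a" and s :: "nat \<Rightarrow> real"
  assumes \<rho>: "seminorm \<rho>" and d: "0 < d"
    and l1: "\<And>n c. d * (\<Sum>i\<le>n. \<bar>c i\<bar>) \<le> \<rho> (\<Sum>i\<le>n. c i *\<^sub>R x i)"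
    and s: "\<And>n. \<bar>s n\<bar> \<le> 1"
  obtains \<phi> where "\<phi> \<in> polar_set \<rho>" "\<And>n. \<phi> (x n) = d * s n"
proof -
  \<comment> \<open>Coefficients vanish beyond \<open>N\<close>, so two elements can be padded to a
    common length.\<close>
  define D where "D = {(\<Sum>i\<le>N. c i *\<^sub>R x i, d * (\<Sum>i\<le>N. c i * s i)) |N c. \<forall>i>N. c i = 0}"
  have extend: "(\<Sum>i\<le>M. c i *\<^sub>R x i, d * (\<Sum>i\<le>M. c i * s i)) = (\<Sum>i\<le>N. c i *\<^sub>R x i, d * (\<Sum>i\<le>N. c i * s i))"
    if "\<forall>i>N. c i = 0" "N \<le> M" for N M and c :: "nat \<Rightarrow> real"
  proof -
    have "c i = 0" if "i \<in> {..M} - {..N}" for i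
      using that \<open>\<forall>i>N. c i = 0\<close> by simp
    then have "(\<Sum>i\<le>M. c i *\<^sub>R x i) = (\<Sum>i\<le>N. c i *\<^sub>R x i)" "(\<Sum>i\<le>M. c i * s i) = (\<Sum>i\<le>N. c i * s i)"
      using \<open>N \<le> M\<close> by (intro sum.mono_neutral_right ballI; simp)+
    then show ?thesis by simp
  qed
  have "convex D"
  proof (rule convexI)
    fix a b and u v :: real
    assume ab: "a \<in> D" "b \<in> D" and "0 \<le> u" "0 \<le> v" "u + v = 1"
    obtain N c where a: "\<forall>i>N. c i = 0" "a = (\<Sum>i\<le>N. c i *\<^sub>R x i, d * (\<Sum>i\<le>N. c i * s i))"
      using ab(1) unfolding D_def by auto
    obtain N' c' where b: "\<forall>i>N'. c' i = 0" "b = (\<Sum>i\<le>N'. c' i *\<^sub>R x i, d * (\<Sum>i\<le>N'. c' i * s i))"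
      using ab(2) unfolding D_def by auto
    define M where "M = max N N'"
    have a': "a = (\<Sum>i\<le>M. c i *\<^sub>R x i, d * (\<Sum>i\<le>M. c i * s i))"
      unfolding a(2) by (rule extend[OF a(1), symmetric]) (simp add: M_def)
    have b': "b = (\<Sum>i\<le>M. c' i *\<^sub>R x i, d * (\<Sum>i\<le>M. c' i * s i))"
      unfolding b(2) by (rule extend[OF b(1), symmetric]) (simp add: M_def)
    define e where "e i = u * c i + v * c' i" for i
    have "u *\<^sub>R a + v *\<^sub>R b = (\<Sum>i\<le>M. e i *\<^sub>R x i, d * (\<Sum>i\<le>M. e i * s i))"
      unfolding a' b' e_def
      by (simp add: scaleR_sum_right sum.distrib sum_distrib_left scaleR_add_left algebra_simps)
    moreover have "\<forall>i>M. e i = 0"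
      using a(1) b(1) by (simp add: e_def M_def)
    ultimately show "u *\<^sub>R a + v *\<^sub>R b \<in> D"
      unfolding D_def by blast
  qed
  moreover have "r \<le> \<rho> w" if wr: "(w, r) \<in> D" for w r
  proof -
    obtain N c where c: "w = (\<Sum>i\<le>N. c i *\<^sub>R x i)" "r = d * (\<Sum>i\<le>N. c i * s i)"
      using wr unfolding D_def by auto
    have "c i * s i \<le> \<bar>c i\<bar>" for i
      using mult_left_mono[OF s[of i], of "\<bar>c i\<bar>"] abs_ge_self[of "c i * s i"] by (simp add: abs_mult)
    then have "r \<le> d * (\<Sum>i\<le>N. \<bar>c i\<bar>)"
      unfolding c using d by (intro mult_left_mono sum_mono) auto
    then show ?thesis
      using l1[where n = N and c = c] c(1) by simp
  qed
  moreover have single: "(t *\<^sub>R x n, d * (t * s n)) \<in> D" for n t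
  proof -
    have "(\<Sum>i\<le>n. (if i = n then t else 0) *\<^sub>R x i) = t *\<^sub>R x n"
      "(\<Sum>i\<le>n. (if i = n then t else 0) * s i) = t * s n"
      by (simp_all add: if_distrib[of "\<lambda>r. r *\<^sub>R _"] if_distrib[of "\<lambda>r. r * _"] cong: if_cong)
    then show ?thesis
      unfolding D_def by (intro CollectI exI[of _ n] exI[of _ "\<lambda>i. if i = n then t else 0"]) simp
  qed
  moreover have "D \<noteq> {}"
    using single by blast
  ultimately obtain f where f: "linear f" "\<And>x. f x \<le> \<rho> x" "\<And>w r. (w, r) \<in> D \<Longrightarrow> r \<le> f w"
    using Mazur_Orlicz[OF seminorm_sublinear[OF \<rho>], of D] by blast
  \<comment> \<open>The coefficients 1 and -1 give the two inequalities.\<close>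
  have "f (x n) = d * s n" for n
    using f(3)[OF single[of 1 n]] f(3)[OF single[of "-1" n]] linear_neg[OF f(1), of "x n"] by simp
  then show thesis
    using that[of f] f by (simp add: polar_set_def)
qed

text \<open>On the polar of the seminorm all patterns of the values d and -d occur, so half these
  values separate them strictly.\<close>

lemma l1_sequence_not_tame:
  assumes "l1_sequence T x"
  shows "\<not> tame_lcs T"
proof
  assume tame: "tame_lcs T"
  obtain \<rho> d where B: "tvs_bounded T (range x)" and \<rho>: "continuous_seminorm T \<rho>" and d: "d > 0"
    and l1: "\<And>n c. d * (\<Sum>i\<le>n. \<bar>c i\<bar>) \<le> \<rho> (\<Sum>i\<le>n. c i *\<^sub>R x i)"
    using assms unfolding l1_sequence_def by blast
  have sn: "seminorm \<rho>"
    using \<rho> by (simp add: continuous_seminorm_def)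
  have "independent_seq (polar_set \<rho>) (\<lambda>n \<phi>. \<phi> (x n))"
    unfolding independent_seq_def
  proof (rule exI[of _ "- d / 2"], rule exI[of _ "d / 2"], intro conjI allI impI)
    fix P M :: "nat set"
    assume PM: "finite P \<and> finite M \<and> P \<inter> M = {}"
    define s where "s n = (if n \<in> P then -1 else 1 :: real)" for n
    have "\<bar>s n\<bar> \<le> 1" for n
      by (simp add: s_def)
    then obtain \<phi> where \<phi>: "\<phi> \<in> polar_set \<rho>" "\<And>n. \<phi> (x n) = d * s n"
      using l1_sequence_functional[OF sn d l1, of s] by blast
    have "\<phi> (x n) < - d / 2" if "n \<in> P" for n
      using \<phi>(2)[of n] that d by (simp add: s_def)
    moreover have "d / 2 < \<phi> (x n)" if "n \<in> M" for n
      using \<phi>(2)[of n] that d PM by (auto simp: s_def)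
    ultimately show "polar_set \<rho> \<inter> (\<Inter>n\<in>P. {\<phi>. \<phi> (x n) < - d / 2}) \<inter> (\<Inter>n\<in>M. {\<phi>. d / 2 < \<phi> (x n)}) \<noteq> {}"
      using \<phi>(1) by blast
  qed (use d in simp)
  then have "\<not> tame_family (polar_set \<rho>) ((\<lambda>b \<phi>. \<phi> b) ` range x)"
    unfolding tame_family_def by (auto intro!: exI[of _ "\<lambda>n \<phi>. \<phi> (x n)"])
  moreover have "polar_set \<rho> \<in> eqc T"
    using closed_subset_polar_eqc[OF \<rho> order_refl closed_polar_set] .
  ultimately show False
    using tame B unfolding tame_lcs_def by blast
qed

text \<open>Two functionals realise the sign pattern of the coefficients and its opposite. Their
  difference gains at least \<open>b - a\<close> per unit of coefficient and is at most twice the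
  seminorm, hence the constant \<open>(b - a) / 2\<close>. A difference is needed because the two
  levels may lie on the same side of 0.\<close>

lemma not_tame_l1_sequence:
  assumes "\<not> tame_lcs T"
  shows "\<exists>x. l1_sequence T x"
proof -
  obtain B K where B: "tvs_bounded T B" and K: "K \<in> eqc T" and nt: "\<not> tame_family K ((\<lambda>b \<phi>. \<phi> b) ` B)"
    using assms unfolding tame_lcs_def by blast
  obtain f where f: "range f \<subseteq> (\<lambda>b \<phi>. \<phi> b) ` B" "independent_seq K f"
    using nt unfolding tame_family_def by blast
  have "\<forall>n. \<exists>b. b \<in> B \<and> f n = (\<lambda>\<phi>. \<phi> b)"
    using f(1) by (auto simp: subset_eq image_iff)
  then obtain x where x: "\<And>n. x n \<in> B" "\<And>n. f n = (\<lambda>\<phi>. \<phi> (x n))"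
    by (metis (full_types))
  obtain \<rho> where \<rho>: "continuous_seminorm T \<rho>" "K \<subseteq> polar_set \<rho>"
    using eqc_subset_polar[OF K] .
  have sn: "seminorm \<rho>"
    using \<rho>(1) by (simp add: continuous_seminorm_def)
  from f(2) obtain a b where ab: "a < b" and
    ind: "\<forall>P M. finite P \<and> finite M \<and> P \<inter> M = {} \<longrightarrow>
      K \<inter> (\<Inter>n\<in>P. {\<phi>. f n \<phi> < a}) \<inter> (\<Inter>n\<in>M. {\<phi>. b < f n \<phi>}) \<noteq> {}"
    unfolding independent_seq_def by (elim exE conjE)
  have pattern: "\<exists>\<phi>\<in>K. (\<forall>n\<in>P. \<phi> (x n) < a) \<and> (\<forall>n\<in>M. b < \<phi> (x n))"
    if "finite P" "finite M" "P \<inter> M = {}" for P M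
  proof -
    have "K \<inter> (\<Inter>n\<in>P. {\<phi>. f n \<phi> < a}) \<inter> (\<Inter>n\<in>M. {\<phi>. b < f n \<phi>}) \<noteq> {}"
      using that by (intro ind[rule_format]) auto
    then show ?thesis
      unfolding x(2) by blast
  qed
  have "(b - a) / 2 * (\<Sum>i\<le>n. \<bar>c i\<bar>) \<le> \<rho> (\<Sum>i\<le>n. c i *\<^sub>R x i)" for n and c :: "nat \<Rightarrow> real"
  proof -
    define P where "P = {i. i \<le> n \<and> c i < 0}"
    define M where "M = {i. i \<le> n \<and> 0 \<le> c i}"
    have PM: "finite P" "finite M" "P \<inter> M = {}" "M \<inter> P = {}"
      by (auto simp: P_def M_def)
    obtain \<phi> where \<phi>: "\<phi> \<in> K" "\<forall>n\<in>P. \<phi> (x n) < a" "\<forall>n\<in>M. b < \<phi> (x n)"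
      using pattern[OF PM(1,2,3)] by blast
    obtain \<psi> where \<psi>: "\<psi> \<in> K" "\<forall>n\<in>M. \<psi> (x n) < a" "\<forall>n\<in>P. b < \<psi> (x n)"
      using pattern[OF PM(2,1,4)] by blast
    have lin: "linear \<phi>" "linear \<psi>"
      using \<phi>(1) \<psi>(1) \<rho>(2) by (auto simp: polar_set_def)
    define y where "y = (\<Sum>i\<le>n. c i *\<^sub>R x i)"
    have "(b - a) * \<bar>c i\<bar> \<le> c i * \<phi> (x i) - c i * \<psi> (x i)" if "i \<le> n" for i
    proof (cases "c i < 0")
      case True
      then have "b - a \<le> \<psi> (x i) - \<phi> (x i)"
        using \<phi>(2) \<psi>(3) that by (force simp: P_def)
      then have "(b - a) * (- c i) \<le> (\<psi> (x i) - \<phi> (x i)) * (- c i)"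
        using True by (intro mult_right_mono) auto
      then show ?thesis
        using True by (simp add: algebra_simps)
    next
      case False
      then have "b - a \<le> \<phi> (x i) - \<psi> (x i)"
        using \<phi>(3) \<psi>(2) that by (force simp: M_def)
      then have "(b - a) * c i \<le> (\<phi> (x i) - \<psi> (x i)) * c i"
        using False by (intro mult_right_mono) auto
      then show ?thesis
        using False by (simp add: algebra_simps)
    qed
    then have "(\<Sum>i\<le>n. (b - a) * \<bar>c i\<bar>) \<le> (\<Sum>i\<le>n. c i * \<phi> (x i) - c i * \<psi> (x i))"
      by (intro sum_mono) auto
    also have "\<dots> = \<phi> y - \<psi> y"
      using lin by (simp add: y_def sum_subtractf linear_sum linear_scale)
    also have "\<dots> \<le> 2 * \<rho> y"
      using polar_set_abs[OF sn, of \<phi> y] polar_set_abs[OF sn, of \<psi> y] \<phi>(1) \<psi>(1) \<rho>(2) by (auto simp: subset_eq)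
    finally show ?thesis
      by (simp add: y_def sum_distrib_left[symmetric])
  qed
  moreover have "tvs_bounded T (range x)"
  proof (rule tvs_boundedI)
    fix p assume "p \<in> P"
    then obtain c where "\<And>b. b \<in> B \<Longrightarrow> p b \<le> c"
      using tvs_bounded_seminorm[OF B continuous_seminorm_P] by blast
    then show "\<exists>c. \<forall>b\<in>range x. p b \<le> c"
      using x(1) by blast
  qed
  moreover have "(b - a) / 2 > 0"
    using ab by simp
  ultimately show ?thesis
    unfolding l1_sequence_def using \<rho>(1) by blast
qed

lemma tame_imp_strong_Krein_Milman:
  assumes tame: "tame_lcs T" and M: "M \<in> eqc T" "convex M"
  shows "M = strong_topology T closure_of (convex hull {\<phi>. \<phi> extreme_point_of M})"
proof -
  define X where "X = {\<phi>. \<phi> extreme_point_of M}"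
  have M': "M \<subseteq> dual T" "compact M"
    using M(1) by (auto simp: eqc_iff)
  have XM: "X \<subseteq> M"
    by (auto simp: X_def extreme_point_of_def)
  have hull: "convex hull X \<subseteq> M"
    using XM M(2) by (intro hull_minimal) auto
  then have hull_dual: "convex hull X \<subseteq> dual T"
    using M'(1) by simp
  obtain \<rho> where \<rho>: "continuous_seminorm T \<rho>" "M \<subseteq> polar_set \<rho>"
    using eqc_subset_polar[OF M(1)] .
  have sn: "seminorm \<rho>"
    using \<rho>(1) by (simp add: continuous_seminorm_def)
  have "\<phi> \<in> strong_topology T closure_of (convex hull X)" if \<phi>: "\<phi> \<in> M" for \<phi>
  proof (rule ccontr)
    assume "\<phi> \<notin> strong_topology T closure_of (convex hull X)"
    then obtain B0 e where B0: "tvs_bounded T B0" "e > 0"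
      and far: "\<And>\<psi>. \<psi> \<in> convex hull X \<Longrightarrow> \<exists>b\<in>B0. e \<le> \<bar>\<psi> b - \<phi> b\<bar>"
      using \<phi> M'(1) unfolding in_strong_closure_iff[OF hull_dual] by (meson not_le subsetD)
    \<comment> \<open>Convexity feeds the minimax; symmetry turns a one-sided bound on
      \<open>B\<close> into a two-sided one on \<open>B0\<close>.\<close>
    define B where "B = convex hull (B0 \<union> uminus ` B0)"
    have B: "tvs_bounded T B"
      unfolding B_def by (rule tvs_bounded_absolute_hull[OF B0(1)])
    have B0B: "b \<in> B" "- b \<in> B" if "b \<in> B0" for b
      using that hull_subset[of "B0 \<union> uminus ` B0" convex] unfolding B_def by auto
    obtain R where R: "\<And>b. b \<in> B \<Longrightarrow> \<rho> b \<le> R"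
      using tvs_bounded_seminorm[OF B \<rho>(1)] by blast
    have bound: "\<bar>y b\<bar> \<le> R" if "y \<in> M" "b \<in> B" for y b
      using polar_set_abs[OF sn, of y b] that \<rho>(2) R by (meson order_trans subsetD)
    have linM: "linear y" if "y \<in> M" for y
      using that M'(1) by (auto simp: dual_def)
    have "X \<noteq> {}"
    proof
      assume "X = {}"
      then have "M \<subseteq> {}"
        using compact_convex_contains_extreme[OF M'(2) M(2), of "{}"] by (auto simp: X_def)
      then show False using \<phi> by simp
    qed
    \<comment> \<open>If no \<open>g\<close> separates, minimax yields weights whose combination
      \<open>\<theta>\<close> of \<open>F\<close> is within \<open>e / 2\<close> of
      \<open>\<phi>\<close> on \<open>B0\<close>, contradicting \<open>far\<close>.\<close>
    have sep': "\<exists>g\<in>B. \<forall>\<psi>\<in>F. \<phi> g + e / 2 \<le> \<psi> g" if F: "finite F" "F \<subseteq> X" "F \<noteq> {}" for F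
    proof (rule ccontr)
      assume no: "\<not> ?thesis"
      \<comment> \<open>Functions outside \<open>M\<close> need not be linear; the value 0 there
        makes \<open>v\<close> linear in \<open>g\<close>, so the image of \<open>B\<close> is
        convex.\<close>
      define v where "v g = (\<lambda>\<psi>. if \<psi> \<in> M then \<psi> g - \<phi> g else 0)" for g
      have "convex (v ` B)"
      proof (rule convexI)
        fix y z and s t :: real
        assume *: "y \<in> v ` B" "z \<in> v ` B" "0 \<le> s" "0 \<le> t" "s + t = 1"
        then obtain g g' where g: "g \<in> B" "y = v g" "g' \<in> B" "z = v g'" by blast
        have lin_comb: "\<psi> (s *\<^sub>R g + t *\<^sub>R g') = s * \<psi> g + t * \<psi> g'" if "\<psi> \<in> M" for \<psi>
          using linM[OF that] by (simp add: linear_add linear_scale)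
        have "s *\<^sub>R y + t *\<^sub>R z = v (s *\<^sub>R g + t *\<^sub>R g')"
          unfolding g(2,4) v_def using lin_comb \<phi>
          by (auto simp: fun_eq_iff algebra_simps)
        moreover have "s *\<^sub>R g + t *\<^sub>R g' \<in> B"
          using g * unfolding B_def by (intro convexD[OF convex_convex_hull]) auto
        ultimately show "s *\<^sub>R y + t *\<^sub>R z \<in> v ` B" by simp
      qed
      moreover have "v ` B \<noteq> {}"
        using far B0B(1) \<open>X \<noteq> {}\<close> hull_subset[of X convex] by blast
      moreover have "\<exists>\<psi>\<in>F. w \<psi> \<le> e / 2" if w: "w \<in> v ` B" for w
      proof -
        obtain g where "g \<in> B" "w = v g" using w by blast
        moreover from this obtain \<psi> where "\<psi> \<in> F" "\<psi> g < \<phi> g + e / 2"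
          using no by (meson not_le)
        ultimately show ?thesis
          using F(2) XM by (intro bexI[of _ \<psi>]) (auto simp: v_def)
      qed
      ultimately obtain l where l: "\<And>\<psi>. \<psi> \<in> F \<Longrightarrow> 0 \<le> l \<psi>" "sum l F = 1"
          "\<And>w. w \<in> v ` B \<Longrightarrow> (\<Sum>\<psi>\<in>F. l \<psi> * w \<psi>) \<le> e / 2"
        using finite_minimax[OF F(1,3), of "v ` B" "e / 2"] by blast
      define \<theta> where "\<theta> = (\<Sum>\<psi>\<in>F. l \<psi> *\<^sub>R \<psi>)"
      have \<theta>: "\<theta> \<in> convex hull X"
        unfolding \<theta>_def using F l hull_subset[of X convex]
        by (intro convex_sum convex_convex_hull) auto
      have \<theta>_le: "\<theta> g - \<phi> g \<le> e / 2" if g: "g \<in> B" for g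
      proof -
        have "(\<Sum>\<psi>\<in>F. l \<psi> * v g \<psi>) = (\<Sum>\<psi>\<in>F. l \<psi> * \<psi> g - l \<psi> * \<phi> g)"
          using F(2) XM by (intro sum.cong refl) (auto simp: v_def right_diff_distrib)
        also have "\<dots> = \<theta> g - \<phi> g"
          using l(2) by (simp add: \<theta>_def sum_subtractf flip: sum_distrib_right)
        finally show ?thesis
          using l(3)[of "v g"] g by simp
      qed
      obtain b where b: "b \<in> B0" "e \<le> \<bar>\<theta> b - \<phi> b\<bar>"
        using far[OF \<theta>] by blast
      have "\<theta> (- b) = - \<theta> b" "\<phi> (- b) = - \<phi> b"
        using linM \<phi> \<theta> hull by (auto simp: linear_neg subset_eq)
      then show False
        using \<theta>_le[OF B0B(1)[OF b(1)]] \<theta>_le[OF B0B(2)[OF b(1)]] b(2) B0(2) by linarith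
    qed
    \<comment> \<open>Minimax needs a nonempty set, and adding a point only strengthens the
      claim.\<close>
    have sep: "\<exists>g\<in>B. \<forall>\<psi>\<in>F. \<phi> g + e / 2 \<le> \<psi> g" if F: "finite F" "F \<subseteq> X" for F
    proof -
      obtain \<psi> where "\<psi> \<in> X" using \<open>X \<noteq> {}\<close> by blast
      then show ?thesis using sep'[of "insert \<psi> F"] F by auto
    qed
    obtain h where h: "\<And>S r. finite S \<Longrightarrow> S \<subseteq> M \<Longrightarrow> r > 0 \<Longrightarrow> \<exists>b\<in>B. \<forall>y\<in>S. \<bar>y b - h y\<bar> < r"
      "\<And>x y u. x \<in> M \<Longrightarrow> y \<in> M \<Longrightarrow> 0 \<le> u \<Longrightarrow> u \<le> 1 \<Longrightarrow>
         h (u *\<^sub>R x + (1 - u) *\<^sub>R y) = u * h x + (1 - u) * h y"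
      "\<And>\<psi>. \<psi> \<in> X \<Longrightarrow> h \<phi> + e / 2 \<le> h \<psi>"
    proof (rule affine_cluster_point[of M B R \<phi> X "e / 2"])
      show "\<bar>y b\<bar> \<le> R" if "y \<in> M" "b \<in> B" for y b
        by (rule bound[OF that])
      show "\<exists>g\<in>B. \<forall>\<psi>\<in>F. \<phi> g + e / 2 \<le> \<psi> g" if "finite F" "F \<subseteq> X" for F
        by (rule sep[OF that])
    qed (rule M(2), rule \<phi>, rule XM, rule that)
    obtain j where "range j \<subseteq> B" "independent_seq M (\<lambda>n y. y (j n))"
    proof (rule affine_minimum_principle[of M B R h "h \<phi> + e / 2" \<phi>])
      show "h \<phi> + e / 2 \<le> h \<psi>" if "\<psi> extreme_point_of M" for \<psi>
        using h(3) that by (simp add: X_def)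
      show "h \<phi> < h \<phi> + e / 2"
        using B0(2) by simp
      show "\<bar>y b\<bar> \<le> R" if "y \<in> M" "b \<in> B" for y b
        by (rule bound[OF that])
      show "\<exists>b\<in>B. \<forall>y\<in>S. \<bar>y b - h y\<bar> < r" if "finite S" "S \<subseteq> M" "r > 0" for S r
        by (rule h(1)[OF that])
      show "h (u *\<^sub>R x + (1 - u) *\<^sub>R y) = u * h x + (1 - u) * h y"
        if "x \<in> M" "y \<in> M" "0 \<le> u" "u \<le> 1" for x y u
        by (rule h(2)[OF that])
    qed (rule M'(2), rule M(2), rule \<phi>, rule that)
    then have "\<not> tame_family M ((\<lambda>b \<phi>. \<phi> b) ` B)"
      unfolding tame_family_def by (auto intro!: exI[of _ "\<lambda>n y. y (j n)"])
    then show False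
      using tame B M(1) unfolding tame_lcs_def by blast
  qed
  moreover have "strong_topology T closure_of (convex hull X) \<subseteq> M"
    using strong_closure_subset[OF hull_dual] closure_minimal[OF hull compact_fun_imp_closed[OF M'(2)]] by simp
  ultimately show ?thesis
    unfolding X_def by blast
qed

lemma weak_strong_closed_hull:
  assumes KM: "\<And>M. M \<in> eqc T \<Longrightarrow> convex M \<Longrightarrow>
      M = strong_topology T closure_of (convex hull {\<phi>. \<phi> extreme_point_of M})"
    and K: "K \<in> eqc T"
  shows "weak_star T closure_of (convex hull K) = strong_topology T closure_of (convex hull K)"
proof -
  define D where "D = closure (convex hull K)"
  have D: "D \<in> eqc T" "weak_star T closure_of (convex hull K) = D" "convex D"
    unfolding D_def using eqc_closure_hull[OF K] closure_convex_fun by auto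
  have compD: "compact D" and Dd: "D \<subseteq> dual T"
    using D(1) by (auto simp: eqc_iff)
  have KD: "convex hull K \<subseteq> D"
    unfolding D_def by (rule closure_subset)
  have compK: "compact K"
    using K by (simp add: eqc_iff)
  \<comment> \<open>A cap at \<open>e\<close> that misses \<open>K\<close> would put
    \<open>K\<close>, and hence its closed hull \<open>D\<close>, into the compact convex remainder,
    which omits \<open>e\<close>.\<close>
  have Milman: "e \<in> K" if e: "e extreme_point_of D" for e
  proof (rule ccontr)
    assume "e \<notin> K"
    then have eK: "e \<in> - K" by simp
    have "open (- K)"
      by (rule open_Compl[OF compact_fun_imp_closed[OF compK]])
    from extreme_point_cap[OF compD D(3) e this eK]
    obtain C where C: "compact C" "convex C" "C \<subseteq> D" "e \<notin> C" "D - C \<subseteq> - K" .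
    have "K \<subseteq> C"
      using C(5) KD hull_subset[of K convex] by blast
    then have "D \<subseteq> C"
      unfolding D_def using C(1,2) compact_fun_imp_closed by (intro closure_minimal hull_minimal) auto
    then show False
      using e C(4) by (auto simp: extreme_point_of_def)
  qed
  have "D = strong_topology T closure_of (convex hull {\<phi>. \<phi> extreme_point_of D})"
    by (rule KM[OF D(1,3)])
  also have "\<dots> \<subseteq> strong_topology T closure_of (convex hull K)"
    using Milman by (intro closure_of_mono hull_mono) auto
  finally have "D \<subseteq> strong_topology T closure_of (convex hull K)" .
  moreover have "strong_topology T closure_of (convex hull K) \<subseteq> D"
    using strong_closure_subset[of "convex hull K"] KD Dd unfolding D_def by blast
  ultimately show ?thesis
    using D(2) by blast
qed

text \<open>Index the sequence by pairs (k, m). The functionals in S pick for every k a number i below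
  2^k, with value d or -d at (k, m) according to whether i lies in the finite set coded by m.
  Averages of such functionals with equidistributed i have nonpositive limits at (k, m) once the set
  coded by m has at most 2^(k-1) elements, while a convex combination of few functionals from S takes the
  value d at a suitable (k, m).\<close>

lemma l1_sequence_closed_hulls_differ:
  assumes l1: "l1_sequence T x"
  shows "\<exists>K\<in>eqc T. weak_star T closure_of (convex hull K) \<noteq> strong_topology T closure_of (convex hull K)"
proof -
  obtain \<rho> d where B: "tvs_bounded T (range x)" and \<rho>: "continuous_seminorm T \<rho>" and d: "d > 0"
    and l1: "\<And>n c. d * (\<Sum>i\<le>n. \<bar>c i\<bar>) \<le> \<rho> (\<Sum>i\<le>n. c i *\<^sub>R x i)"
    using l1 unfolding l1_sequence_def by blast
  have sn: "seminorm \<rho>"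
    using \<rho> by (simp add: continuous_seminorm_def)
  define y where "y k m = x (prod_encode (k, m))" for k m
  \<comment> \<open>For each level the union over \<open>i\<close> is finite, so \<open>S\<close> is
    closed and therefore weak-star compact.\<close>
  define S where "S = polar_set \<rho> \<inter>
    (\<Inter>k. \<Union>i<2 ^ k. \<Inter>m. {\<phi>. \<phi> (y k m) = (if i \<in> set_decode m then d else - d)})"
  have closed_eq: "closed {\<phi>::'a \<Rightarrow> real. \<phi> z = c}" for z c
    by (intro closed_Collect_eq continuous_on_product_coordinates continuous_on_const)
  have "closed S"
    unfolding S_def by (intro closed_Int closed_polar_set closed_INT closed_UN ballI finite_lessThan closed_eq)
  then have S: "S \<in> eqc T"
    by (intro closed_subset_polar_eqc[OF \<rho>]) (auto simp: S_def)
  \<comment> \<open>One number supplies the choice \<open>u mod 2 ^ k\<close> at all levels, so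
    averaging over \<open>u < 2 ^ L\<close> treats every level up to \<open>L\<close> at
    once.\<close>
  have "\<forall>u::nat. \<exists>\<phi>. \<phi> \<in> polar_set \<rho> \<and> (\<forall>k m. \<phi> (y k m) = (if u mod 2 ^ k \<in> set_decode m then d else - d))"
  proof
    fix u :: nat
    define s where "s n = (if u mod 2 ^ fst (prod_decode n) \<in> set_decode (snd (prod_decode n)) then 1 else - 1 :: real)" for n
    have "\<bar>s n\<bar> \<le> 1" for n
      by (simp add: s_def)
    then obtain \<phi> where "\<phi> \<in> polar_set \<rho>" "\<And>n. \<phi> (x n) = d * s n"
      using l1_sequence_functional[OF sn d l1, of s] by blast
    then show "\<exists>\<phi>. \<phi> \<in> polar_set \<rho> \<and> (\<forall>k m. \<phi> (y k m) = (if u mod 2 ^ k \<in> set_decode m then d else - d))"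
      by (intro exI[of _ \<phi>]) (simp add: y_def s_def)
  qed
  then obtain \<Phi> where \<Phi>: "\<forall>u::nat. \<Phi> u \<in> polar_set \<rho> \<and>
      (\<forall>k m. \<Phi> u (y k m) = (if u mod 2 ^ k \<in> set_decode m then d else - d))"
    by (rule choice[THEN exE])
  have \<Phi>S: "\<Phi> u \<in> S" for u
  proof -
    have "\<Phi> u \<in> (\<Union>i<2 ^ k. \<Inter>m. {\<phi>. \<phi> (y k m) = (if i \<in> set_decode m then d else - d)})" for k
      using \<Phi> by (intro UN_I[of "u mod 2 ^ k"]) auto
    then show ?thesis
      unfolding S_def using \<Phi> by blast
  qed
  define D where "D = closure (convex hull S)"
  have compD: "compact D"
    unfolding D_def using eqc_closure_hull(1)[OF S] by (simp add: eqc_iff)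
  define Z where "Z k = {\<phi> :: 'a \<Rightarrow> real. \<forall>m. 2 * card (set_decode m) \<le> 2 ^ k \<longrightarrow> \<phi> (y k m) \<le> 0}" for k
  have average: "\<exists>\<psi>\<in>convex hull S. \<forall>k\<le>L. \<psi> \<in> Z k" for L
  proof
    define \<psi> where "\<psi> = (\<Sum>u<2 ^ L. (1 / 2 ^ L) *\<^sub>R \<Phi> u)"
    show "\<psi> \<in> convex hull S"
      unfolding \<psi>_def using \<Phi>S hull_subset[of S convex]
      by (intro convex_sum convex_convex_hull) auto
    show "\<forall>k\<le>L. \<psi> \<in> Z k"
      unfolding Z_def
    proof (intro allI impI CollectI)
      fix k m assume k: "k \<le> L" and m: "2 * card (set_decode m) \<le> 2 ^ k"
      \<comment> \<open>Members of \<open>U\<close> contribute \<open>d\<close> and the others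
        \<open>- d\<close>; the bound on \<open>m\<close> makes \<open>U\<close> at most half of the
        range.\<close>
      define U where "U = {u::nat. u < 2 ^ L \<and> u mod 2 ^ k \<in> set_decode m}"
      have "(\<Sum>u<2 ^ L. \<Phi> u (y k m)) = (\<Sum>u<2 ^ L. (if u \<in> U then 2 * d else 0) - d)"
        using \<Phi> by (intro sum.cong) (auto simp: U_def)
      also have "\<dots> = real (card ({..<2 ^ L} \<inter> U)) * (2 * d) - 2 ^ L * d"
        by (simp add: sum_subtractf sum.If_cases)
      also have "{..<2 ^ L} \<inter> U = U"
        by (auto simp: U_def)
      also have "real (card U) * (2 * d) - 2 ^ L * d \<le> 0"
      proof -
        have "2 * card U \<le> 2 * card (set_decode m) * 2 ^ (L - k)"
          unfolding U_def using card_mod_in_le[OF finite_set_decode k, of m] by simp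
        also have "\<dots> \<le> 2 ^ k * 2 ^ (L - k)"
          using m by (rule mult_right_mono) simp
        also have "\<dots> = 2 ^ L"
          using k by (simp flip: power_add)
        finally have "real (2 * card U) \<le> real (2 ^ L)"
          by (rule of_nat_mono)
        then show ?thesis
          using d mult_right_mono[of "2 * real (card U)" "2 ^ L" d] by simp
      qed
      finally have "(\<Sum>u<2 ^ L. \<Phi> u (y k m)) \<le> 0" .
      moreover have "\<psi> (y k m) = (1 / 2 ^ L) * (\<Sum>u<2 ^ L. \<Phi> u (y k m))"
        by (simp add: \<psi>_def sum_divide_distrib)
      ultimately show "\<psi> (y k m) \<le> 0"
        by (simp add: mult_nonneg_nonpos divide_nonpos_pos)
    qed
  qed
  \<comment> \<open>An average handles only levels up to \<open>L\<close>. As the conditions are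
    closed, compactness of \<open>D\<close> gives one functional obeying all of them.\<close>
  have "closed (Z k)" for k
    unfolding Z_def by (intro closed_Collect_all closed_Collect_imp open_Collect_const closed_coordinate_le)
  then have "\<forall>a\<in>range Z. closed a" by blast
  moreover have "\<forall>\<B>\<subseteq>range Z. finite \<B> \<longrightarrow> D \<inter> \<Inter>\<B> \<noteq> {}"
  proof (intro allI impI)
    fix \<B> assume "\<B> \<subseteq> range Z" "finite \<B>"
    then obtain I where I: "finite I" "\<B> = Z ` I"
      by (meson finite_subset_image)
    obtain L where L: "\<forall>k\<in>I. k \<le> L"
      using I(1) finite_nat_set_iff_bounded_le by blast
    obtain \<psi> where "\<psi> \<in> convex hull S" "\<forall>k\<le>L. \<psi> \<in> Z k"
      using average by blast
    then have "\<psi> \<in> D \<inter> \<Inter>\<B>"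
      using I(2) L closure_subset[of "convex hull S"] unfolding D_def by blast
    then show "D \<inter> \<Inter>\<B> \<noteq> {}" by blast
  qed
  ultimately have "D \<inter> \<Inter>(range Z) \<noteq> {}"
    using compD unfolding compact_fip by (meson)
  then obtain \<psi> where \<psi>: "\<psi> \<in> D" "\<And>k. \<psi> \<in> Z k"
    by blast
  have "\<psi> \<notin> strong_topology T closure_of (convex hull S)"
  proof
    assume \<psi>_cl: "\<psi> \<in> strong_topology T closure_of (convex hull S)"
    have hull_dual: "convex hull S \<subseteq> dual T"
      using eqc_closure_hull(1)[OF S] closure_subset[of "convex hull S"] by (auto simp: eqc_iff)
    have "\<exists>\<theta>\<in>convex hull S. \<forall>b\<in>range x. \<bar>\<theta> b - \<psi> b\<bar> < d"
      using in_strong_closure_iff[OF hull_dual, of \<psi>] \<psi>_cl B d by blast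
    then obtain \<theta> where \<theta>: "\<theta> \<in> convex hull S" "\<forall>b\<in>range x. \<bar>\<theta> b - \<psi> b\<bar> < d" ..
    from \<theta>(1) obtain I w where I: "finite I" "I \<subseteq> S" "sum w I = 1" "(\<Sum>\<phi>\<in>I. w \<phi> *\<^sub>R \<phi>) = \<theta>"
      unfolding convex_hull_explicit mem_Collect_eq by (elim exE conjE)
    \<comment> \<open>At any level the members of \<open>I\<close> account for at most
      \<open>card I\<close> choices, and \<open>card I < 2 ^ card I\<close> makes this at most half
      of \<open>2 ^ k\<close>.\<close>
    define k where "k = Suc (card I)"
    have "\<forall>\<phi>\<in>I. \<exists>i. \<forall>m. \<phi> (y k m) = (if i \<in> set_decode m then d else - d)"
    proof
      fix \<phi> assume "\<phi> \<in> I"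
      then have "\<phi> \<in> (\<Union>i<2 ^ k. \<Inter>m. {\<phi>. \<phi> (y k m) = (if i \<in> set_decode m then d else - d)})"
        using I(2) unfolding S_def by blast
      then show "\<exists>i. \<forall>m. \<phi> (y k m) = (if i \<in> set_decode m then d else - d)"
        by blast
    qed
    then obtain f where f: "\<forall>\<phi>\<in>I. \<forall>m. \<phi> (y k m) = (if f \<phi> \<in> set_decode m then d else - d)"
      by (rule bchoice[THEN exE])
    \<comment> \<open>Coding exactly the choices made gives every member of \<open>I\<close> the
      value \<open>d\<close> at \<open>(k, m)\<close>, whatever the weights, while
      \<open>\<psi>\<close> is nonpositive there.\<close>
    define m where "m = set_encode (f ` I)"
    have m: "set_decode m = f ` I"
      unfolding m_def using I(1) by (simp add: set_encode_inverse)
    have "card (f ` I) \<le> 2 ^ card I"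
      using card_image_le[OF I(1), of f] less_exp[of "card I"] by linarith
    then have "2 * card (set_decode m) \<le> 2 ^ k"
      unfolding m k_def by simp
    then have "\<psi> (y k m) \<le> 0"
      using \<psi>(2)[of k] by (simp add: Z_def)
    moreover have "\<theta> (y k m) = d"
    proof -
      have "\<theta> (y k m) = (\<Sum>\<phi>\<in>I. w \<phi> * \<phi> (y k m))"
        unfolding I(4)[symmetric] by simp
      also have "\<dots> = (\<Sum>\<phi>\<in>I. w \<phi> * d)"
        using f by (intro sum.cong) (auto simp: m)
      finally show ?thesis
        using I(3) by (simp flip: sum_distrib_right)
    qed
    moreover have "\<bar>\<theta> (y k m) - \<psi> (y k m)\<bar> < d"
      using \<theta>(2) unfolding y_def by blast
    ultimately show False by linarith
  qed
  then show ?thesis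
    using S \<psi>(1) eqc_closure_hull(2)[OF S] unfolding D_def by metis
qed

end

theorem theorem9p12:
  fixes T :: "'a::real_vector topology"
  assumes "locally_convex_space T"
  shows "((\<not> (\<exists>x. l1_sequence T x)) \<longleftrightarrow> tame_lcs T)
    \<and> (tame_lcs T \<longleftrightarrow>
         (\<forall>M. M \<subseteq> dual T \<and> compactin (weak_star T) M \<and> equicontinuous_set T M \<and> convex M \<longrightarrow>
            M = (strong_topology T) closure_of (convex hull {\<phi>. \<phi> extreme_point_of M})))
    \<and> (tame_lcs T \<longleftrightarrow>
         (\<forall>K\<in>eqc T. (weak_star T) closure_of (convex hull K)
                    = (strong_topology T) closure_of (convex hull K)))"
proof -
  obtain P where P: "\<And>p. p \<in> P \<Longrightarrow> seminorm p" and T: "T = seminorm_topology P"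
    using assms unfolding locally_convex_space_def by blast
  interpret seminorm_family P
    by unfold_locales (rule P)
  define iii where "iii \<longleftrightarrow> (\<forall>M. M \<subseteq> dual T \<and> compactin (weak_star T) M \<and> equicontinuous_set T M \<and> convex M \<longrightarrow>
      M = (strong_topology T) closure_of (convex hull {\<phi>. \<phi> extreme_point_of M}))"
  define iv where "iv \<longleftrightarrow> (\<forall>K\<in>eqc T. (weak_star T) closure_of (convex hull K)
      = (strong_topology T) closure_of (convex hull K))"
  have iii: "iii \<longleftrightarrow> (\<forall>M. M \<in> eqc T \<longrightarrow> convex M \<longrightarrow>
      M = (strong_topology T) closure_of (convex hull {\<phi>. \<phi> extreme_point_of M}))"
    unfolding iii_def eqc_def by blast
  \<comment> \<open>The equivalences close through the cycle (ii), (iii), (iv), (i), together with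
    the equivalence of (i) and (ii).\<close>
  have "tame_lcs T \<longleftrightarrow> \<not> (\<exists>x. l1_sequence T x)"
    using l1_sequence_not_tame not_tame_l1_sequence unfolding T by blast
  moreover have "tame_lcs T \<Longrightarrow> iii"
    using tame_imp_strong_Krein_Milman unfolding iii T by blast
  moreover have "iii \<Longrightarrow> iv"
    using weak_strong_closed_hull unfolding iii iv_def T by blast
  moreover have "iv \<Longrightarrow> \<not> (\<exists>x. l1_sequence T x)"
    using l1_sequence_closed_hulls_differ unfolding iv_def T by blast
  ultimately show ?thesis
    unfolding iii_def[symmetric] iv_def[symmetric] by blast
qed

end
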